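(* The twistor space of hyperbolic four-space $H^4$, with the symplectic form induced by the Levi-Civita connection on $\Lambda^+$, is symplectomorphic to the small resolution of the conifold $\{xw-yz=0\}\subset\mathbb{C}^4$, i.e. to the total space $R$ of $\mathcal{O}(-1)\oplus\mathcal{O}(-1)\to\mathbb{CP}^1$ with the symplectic form $p^*\omega_{\mathbb{C}^4}+q^*\omega_{FS}$.
   Context: The twistor space $Z$ of an oriented Riemannian four-manifold is the unit sphere bundle of the bundle $\Lambda^+$ of self-dual 2-forms. The Levi-Civita connection induces a metric connection on the vertical tangent bundle $V\to Z$ (Levi-Civita along the round fibres; parallel transport, which is isometric between fibres, in horizontal directions); its curvature is $2\pi i\,\omega$, with $\omega$ a closed real 2-form on $Z$ and the fibres oriented and signs chosen so that $2\pi\omega$ restricts to the area form of each fibre. For $H^4$, $\omega$ is symplectic, and the fibres have $\omega$-area $2$. $R$ is the total space of $\mathcal{O}(-1)\oplus\mathcal{O}(-1)\to\mathbb{CP}^1$, with bundle projection $q\colon R\to\mathbb{CP}^1$, and $p\colon R\to\mathbb{C}^4=\mathbb{C}^2\oplus\mathbb{C}^2$ is the map induced by the tautological inclusion $\mathcal{O}(-1)\subset\underline{\mathbb{C}^2}$ on each summand; its image is the quadric cone $\{xw-yz=0\}$. $\omega_{\mathbb{C}^4}$ is the standard symplectic form and $\omega_{FS}$ the Fubini--Study form on $\mathbb{CP}^1$, normalised to have the same total area as the fibres of the twistor space. *)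

theory Defs
  imports "HOL-Analysis.Analysis"
begin

section \<open>Smooth maps and submanifolds of Euclidean space\<close>

text \<open>
  All manifolds below are embedded submanifolds of a Euclidean space and are represented by
  their underlying sets. A differential form on such a set takes a base point and tangent
  vectors of the ambient space; only its values on tangent vectors of the submanifold matter.
\<close>

primrec Ck_on :: "nat \<Rightarrow> 'a::euclidean_space set \<Rightarrow> ('a \<Rightarrow> 'b::real_normed_vector) \<Rightarrow> bool" where
  "Ck_on 0 S f \<longleftrightarrow> continuous_on S f"
| "Ck_on (Suc k) S f \<longleftrightarrow>
     f differentiable_on S \<and> (\<forall>v. Ck_on k S (\<lambda>x. frechet_derivative f (at x) v))"

text \<open>To be used for open \<open>S\<close> only.\<close>

definition smooth_on :: "'a::euclidean_space set \<Rightarrow> ('a \<Rightarrow> 'b::real_normed_vector) \<Rightarrow> bool" where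
  "smooth_on S f \<longleftrightarrow> (\<forall>k. Ck_on k S f)"

definition tangent_space :: "'a::euclidean_space set \<Rightarrow> 'a \<Rightarrow> 'a set" where
  "tangent_space M z = {v. \<exists>c e. 0 < e \<and> smooth_on {-e<..<e} c \<and> c ` {-e<..<e} \<subseteq> M \<and>
     c (0::real) = z \<and> (c has_vector_derivative v) (at 0)}"

definition smooth_map :: "'a::euclidean_space set \<Rightarrow> 'b::euclidean_space set \<Rightarrow> ('a \<Rightarrow> 'b) \<Rightarrow> bool" where
  "smooth_map M N f \<longleftrightarrow> f ` M \<subseteq> N \<and>
     (\<forall>z\<in>M. \<exists>O' F. open O' \<and> z \<in> O' \<and> smooth_on O' F \<and> (\<forall>x\<in>M \<inter> O'. F x = f x))"

definition diffeomorphism :: "'a::euclidean_space set \<Rightarrow> 'b::euclidean_space set \<Rightarrow> ('a \<Rightarrow> 'b) \<Rightarrow> bool" where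
  "diffeomorphism M N f \<longleftrightarrow> bij_betw f M N \<and> smooth_map M N f \<and> smooth_map N M (inv_into M f)"

type_synonym 'a two_form = "'a \<Rightarrow> 'a \<Rightarrow> 'a \<Rightarrow> real"

text \<open>
  The derivative of \<open>f\<close> within \<open>M\<close> is not unique as a linear map on the ambient space, but
  by the chain rule its values on tangent vectors of \<open>M\<close> are.
\<close>

definition pullback :: "'a::euclidean_space set \<Rightarrow> ('a \<Rightarrow> 'b::euclidean_space) \<Rightarrow> 'b two_form \<Rightarrow> 'a two_form" where
  "pullback M f \<eta> z u v =
     \<eta> (f z) (frechet_derivative f (at z within M) u) (frechet_derivative f (at z within M) v)"

definition symplectomorphic ::
    "'a::euclidean_space set \<Rightarrow> 'a two_form \<Rightarrow> 'b::euclidean_space set \<Rightarrow> 'b two_form \<Rightarrow> bool" where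
  "symplectomorphic M \<omega> N \<eta> \<longleftrightarrow>
     (\<exists>f. diffeomorphism M N f \<and>
       (\<forall>z\<in>M. \<forall>u\<in>tangent_space M z. \<forall>v\<in>tangent_space M z. pullback M f \<eta> z u v = \<omega> z u v))"


section \<open>Two-forms on an oriented Riemannian four-manifold\<close>

text \<open>
  The four-manifold is an open subset of \<open>\<real>\<^sup>4\<close> with metric tensor \<open>g\<close> and the standard
  orientation. A two-form at a point is its antisymmetric matrix \<open>\<alpha> $ i $ j = \<alpha>(e\<^sub>i, e\<^sub>j)\<close>.
\<close>

type_synonym metric = "real^4 \<Rightarrow> real^4^4"

definition raise :: "metric \<Rightarrow> real^4 \<Rightarrow> real^4^4 \<Rightarrow> real^4^4" where
  "raise g x \<alpha> = matrix_inv (g x) ** \<alpha> ** matrix_inv (g x)"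

text \<open>Normalised so that \<open>e\<^sup>1 \<and> e\<^sup>2\<close> has length one for an orthonormal coframe.\<close>

definition form_inner :: "metric \<Rightarrow> real^4 \<Rightarrow> real^4^4 \<Rightarrow> real^4^4 \<Rightarrow> real" where
  "form_inner g x \<alpha> \<beta> = (1/2) * (\<Sum>i\<in>UNIV. \<Sum>j\<in>UNIV. raise g x \<alpha> $ i $ j * \<beta> $ i $ j)"

definition levi_civita_symbol :: "4 \<Rightarrow> 4 \<Rightarrow> 4 \<Rightarrow> 4 \<Rightarrow> real" where
  "levi_civita_symbol i j k l =
     det (vector [axis i 1, axis j 1, axis k 1, axis l 1] :: real^4^4)"

definition hodge_star :: "metric \<Rightarrow> real^4 \<Rightarrow> real^4^4 \<Rightarrow> real^4^4" where
  "hodge_star g x \<alpha> = (\<chi> k l. (1/2) * sqrt (det (g x)) *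
     (\<Sum>i\<in>UNIV. \<Sum>j\<in>UNIV. raise g x \<alpha> $ i $ j * levi_civita_symbol i j k l))"

definition self_dual_forms :: "metric \<Rightarrow> real^4 \<Rightarrow> (real^4^4) set" where
  "self_dual_forms g x = {\<alpha>. transpose \<alpha> = - \<alpha> \<and> hodge_star g x \<alpha> = \<alpha>}"

definition christoffel :: "metric \<Rightarrow> real^4 \<Rightarrow> 4 \<Rightarrow> 4 \<Rightarrow> 4 \<Rightarrow> real" where
  "christoffel g x m i j =
     (let dg = (\<lambda>a b c. frechet_derivative (\<lambda>y. g y $ b $ c) (at x) (axis a 1))
      in (1/2) * (\<Sum>l\<in>UNIV. matrix_inv (g x) $ m $ l * (dg i j l + dg j i l - dg l i j)))"

text \<open>
  The zeroth order part of the Levi-Civita connection on two-forms: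
  \<open>\<nabla>\<^sub>v \<alpha> = D\<^sub>v \<alpha> + lc_form g x v \<alpha>\<close>.
\<close>

definition lc_form :: "metric \<Rightarrow> real^4 \<Rightarrow> real^4 \<Rightarrow> real^4^4 \<Rightarrow> real^4^4" where
  "lc_form g x v \<alpha> = (\<chi> j k. - (\<Sum>i\<in>UNIV. \<Sum>m\<in>UNIV.
     v $ i * (christoffel g x m i j * \<alpha> $ m $ k + christoffel g x m i k * \<alpha> $ j $ m)))"


section \<open>The twistor space and its two-form\<close>

definition twistor_space :: "(real^4) set \<Rightarrow> metric \<Rightarrow> ((real^4) \<times> (real^4^4)) set" where
  "twistor_space U g = {(x, \<alpha>). x \<in> U \<and> \<alpha> \<in> self_dual_forms g x \<and> form_inner g x \<alpha> \<alpha> = 1}"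

text \<open>
  The vertical tangent space \<open>V\<^sub>z\<close>, i.e. the tangent space of the fibre sphere, as a subspace
  of the fibre of \<open>\<Lambda>\<^sup>+\<close>.
\<close>

fun vertical_space :: "metric \<Rightarrow> (real^4) \<times> (real^4^4) \<Rightarrow> (real^4^4) set" where
  "vertical_space g (x, \<alpha>) = {\<beta> \<in> self_dual_forms g x. form_inner g x \<alpha> \<beta> = 0}"

fun horizontal_lift :: "metric \<Rightarrow> (real^4) \<times> (real^4^4) \<Rightarrow> real^4 \<Rightarrow> (real^4) \<times> (real^4^4)" where
  "horizontal_lift g (x, \<alpha>) v = (v, - lc_form g x v \<alpha>)"

text \<open>
  The covariant derivative in direction \<open>w\<close> of a section \<open>s\<close> of \<open>V\<close>, with \<open>w\<close> split into its
  horizontal part, which is the horizontal lift \<open>h\<close> of the projection of \<open>w\<close> to the base, and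
  its vertical part \<open>w - h\<close>. Along the fibre, a round sphere in the Euclidean space \<open>\<Lambda>\<^sup>+\<^sub>x\<close>,
  the Levi-Civita connection is the tangential projection of the flat derivative. Along \<open>h\<close>,
  the derivative is the one defined by parallel transport in \<open>\<Lambda>\<^sup>+\<close>.
\<close>

fun vertical_covd ::
    "metric \<Rightarrow> ((real^4) \<times> (real^4^4) \<Rightarrow> real^4^4) \<Rightarrow> (real^4) \<times> (real^4^4) \<Rightarrow> (real^4) \<times> (real^4^4) \<Rightarrow> real^4^4" where
  "vertical_covd g s (x, \<alpha>) w =
     (let ds = frechet_derivative s (at (x, \<alpha>));
          h = horizontal_lift g (x, \<alpha>) (fst w);
          d\<^sub>v = ds (w - h)
      in (d\<^sub>v - form_inner g x \<alpha> d\<^sub>v *\<^sub>R \<alpha>) + (ds h + lc_form g x (fst w) (s (x, \<alpha>))))"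

definition lie_bracket :: "('a::real_normed_vector \<Rightarrow> 'a) \<Rightarrow> ('a \<Rightarrow> 'a) \<Rightarrow> 'a \<Rightarrow> 'a" where
  "lie_bracket X Y z = frechet_derivative Y (at z) (X z) - frechet_derivative X (at z) (Y z)"

definition vertical_curvature ::
    "metric \<Rightarrow> ((real^4) \<times> (real^4^4) \<Rightarrow> (real^4) \<times> (real^4^4)) \<Rightarrow> ((real^4) \<times> (real^4^4) \<Rightarrow> (real^4) \<times> (real^4^4)) \<Rightarrow>
     ((real^4) \<times> (real^4^4) \<Rightarrow> real^4^4) \<Rightarrow> (real^4) \<times> (real^4^4) \<Rightarrow> real^4^4" where
  "vertical_curvature g X Y s z =
     vertical_covd g (\<lambda>z'. vertical_covd g s z' (Y z')) z (X z)
     - vertical_covd g (\<lambda>z'. vertical_covd g s z' (X z')) z (Y z)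
     - vertical_covd g s z (lie_bracket X Y z)"

text \<open>
  Rotation of \<open>V\<^sub>z\<close> by a right angle. For orthonormal \<open>\<alpha>, \<beta>\<close> in \<open>\<Lambda>\<^sup>+\<close> the endomorphisms
  \<open>\<surd>2 g\<^sup>-\<^sup>1 \<alpha>\<close> and \<open>\<surd>2 g\<^sup>-\<^sup>1 \<beta>\<close> are anticommuting complex structures, and \<open>\<beta>\<close> is sent to the
  form corresponding to their product. The fibres are oriented by the bases
  \<open>(\<beta>, fibre_rotation g z \<beta>)\<close>; the opposite orientation is obtained from this one by the
  antipodal map of the fibres.
\<close>

fun fibre_rotation :: "metric \<Rightarrow> (real^4) \<times> (real^4^4) \<Rightarrow> real^4^4 \<Rightarrow> real^4^4" where
  "fibre_rotation g (x, \<alpha>) \<beta> = sqrt 2 *\<^sub>R (\<alpha> ** matrix_inv (g x) ** \<beta>)"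

text \<open>
  The form \<open>\<omega>\<close> with curvature \<open>2\<pi>i \<omega>\<close>, where \<open>i\<close> acts on \<open>V\<close> as minus the rotation: a round
  unit sphere with area form \<open>A\<close> and positive rotation \<open>J\<close> has curvature \<open>F(u,v) = - A(u,v) J\<close>,
  so this is the sign for which \<open>2\<pi>\<omega>\<close> restricts to the area form of each fibre. The fields
  \<open>X, Y\<close> and the section \<open>s\<close> are local and smooth on the ambient space; only their
  restrictions to the twistor space affect the curvature.
\<close>

definition twistor_form :: "(real^4) set \<Rightarrow> metric \<Rightarrow> ((real^4) \<times> (real^4^4)) two_form" where
  "twistor_form U g z u v = (THE c. \<forall>N X Y s.
     open N \<and> z \<in> N \<and> N \<subseteq> U \<times> UNIV \<and>
     smooth_on N X \<and> smooth_on N Y \<and> smooth_on N s \<and>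
     (\<forall>z' \<in> N \<inter> twistor_space U g.
        X z' \<in> tangent_space (twistor_space U g) z' \<and>
        Y z' \<in> tangent_space (twistor_space U g) z' \<and>
        s z' \<in> vertical_space g z') \<and>
     X z = u \<and> Y z = v \<longrightarrow>
     vertical_curvature g X Y s z = (2 * pi * c) *\<^sub>R (- fibre_rotation g z (s z)))"


section \<open>Hyperbolic four-space: the Poincare ball model\<close>

abbreviation H4 :: "(real^4) set" where
  "H4 \<equiv> ball 0 1"

definition hyp_metric :: metric where
  "hyp_metric x = mat (4 / (1 - (norm x)\<^sup>2)\<^sup>2)"


section \<open>The small resolution of the conifold\<close>

text \<open>
  The projective line is the set of orthogonal projections of \<open>\<complex>\<^sup>2\<close> onto complex lines,
  \<open>[z] \<mapsto> z z\<^sup>* / |z|\<^sup>2\<close>.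
\<close>

definition CP1 :: "(complex^2^2) set" where
  "CP1 = {P. map_matrix cnj (transpose P) = P \<and> P ** P = P \<and> trace P = 1}"

text \<open>
  A point of \<open>\<O>(-1) \<oplus> \<O>(-1)\<close> is a line together with two vectors in it.
\<close>

definition resolution :: "((complex^2^2) \<times> (complex^2) \<times> (complex^2)) set" where
  "resolution = {(P, (a, b)). P \<in> CP1 \<and> a \<in> range ((*v) P) \<and> b \<in> range ((*v) P)}"

definition res_q :: "(complex^2^2) \<times> (complex^2) \<times> (complex^2) \<Rightarrow> complex^2^2" where
  "res_q = fst"

text \<open>
  With \<open>(x, y) = a\<close> and \<open>(z, w) = b\<close> the image of \<open>resolution\<close> is the cone \<open>x w - y z = 0\<close>.
\<close>

definition res_p :: "(complex^2^2) \<times> (complex^2) \<times> (complex^2) \<Rightarrow> (complex^2) \<times> (complex^2)" where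
  "res_p = snd"

text \<open>The form \<open>\<Sum> dx\<^sub>k \<and> dy\<^sub>k\<close> in complex coordinates \<open>x\<^sub>k + i y\<^sub>k\<close>.\<close>

definition omega_C4 :: "((complex^2) \<times> (complex^2)) two_form" where
  "omega_C4 z u v = (\<Sum>k\<in>UNIV. Im (cnj (fst u $ k) * fst v $ k)) +
                    (\<Sum>k\<in>UNIV. Im (cnj (snd u $ k) * snd v $ k))"

text \<open>
  If \<open>P = z z\<^sup>*\<close> with \<open>|z| = 1\<close>, the tangent vector \<open>A\<close> corresponds to the horizontal lift
  \<open>A z\<close> in \<open>z\<^sup>\<bottom>\<close>, so \<open>Im (trace (P A B)) = Im \<langle>A z, B z\<rangle>\<close> is the Fubini-Study form
  \<open>(i/2) \<partial>\<partial>\<^sup>- log |z|\<^sup>2\<close>, of total area \<open>\<pi>\<close>. The factor makes the area two, the area of the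
  twistor fibres (area \<open>4\<pi>\<close> for \<open>2\<pi>\<omega>\<close>).
\<close>

definition omega_FS :: "(complex^2^2) two_form" where
  "omega_FS P A B = (2 / pi) * Im (trace (P ** A ** B))"

definition resolution_form :: "((complex^2^2) \<times> (complex^2) \<times> (complex^2)) two_form" where
  "resolution_form r u v =
     pullback resolution res_p omega_C4 r u v + pullback resolution res_q omega_FS r u v"

end

theory Submission
  imports Defs
begin

text \<open>Identify \<open>\<real>\<^sup>4\<close> with the quaternions. At every point of the ball the self-dual forms are
  the multiples of the left multiplications \<open>L\<^sub>n\<close> by imaginary quaternions \<open>n\<close>, so scaling
  \<open>L\<^sub>n\<close> to unit length identifies the twistor space with \<open>H4 \<times> S\<^sup>2\<close>. In this
  trivialisation the Levi-Civita connection is \<open>d + A \<times>\<close> with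
  \<open>A\<^sub>v = 2 Im (v x\<^sup>*) / (1 - \<bar>x\<bar>\<^sup>2)\<close> (\<open>lc_form_scaled\<close>). The vertical tangent space at
  \<open>(x, n)\<close> is the plane orthogonal to \<open>n\<close>, and computing the curvature of the induced connection
  on it (\<open>vertical_curvature_hyp\<close>, \<open>twistor_density_eq\<close>) gives
  \<open>2\<pi>\<omega> = \<sigma> - d\<langle>n, A\<rangle>\<close>, where \<open>\<sigma>\<close> is the area form of the unit sphere. The existence of
  enough local sections turns this into the value of the form defined by the curvature
  (\<open>twistor_form_hyp\<close>).

  On the other side, a complex line in \<open>\<complex>\<^sup>2\<close> is the image of the projection
  \<open>P(n) = (1 + n \<cdot> s) / 2\<close>, with \<open>s\<close> the Pauli matrices, and a quaternion \<open>x\<close> is a complex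
  two-by-two matrix \<open>X\<close>. A pair of vectors in the line is a matrix \<open>M = P(n) M\<close>, and \<open>P(n) X\<close>
  runs through these exactly once as \<open>x\<close> runs through the quaternions. The symmetry group
  \<open>SU(2) \<times> SU(2)\<close> acts on both spaces with one-parameter families of orbits, and this
  suggests the equivariant maps \<open>(x, n) \<mapsto> (P(n), f(\<bar>x\<bar>) P(n) X)\<close>. The Fubini-Study form contributes
  \<open>\<sigma> / (2\<pi>)\<close>, and the standard form of \<open>\<complex>\<^sup>4\<close> has the primitive \<open>Im (tr (M\<^sup>* dM)) / 2\<close>, which
  pulls back to \<open>- f\<^sup>2 \<langle>n, Im (dx x\<^sup>*)\<rangle> / 2\<close>. This is \<open>- \<langle>n, A\<rangle> / (2\<pi>)\<close> precisely for
  \<open>f\<^sup>2 = 2 / (\<pi> (1 - \<bar>x\<bar>\<^sup>2))\<close>. Since \<open>f\<^sup>2 = 2/\<pi> + \<bar>M\<bar>\<^sup>2\<close>, the quaternion can be recovered from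
  \<open>M\<close> by a smooth formula, and the map is a diffeomorphism onto the whole resolution
  (\<open>resolution_param\<close>, \<open>of_resolution_res_param\<close>). The equality of the forms is
  \<open>resolution_form_density\<close>.\<close>

section \<open>Calculus of smooth maps\<close>

lemma linear_sum_Basis:
  fixes f :: "'a::euclidean_space \<Rightarrow> 'b::real_vector"
  assumes "linear f"
  shows "(\<Sum>b\<in>Basis. (v \<bullet> b) *\<^sub>R f b) = f v"
proof -
  have "f v = f (\<Sum>b\<in>Basis. (v \<bullet> b) *\<^sub>R b)"
    by (simp add: euclidean_representation)
  also have "\<dots> = (\<Sum>b\<in>Basis. (v \<bullet> b) *\<^sub>R f b)"
    by (simp add: linear_sum[OF assms] linear_scale[OF assms])
  finally show ?thesis ..
qed

lemma Ck_on_cong: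
  assumes S: "open S" and "\<And>x. x \<in> S \<Longrightarrow> f x = g x" "Ck_on k S f"
  shows "Ck_on k S g"
  using assms(2,3)
proof (induction k arbitrary: f g)
  case 0
  then show ?case by (simp cong: continuous_on_cong)
next
  case (Suc k)
  have "(f has_derivative frechet_derivative f (at x)) (at x)" if "x \<in> S" for x
    using Suc.prems(2) that S
    by (auto simp: differentiable_on_eq_differentiable_at frechet_derivative_works)
  then have g: "(g has_derivative frechet_derivative f (at x)) (at x)" if "x \<in> S" for x
    using has_derivative_transform_within_open[OF _ S that] Suc.prems(1) that by blast
  have "Ck_on k S (\<lambda>x. frechet_derivative g (at x) v)" for v
    by (rule Suc.IH[of "\<lambda>x. frechet_derivative f (at x) v"])
      (use Suc.prems frechet_derivative_at[OF g] in auto)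
  moreover have "g differentiable_on S"
    using g S by (auto simp: differentiable_on_eq_differentiable_at differentiable_def)
  ultimately show ?case by simp
qed

text \<open>This replaces the chosen derivative in the definition of \<open>Ck_on\<close> by any derivative that is
  given by a formula.\<close>

lemma Ck_on_Suc_intro:
  assumes "open S" "\<And>x. x \<in> S \<Longrightarrow> (f has_derivative f' x) (at x)"
    and "\<And>v. Ck_on k S (\<lambda>x. f' x v)"
  shows "Ck_on (Suc k) S f"
proof -
  have "f differentiable_on S"
    using assms(1,2) by (auto simp: differentiable_on_eq_differentiable_at differentiable_def)
  moreover have "Ck_on k S (\<lambda>x. frechet_derivative f (at x) v)" for v
    by (rule Ck_on_cong[OF assms(1) _ assms(3)[of v]]) (simp add: frechet_derivative_at[OF assms(2)])
  ultimately show ?thesis by simp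
qed

lemma Ck_on_has_derivative:
  assumes "open S" "Ck_on (Suc k) S f" "x \<in> S"
  shows "(f has_derivative frechet_derivative f (at x)) (at x)"
  using assms by (auto simp: differentiable_on_eq_differentiable_at frechet_derivative_works)

lemma Ck_on_Suc_imp: "Ck_on (Suc k) S f \<Longrightarrow> Ck_on k S f"
proof (induction k arbitrary: f)
  case 0
  then show ?case by (simp add: differentiable_imp_continuous_on)
next
  case (Suc k)
  then show ?case by (metis Ck_on.simps(2))
qed

lemma Ck_on_subset:
  assumes "open S" "T \<subseteq> S" "Ck_on k S f" shows "Ck_on k T f"
  using assms(3)
proof (induction k arbitrary: f)
  case 0
  then show ?case using assms(2) by (simp add: continuous_on_subset)
next
  case (Suc k)
  then show ?case using assms(2) differentiable_on_subset by auto
qed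

lemma Ck_on_const: "open S \<Longrightarrow> Ck_on k S (\<lambda>x. c)"
proof (induction k arbitrary: c)
  case (Suc k)
  show ?case by (rule Ck_on_Suc_intro[where f'="\<lambda>x v. 0"]) (use Suc in auto)
qed auto

lemma Ck_on_linear:
  assumes S: "open S" and L: "bounded_linear L" and f: "Ck_on k S f"
  shows "Ck_on k S (\<lambda>x. L (f x))"
  using f
proof (induction k arbitrary: f)
  case 0
  then show ?case using bounded_linear.continuous_on[OF L] by auto
next
  case (Suc k)
  show ?case
    by (rule Ck_on_Suc_intro[OF S bounded_linear.has_derivative[OF L Ck_on_has_derivative[OF S Suc.prems]]])
      (use Suc S in auto)
qed

lemma Ck_on_add:
  assumes S: "open S" and f: "Ck_on k S f" and g: "Ck_on k S g"
  shows "Ck_on k S (\<lambda>x. f x + g x)"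
  using f g
proof (induction k arbitrary: f g)
  case 0
  then show ?case by (auto intro: continuous_intros)
next
  case (Suc k)
  show ?case
    by (rule Ck_on_Suc_intro[OF S has_derivative_add[OF
            Ck_on_has_derivative[OF S Suc.prems(1)] Ck_on_has_derivative[OF S Suc.prems(2)]]])
      (use Suc S in auto)
qed

lemma Ck_on_bilinear:
  assumes S: "open S" and B: "bounded_bilinear B" and f: "Ck_on k S f" and g: "Ck_on k S g"
  shows "Ck_on k S (\<lambda>x. B (f x) (g x))"
  using f g
proof (induction k arbitrary: f g)
  case 0
  then show ?case using bounded_bilinear.continuous_on[OF B] by auto
next
  case (Suc k)
  note fg = Suc.prems[THEN Ck_on_Suc_imp]
  show ?case
    by (rule Ck_on_Suc_intro[OF S bounded_bilinear.FDERIV[OF B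
            Ck_on_has_derivative[OF S Suc.prems(1)] Ck_on_has_derivative[OF S Suc.prems(2)]]])
      (use Suc fg S in \<open>auto intro!: Ck_on_add Suc.IH\<close>)
qed

lemma Ck_on_sum:
  assumes "open S" "\<And>i. i \<in> I \<Longrightarrow> Ck_on k S (f i)"
  shows "Ck_on k S (\<lambda>x. \<Sum>i\<in>I. f i x)"
  using assms(2)
  by (induction I rule: infinite_finite_induct) (auto intro: Ck_on_const Ck_on_add assms(1))

lemma Ck_on_id: "open S \<Longrightarrow> Ck_on k S (\<lambda>x. x)"
proof (cases k)
  case (Suc k)
  assume S: "open S"
  show ?thesis unfolding Suc
    by (rule Ck_on_Suc_intro[OF S has_derivative_ident Ck_on_const[OF S]])
qed auto

text \<open>Written out in a basis, the derivative of a composition is a sum of products of the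
  partial derivatives of the outer map and the coordinates of the derivative of the inner map;
  both have one order of smoothness less, so the induction closes.\<close>

lemma Ck_on_compose:
  fixes f :: "'a::euclidean_space \<Rightarrow> 'b::euclidean_space" and g :: "'b \<Rightarrow> 'c::real_normed_vector"
  assumes S: "open S" and T: "open T" and fT: "f ` S \<subseteq> T" and f: "Ck_on k S f" and g: "Ck_on k T g"
  shows "Ck_on k S (\<lambda>x. g (f x))"
  using f g
proof (induction k arbitrary: g)
  case 0
  then show ?case using fT by (auto intro: continuous_on_compose2)
next
  case (Suc k)
  let ?f' = "\<lambda>x. frechet_derivative f (at x)" and ?g' = "\<lambda>y. frechet_derivative g (at y)"
  have d: "((\<lambda>x. g (f x)) has_derivative (\<lambda>v. ?g' (f x) (?f' x v))) (at x)" if "x \<in> S" for x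
    by (rule has_derivative_compose[OF Ck_on_has_derivative[OF S Suc.prems(1) that]
          Ck_on_has_derivative[OF T Suc.prems(2)]])
      (use that fT in blast)
  have basis: "(\<Sum>b\<in>Basis. (?f' x v \<bullet> b) *\<^sub>R ?g' (f x) b) = ?g' (f x) (?f' x v)" if "x \<in> S" for x v
    by (rule linear_sum_Basis[OF has_derivative_linear[OF Ck_on_has_derivative[OF T Suc.prems(2)]]])
      (use that fT in blast)
  have inner: "Ck_on k S (\<lambda>x. ?f' x v \<bullet> b)" for v b
    using Ck_on_linear[OF S bounded_linear_inner_left, of k "\<lambda>x. ?f' x v" b] Suc.prems(1) by simp
  have outer: "Ck_on k S (\<lambda>x. ?g' (f x) b)" for b
    using Suc.IH[OF Ck_on_Suc_imp[OF Suc.prems(1)], of "\<lambda>y. ?g' y b"] Suc.prems(2) by auto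
  have "Ck_on k S (\<lambda>x. ?g' (f x) (?f' x v))" for v
    by (rule Ck_on_cong[OF S basis])
      (auto intro!: Ck_on_sum S Ck_on_bilinear[OF S bounded_bilinear_scaleR] inner outer)
  from Ck_on_Suc_intro[OF S d this] show ?case .
qed

text \<open>Real powers form a family closed under differentiation, so one induction covers inverses and
  square roots at the same time.\<close>

lemma Ck_on_powr: "Ck_on k {0<..} (\<lambda>x::real. x powr a)"
proof (induction k arbitrary: a)
  case 0
  then show ?case by (auto intro!: continuous_intros)
next
  case (Suc k)
  have "((\<lambda>x::real. x powr a) has_derivative (\<lambda>v. v *\<^sub>R (a * x powr (a - 1)))) (at x)" if "x > 0" for x
    using has_real_derivative_powr[OF that, of a] by (simp add: has_field_derivative_def mult.commute[of _ "a * _"])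
  moreover have "Ck_on k {0<..} (\<lambda>x::real. v *\<^sub>R (a * x powr (a - 1)))" for v
    using Ck_on_linear[OF _ bounded_linear_mult_right[of "v * a"] Suc.IH[of "a - 1"]]
    by (simp add: mult.assoc)
  ultimately show ?case
    by (intro Ck_on_Suc_intro[where f'="\<lambda>x v. v *\<^sub>R (a * x powr (a - 1))"]) auto
qed

lemma smooth_on_has_derivative:
  "open S \<Longrightarrow> smooth_on S f \<Longrightarrow> x \<in> S \<Longrightarrow> (f has_derivative frechet_derivative f (at x)) (at x)"
  unfolding smooth_on_def using Ck_on_has_derivative by blast

lemma smooth_on_subset: "open S \<Longrightarrow> T \<subseteq> S \<Longrightarrow> smooth_on S f \<Longrightarrow> smooth_on T f"
  unfolding smooth_on_def using Ck_on_subset by blast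

lemma smooth_on_cong:
  "open S \<Longrightarrow> (\<And>x. x \<in> S \<Longrightarrow> f x = g x) \<Longrightarrow> smooth_on S f \<Longrightarrow> smooth_on S g"
  unfolding smooth_on_def using Ck_on_cong by blast

named_theorems smooth_intros

lemma smooth_on_const [smooth_intros]: "open S \<Longrightarrow> smooth_on S (\<lambda>x. c)"
  by (simp add: smooth_on_def Ck_on_const)

lemma smooth_on_id [smooth_intros]: "open S \<Longrightarrow> smooth_on S (\<lambda>x. x)"
  by (simp add: smooth_on_def Ck_on_id)

lemma smooth_on_linear:
  "bounded_linear L \<Longrightarrow> open S \<Longrightarrow> smooth_on S f \<Longrightarrow> smooth_on S (\<lambda>x. L (f x))"
  by (simp add: smooth_on_def Ck_on_linear)

lemma smooth_on_bilinear:
  "bounded_bilinear B \<Longrightarrow> open S \<Longrightarrow> smooth_on S f \<Longrightarrow> smooth_on S g \<Longrightarrow> smooth_on S (\<lambda>x. B (f x) (g x))"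
  by (simp add: smooth_on_def Ck_on_bilinear)

lemma smooth_on_compose:
  fixes f :: "'a::euclidean_space \<Rightarrow> 'b::euclidean_space" and g :: "'b \<Rightarrow> 'c::real_normed_vector"
  shows "open S \<Longrightarrow> open T \<Longrightarrow> f ` S \<subseteq> T \<Longrightarrow> smooth_on S f \<Longrightarrow> smooth_on T g \<Longrightarrow>
    smooth_on S (\<lambda>x. g (f x))"
  unfolding smooth_on_def using Ck_on_compose by blast

lemma smooth_on_add [smooth_intros]:
  "open S \<Longrightarrow> smooth_on S f \<Longrightarrow> smooth_on S g \<Longrightarrow> smooth_on S (\<lambda>x. f x + g x)"
  by (simp add: smooth_on_def Ck_on_add)

lemma smooth_on_sum [smooth_intros]:
  "open S \<Longrightarrow> (\<And>i. i \<in> I \<Longrightarrow> smooth_on S (f i)) \<Longrightarrow> smooth_on S (\<lambda>x. \<Sum>i\<in>I. f i x)"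
  by (simp add: smooth_on_def Ck_on_sum)

lemmas [smooth_intros] =
  smooth_on_bilinear[OF bounded_bilinear_mult]
  smooth_on_bilinear[OF bounded_bilinear_scaleR]
  smooth_on_bilinear[OF bounded_bilinear_inner]
  smooth_on_linear[OF bounded_linear_fst]
  smooth_on_linear[OF bounded_linear_snd]
  smooth_on_linear[OF bounded_linear_vec_nth]

lemma smooth_on_minus [smooth_intros]:
  "open S \<Longrightarrow> smooth_on S f \<Longrightarrow> smooth_on S (\<lambda>x. - f x)"
  using smooth_on_linear[OF bounded_linear_minus[OF bounded_linear_ident]] by blast

lemma smooth_on_diff [smooth_intros]:
  "open S \<Longrightarrow> smooth_on S f \<Longrightarrow> smooth_on S g \<Longrightarrow> smooth_on S (\<lambda>x. f x - g x)"
  using smooth_on_add[OF _ _ smooth_on_minus, of S f g] by simp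

lemma smooth_on_power [smooth_intros]:
  fixes f :: "'a::euclidean_space \<Rightarrow> real"
  shows "open S \<Longrightarrow> smooth_on S f \<Longrightarrow> smooth_on S (\<lambda>x. f x ^ n)"
  by (induction n) (auto intro!: smooth_intros)

lemma smooth_on_Pair [smooth_intros]:
  assumes "open S" "smooth_on S f" "smooth_on S g"
  shows "smooth_on S (\<lambda>x. (f x, g x))"
proof -
  have "bounded_linear (\<lambda>y. (y, 0))" "bounded_linear (\<lambda>y. (0, y))"
    by (auto intro!: bounded_linear_Pair bounded_linear_ident bounded_linear_zero)
  from smooth_on_add[OF assms(1) smooth_on_linear[OF this(1) assms(1,2)] smooth_on_linear[OF this(2) assms(1,3)]]
  show ?thesis by simp
qed

lemma bounded_linear_axis: "bounded_linear (axis i :: 'b::real_normed_vector \<Rightarrow> 'b^'n)"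
proof (rule bounded_linear_intro[where K=1])
  show "axis i (x + y) = axis i x + (axis i y :: 'b^'n)" for x y
    by (simp add: vec_eq_iff axis_def)
  show "axis i (r *\<^sub>R x) = r *\<^sub>R (axis i x :: 'b^'n)" for r x
    by (simp add: vec_eq_iff axis_def)
  show "norm (axis i x :: 'b^'n) \<le> norm x * 1" for x
  proof -
    have "norm (axis i x :: 'b^'n) \<le> (\<Sum>j\<in>UNIV. norm ((axis i x :: 'b^'n) $ j))"
      unfolding norm_vec_def by (rule L2_set_le_sum) simp
    also have "\<dots> = (\<Sum>j\<in>UNIV. if j = i then norm x else 0)"
      by (rule sum.cong) (auto simp: axis_def)
    finally show ?thesis by simp
  qed
qed

lemma smooth_on_vec_lambda [smooth_intros]:
  fixes f :: "'n::finite \<Rightarrow> 'a::euclidean_space \<Rightarrow> 'b::euclidean_space"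
  assumes "open S" "\<And>i. smooth_on S (f i)"
  shows "smooth_on S (\<lambda>x. \<chi> i. f i x)"
proof -
  have "smooth_on S (\<lambda>x. \<Sum>i\<in>UNIV. axis i (f i x) :: 'b^'n)"
    by (intro smooth_intros smooth_on_linear[OF bounded_linear_axis] assms)
  moreover have "(\<Sum>i\<in>UNIV. axis i (f i x)) = (\<chi> i. f i x)" for x
    by (simp add: vec_eq_iff axis_def if_distrib cong: if_cong)
  ultimately show ?thesis by simp
qed

lemma smooth_on_powr [smooth_intros]:
  fixes f :: "'a::euclidean_space \<Rightarrow> real"
  assumes "open S" "smooth_on S f" "\<And>x. x \<in> S \<Longrightarrow> f x > 0"
  shows "smooth_on S (\<lambda>x. f x powr a)"
  by (rule smooth_on_compose[where T="{0<..}" and g="\<lambda>y. y powr a", OF assms(1) _ _ assms(2)])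
    (use assms(3) in \<open>auto simp: smooth_on_def Ck_on_powr\<close>)

lemma smooth_on_inverse [smooth_intros]:
  fixes f :: "'a::euclidean_space \<Rightarrow> real"
  assumes "open S" "smooth_on S f" "\<And>x. x \<in> S \<Longrightarrow> f x > 0"
  shows "smooth_on S (\<lambda>x. inverse (f x))"
  by (rule smooth_on_cong[OF assms(1) _ smooth_on_powr[OF assms, of "-1"]])
    (use assms(3) in \<open>auto simp: powr_minus less_imp_le\<close>)

lemma smooth_on_divide [smooth_intros]:
  fixes f g :: "'a::euclidean_space \<Rightarrow> real"
  assumes "open S" "smooth_on S f" "smooth_on S g" "\<And>x. x \<in> S \<Longrightarrow> g x > 0"
  shows "smooth_on S (\<lambda>x. f x / g x)"
  unfolding divide_inverse by (intro smooth_intros assms)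

lemma smooth_on_sqrt [smooth_intros]:
  assumes "open S" "smooth_on S f" "\<And>x. x \<in> S \<Longrightarrow> f x > 0"
  shows "smooth_on S (\<lambda>x. sqrt (f x))"
  by (rule smooth_on_cong[OF assms(1) _ smooth_on_powr[OF assms, of "1/2"]])
    (use assms(3) in \<open>auto simp: powr_half_sqrt less_imp_le\<close>)

lemma smooth_on_frechet_derivative:
  assumes S: "open S" and f: "smooth_on S f" and w: "smooth_on S w"
  shows "smooth_on S (\<lambda>x. frechet_derivative f (at x) (w x))"
proof (rule smooth_on_cong[OF S])
  fix x assume "x \<in> S"
  then have "linear (frechet_derivative f (at x))"
    using smooth_on_has_derivative[OF S f] has_derivative_linear by blast
  then show "(\<Sum>b\<in>Basis. (w x \<bullet> b) *\<^sub>R frechet_derivative f (at x) b) = frechet_derivative f (at x) (w x)"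
    by (rule linear_sum_Basis)
next
  have "Ck_on (Suc k) S f" for k
    using f smooth_on_def by blast
  then have *: "smooth_on S (\<lambda>x. frechet_derivative f (at x) v)" for v
    by (simp add: smooth_on_def)
  show "smooth_on S (\<lambda>x. \<Sum>b\<in>Basis. (w x \<bullet> b) *\<^sub>R frechet_derivative f (at x) b)"
    by (intro smooth_intros S w *)
qed

text \<open>The mean value theorem, applied once in each of the two directions.\<close>

lemma second_difference:
  fixes f :: "'a::euclidean_space \<Rightarrow> real"
  assumes S: "open S" and f: "smooth_on S f" and r: "ball x r \<subseteq> S"
    and h: "h > 0" "h * (norm a + norm b) < r"
  shows "\<exists>y. dist y x \<le> h * (norm a + norm b) \<and>
    f (x + h *\<^sub>R a + h *\<^sub>R b) - f (x + h *\<^sub>R a) - (f (x + h *\<^sub>R b) - f x) =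
    h\<^sup>2 * frechet_derivative (\<lambda>z. frechet_derivative f (at z) a) (at y) b"
proof -
  let ?D = "\<lambda>z. frechet_derivative f (at z) a"
  have D: "smooth_on S ?D"
    by (intro smooth_on_frechet_derivative S f smooth_intros)
  have dist: "dist (x + s *\<^sub>R a + t *\<^sub>R b) x \<le> h * (norm a + norm b)"
    if "0 \<le> s" "s \<le> h" "0 \<le> t" "t \<le> h" for s t
  proof -
    have "dist (x + s *\<^sub>R a + t *\<^sub>R b) x = norm (s *\<^sub>R a + t *\<^sub>R b)"
      by (simp add: dist_norm)
    also have "\<dots> \<le> s * norm a + t * norm b"
      using norm_triangle_ineq[of "s *\<^sub>R a" "t *\<^sub>R b"] that by simp
    also have "\<dots> \<le> h * (norm a + norm b)"
      using mult_right_mono[OF that(2) norm_ge_zero[of a]] mult_right_mono[OF that(4) norm_ge_zero[of b]]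
      by (simp add: distrib_left)
    finally show ?thesis .
  qed
  have in_S: "x + s *\<^sub>R a + t *\<^sub>R b \<in> S" if "0 \<le> s" "s \<le> h" "0 \<le> t" "t \<le> h" for s t
    using dist[OF that] h(2) r by (auto simp: dist_commute subset_iff)
  have df: "((\<lambda>s. f (x + s *\<^sub>R a + t *\<^sub>R b)) has_real_derivative ?D (x + s *\<^sub>R a + t *\<^sub>R b)) (at s)"
    if "0 \<le> s" "s \<le> h" "0 \<le> t" "t \<le> h" for s t
  proof -
    have F: "(f has_derivative frechet_derivative f (at (x + s *\<^sub>R a + t *\<^sub>R b))) (at (x + s *\<^sub>R a + t *\<^sub>R b))"
      by (rule smooth_on_has_derivative[OF S f in_S[OF that]])
    have "((\<lambda>s. x + s *\<^sub>R a + t *\<^sub>R b) has_derivative (\<lambda>k. k *\<^sub>R a)) (at s)"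
      by (auto intro!: derivative_eq_intros)
    from has_derivative_compose[OF this F] show ?thesis
      by (simp add: has_field_derivative_def linear_scale[OF has_derivative_linear[OF F]] mult_commute_abs)
  qed
  have dD: "((\<lambda>t. ?D (x + s *\<^sub>R a + t *\<^sub>R b)) has_real_derivative
      frechet_derivative ?D (at (x + s *\<^sub>R a + t *\<^sub>R b)) b) (at t)"
    if "0 \<le> s" "s \<le> h" "0 \<le> t" "t \<le> h" for s t
  proof -
    have F: "(?D has_derivative frechet_derivative ?D (at (x + s *\<^sub>R a + t *\<^sub>R b))) (at (x + s *\<^sub>R a + t *\<^sub>R b))"
      by (rule smooth_on_has_derivative[OF S D in_S[OF that]])
    have "((\<lambda>t. x + s *\<^sub>R a + t *\<^sub>R b) has_derivative (\<lambda>k. k *\<^sub>R b)) (at t)"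
      by (auto intro!: derivative_eq_intros)
    from has_derivative_compose[OF this F] show ?thesis
      by (simp add: has_field_derivative_def linear_scale[OF has_derivative_linear[OF F]] mult_commute_abs)
  qed
  have "\<exists>s. 0 < s \<and> s < h \<and>
      (f (x + h *\<^sub>R a + h *\<^sub>R b) - f (x + h *\<^sub>R a + 0 *\<^sub>R b)) - (f (x + 0 *\<^sub>R a + h *\<^sub>R b) - f (x + 0 *\<^sub>R a + 0 *\<^sub>R b))
      = (h - 0) * (?D (x + s *\<^sub>R a + h *\<^sub>R b) - ?D (x + s *\<^sub>R a + 0 *\<^sub>R b))"
    by (rule MVT2[OF h(1)]) (use h in \<open>auto intro!: DERIV_diff df df[where t=0, simplified]\<close>)
  then obtain s where s: "0 < s" "s < h" and fs:
      "f (x + h *\<^sub>R a + h *\<^sub>R b) - f (x + h *\<^sub>R a) - (f (x + h *\<^sub>R b) - f x)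
      = h * (?D (x + s *\<^sub>R a + h *\<^sub>R b) - ?D (x + s *\<^sub>R a + 0 *\<^sub>R b))"
    by auto
  have "\<exists>t. 0 < t \<and> t < h \<and> ?D (x + s *\<^sub>R a + h *\<^sub>R b) - ?D (x + s *\<^sub>R a + 0 *\<^sub>R b)
      = (h - 0) * frechet_derivative ?D (at (x + s *\<^sub>R a + t *\<^sub>R b)) b"
    by (rule MVT2[OF h(1)]) (use s in \<open>auto intro!: dD\<close>)
  then obtain t where t: "0 < t" "t < h" and
      "?D (x + s *\<^sub>R a + h *\<^sub>R b) - ?D (x + s *\<^sub>R a + 0 *\<^sub>R b)
      = h * frechet_derivative ?D (at (x + s *\<^sub>R a + t *\<^sub>R b)) b"
    by auto
  with fs have "f (x + h *\<^sub>R a + h *\<^sub>R b) - f (x + h *\<^sub>R a) - (f (x + h *\<^sub>R b) - f x)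
      = h\<^sup>2 * frechet_derivative ?D (at (x + s *\<^sub>R a + t *\<^sub>R b)) b"
    by (simp add: power2_eq_square)
  then show ?thesis using dist[of s t] s t by (intro exI[of _ "x + s *\<^sub>R a + t *\<^sub>R b"]) auto
qed

text \<open>Both mixed derivatives are limits of the same second difference quotient.\<close>

lemma second_derivative_symmetric_real:
  fixes f :: "'a::euclidean_space \<Rightarrow> real"
  assumes S: "open S" and f: "smooth_on S f" and x: "x \<in> S"
  shows "frechet_derivative (\<lambda>z. frechet_derivative f (at z) a) (at x) b =
    frechet_derivative (\<lambda>z. frechet_derivative f (at z) b) (at x) a"
proof -
  define DD where "DD a b y = frechet_derivative (\<lambda>z. frechet_derivative f (at z) a) (at y) b" for a b y
  have smooth: "smooth_on S (DD a b)" for a b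
    unfolding DD_def by (intro smooth_on_frechet_derivative S f smooth_intros)
  have lim: "\<exists>d>0. \<forall>y. dist y x < d \<longrightarrow> dist (DD a b y) (DD a b x) < e" if "e > 0" for a b e
  proof -
    have "continuous_on S (DD a b)"
      using smooth[of a b] Ck_on.simps(1) unfolding smooth_on_def by blast
    then have "isCont (DD a b) x"
      using S x continuous_on_eq_continuous_at by blast
    then show ?thesis using that unfolding continuous_at_eps_delta by blast
  qed
  obtain r where r: "r > 0" "ball x r \<subseteq> S"
    using S x openE by blast
  have le: "dist (DD a b x) (DD b a x) \<le> e" if e: "e > 0" for e
  proof -
    obtain d where d: "d > 0" "\<And>y. dist y x < d \<Longrightarrow> dist (DD a b y) (DD a b x) < e / 2"
      using lim[of "e/2" a b] e by auto
    obtain d' where d': "d' > 0" "\<And>y. dist y x < d' \<Longrightarrow> dist (DD b a y) (DD b a x) < e / 2"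
      using lim[of "e/2" b a] e by auto
    define m where "m = min r (min d d')"
    define h where "h = m / (norm a + norm b + 1)"
    have m: "m > 0" "m \<le> r" "m \<le> d" "m \<le> d'"
      using r d d' by (auto simp: m_def)
    have pos: "0 < norm a + norm b + 1"
      by (simp add: add_nonneg_pos)
    then have h: "h > 0" "h * (norm a + norm b) < m"
      using m(1) by (auto simp: h_def field_simps)
    have h': "h * (norm b + norm a) < m"
      using h(2) by (simp add: add.commute)
    obtain y where y: "dist y x \<le> h * (norm a + norm b)"
      "f (x + h *\<^sub>R a + h *\<^sub>R b) - f (x + h *\<^sub>R a) - (f (x + h *\<^sub>R b) - f x) = h\<^sup>2 * DD a b y"
      using second_difference[OF S f r(2) h(1), of a b] h(2) m unfolding DD_def by auto
    obtain z where z: "dist z x \<le> h * (norm b + norm a)"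
      "f (x + h *\<^sub>R b + h *\<^sub>R a) - f (x + h *\<^sub>R b) - (f (x + h *\<^sub>R a) - f x) = h\<^sup>2 * DD b a z"
      using second_difference[OF S f r(2) h(1), of b a] h' m unfolding DD_def by auto
    have swap: "x + h *\<^sub>R b + h *\<^sub>R a = x + h *\<^sub>R a + h *\<^sub>R b"
      by simp
    have "h\<^sup>2 * DD a b y = h\<^sup>2 * DD b a z"
      using y(2) z(2)[unfolded swap] by linarith
    then have "DD a b y = DD b a z" using h(1) by simp
    moreover have "dist (DD a b y) (DD a b x) < e / 2" "dist (DD b a z) (DD b a x) < e / 2"
      using d(2)[of y] d'(2)[of z] y(1) z(1) h(2) h' m by auto
    ultimately show ?thesis unfolding dist_real_def by linarith
  qed
  have "dist (DD a b x) (DD b a x) \<le> 0"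
    by (rule field_le_epsilon) (use le in auto)
  then show ?thesis by (simp add: DD_def)
qed

lemma second_derivative_symmetric:
  fixes f :: "'a::euclidean_space \<Rightarrow> 'b::euclidean_space"
  assumes S: "open S" and f: "smooth_on S f" and x: "x \<in> S"
  shows "frechet_derivative (\<lambda>z. frechet_derivative f (at z) a) (at x) b =
    frechet_derivative (\<lambda>z. frechet_derivative f (at z) b) (at x) a"
proof (rule euclidean_eqI)
  fix c :: 'b assume "c \<in> Basis"
  have comp: "frechet_derivative (\<lambda>z. g z \<bullet> c) (at y) v = frechet_derivative g (at y) v \<bullet> c"
    if "smooth_on S g" "y \<in> S" for g v and y
    using has_derivative_inner_left[OF smooth_on_has_derivative[OF S that], of c]
    by (simp add: frechet_derivative_at[symmetric])
  have twice: "frechet_derivative (\<lambda>z. frechet_derivative (\<lambda>z. f z \<bullet> c) (at z) v) (at x) w =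
      frechet_derivative (\<lambda>z. frechet_derivative f (at z) v) (at x) w \<bullet> c" for v w
  proof -
    have "smooth_on S (\<lambda>z. frechet_derivative f (at z) v)"
      by (intro smooth_on_frechet_derivative S f smooth_intros)
    note this [THEN smooth_on_has_derivative[OF S _ x], THEN has_derivative_inner_left, of c]
    then have "((\<lambda>z. frechet_derivative (\<lambda>z. f z \<bullet> c) (at z) v) has_derivative
        (\<lambda>w. frechet_derivative (\<lambda>z. frechet_derivative f (at z) v) (at x) w \<bullet> c)) (at x)"
      by (rule has_derivative_transform_within_open[OF _ S x]) (simp add: comp[OF f])
    then show ?thesis by (simp add: frechet_derivative_at[symmetric])
  qed
  have "smooth_on S (\<lambda>z. f z \<bullet> c)"
    by (intro smooth_intros S f)
  from second_derivative_symmetric_real[OF S this x, of a b] show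
    "frechet_derivative (\<lambda>z. frechet_derivative f (at z) a) (at x) b \<bullet> c =
     frechet_derivative (\<lambda>z. frechet_derivative f (at z) b) (at x) a \<bullet> c"
    by (simp add: twice)
qed

section \<open>Tangent vectors\<close>

text \<open>A tangent vector is the velocity of a curve in \<open>M\<close>, so a derivative applied to it depends only
  on the values of the function on \<open>M\<close>. This is how identities that hold only on the twistor
  space are differentiated below.\<close>

lemma tangent_derivative_unique:
  fixes F G :: "'a::euclidean_space \<Rightarrow> 'b::real_normed_vector"
  assumes u: "u \<in> tangent_space M z" and O': "open O'" "z \<in> O'"
    and eq: "\<And>x. x \<in> M \<inter> O' \<Longrightarrow> F x = G x"
    and F: "(F has_derivative F') (at z within M)" and G: "(G has_derivative G') (at z within M)"
  shows "F' u = G' u"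
proof -
  obtain c e where e: "0 < e" "smooth_on {-e<..<e} c" "c ` {-e<..<e} \<subseteq> M" "c (0::real) = z"
    and c: "(c has_vector_derivative u) (at 0)"
    using u unfolding tangent_space_def by blast
  let ?I = "{-e<..<e} :: real set"
  have I: "open ?I" "0 \<in> ?I" using e(1) by auto
  have comp: "((\<lambda>t. H (c t)) has_vector_derivative H' u) (at 0)"
    if H: "(H has_derivative H') (at z within M)" for H :: "'a \<Rightarrow> 'b" and H'
  proof -
    have "(c has_derivative (\<lambda>t. t *\<^sub>R u)) (at 0 within ?I)"
      using c has_derivative_at_withinI unfolding has_vector_derivative_def by blast
    moreover have "(H has_derivative H') (at (c 0) within c ` ?I)"
      using has_derivative_subset[OF H e(3)] e(4) by simp
    ultimately have "((\<lambda>t. H (c t)) has_derivative (\<lambda>t. H' (t *\<^sub>R u))) (at 0 within ?I)"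
      by (rule has_derivative_in_compose)
    then show ?thesis
      using at_within_open[OF I(2,1)]
      by (simp add: has_vector_derivative_def linear_scale[OF has_derivative_linear[OF H]])
  qed
  have "open (?I \<inter> c -` O')"
  proof -
    have "continuous_on ?I c"
      using e(2) Ck_on.simps(1) unfolding smooth_on_def by blast
    then show ?thesis
      using continuous_on_open_vimage[OF I(1), of c] O'(1) by (simp add: Int_commute)
  qed
  moreover have "0 \<in> ?I \<inter> c -` O'" using I e(4) O'(2) by auto
  moreover have "F (c t) = G (c t)" if "t \<in> ?I \<inter> c -` O'" for t
    using that e(3) by (intro eq) auto
  ultimately have "((\<lambda>t. G (c t)) has_vector_derivative F' u) (at 0)"
    by (rule has_vector_derivative_transform_within_open[OF comp[OF F]])
  from vector_derivative_unique_at[OF this comp[OF G]] show ?thesis .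
qed

lemma tangent_space_image:
  fixes f :: "'a::euclidean_space \<Rightarrow> 'b::euclidean_space"
  assumes u: "u \<in> tangent_space M z" and S: "open S" "smooth_on S f" "M \<subseteq> S" "f ` M \<subseteq> N"
    and D: "(f has_derivative f') (at z)"
  shows "f' u \<in> tangent_space N (f z)"
proof -
  obtain c e where e: "0 < e" "smooth_on {-e<..<e} c" "c ` {-e<..<e} \<subseteq> M" "c (0::real) = z"
    and c: "(c has_vector_derivative u) (at 0)"
    using u unfolding tangent_space_def by blast
  have "smooth_on {-e<..<e} (\<lambda>t. f (c t))"
    by (rule smooth_on_compose[where T=S]) (use e S in auto)
  moreover have "((\<lambda>t. f (c t)) has_vector_derivative f' u) (at 0)"
    using c D e(4) has_derivative_compose[of c "\<lambda>t. t *\<^sub>R u" 0 UNIV f f']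
    by (simp add: has_vector_derivative_def linear_scale[OF has_derivative_linear[OF D]])
  ultimately show ?thesis
    unfolding tangent_space_def using e S(4) by (intro CollectI exI[of _ "\<lambda>t. f (c t)"] exI[of _ e]) auto
qed

section \<open>Self-dual forms and imaginary quaternions\<close>

lemma det_4:
  "det (A::'a::comm_ring_1^4^4) =
    A$1$1 * (A$2$2 * (A$3$3 * A$4$4 - A$3$4 * A$4$3) - A$2$3 * (A$3$2 * A$4$4 - A$3$4 * A$4$2) + A$2$4 * (A$3$2 * A$4$3 - A$3$3 * A$4$2))
  - A$1$2 * (A$2$1 * (A$3$3 * A$4$4 - A$3$4 * A$4$3) - A$2$3 * (A$3$1 * A$4$4 - A$3$4 * A$4$1) + A$2$4 * (A$3$1 * A$4$3 - A$3$3 * A$4$1))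
  + A$1$3 * (A$2$1 * (A$3$2 * A$4$4 - A$3$4 * A$4$2) - A$2$2 * (A$3$1 * A$4$4 - A$3$4 * A$4$1) + A$2$4 * (A$3$1 * A$4$2 - A$3$2 * A$4$1))
  - A$1$4 * (A$2$1 * (A$3$2 * A$4$3 - A$3$3 * A$4$2) - A$2$2 * (A$3$1 * A$4$3 - A$3$3 * A$4$1) + A$2$3 * (A$3$1 * A$4$2 - A$3$2 * A$4$1))"
proof -
  have f1: "finite {2::4, 3, 4}" "1 \<notin> {2::4, 3, 4}" by auto
  have f2: "finite {3::4, 4}" "2 \<notin> {3::4, 4}" by auto
  have f3: "finite {4::4}" "3 \<notin> {4::4}" by auto
  show ?thesis
    unfolding det_def UNIV_4
    unfolding sum_over_permutations_insert[OF f1]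
    unfolding sum_over_permutations_insert[OF f2]
    unfolding sum_over_permutations_insert[OF f3]
    unfolding permutes_sing
    by (simp add: sign_swap_id permutation_swap_id sign_compose permutation_compose sign_id Transposition.transpose_def algebra_simps)
qed

text \<open>The matrix of left multiplication by the imaginary quaternion \<open>n\<close>, in the basis
  \<open>1, i, j, k\<close>.\<close>

definition left_mult :: "real^3 \<Rightarrow> real^4^4" where
  "left_mult n = vector [vector [0, - n$1, - n$2, - n$3], vector [n$1, 0, - n$3, n$2],
     vector [n$2, n$3, 0, - n$1], vector [n$3, - n$2, n$1, 0]]"

text \<open>The imaginary part of the image of \<open>1\<close>, which determines a left multiplication.\<close>

definition im_part :: "real^4^4 \<Rightarrow> real^3" where
  "im_part \<alpha> = vector [\<alpha>$2$1, \<alpha>$3$1, \<alpha>$4$1]"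

lemma vector_4 [simp]:
  "(vector [x, y, z, w] :: 'a::zero^4) $ 1 = x"
  "(vector [x, y, z, w] :: 'a::zero^4) $ 2 = y"
  "(vector [x, y, z, w] :: 'a::zero^4) $ 3 = z"
  "(vector [x, y, z, w] :: 'a::zero^4) $ 4 = w"
  by (simp_all add: vector_def)

lemma im_part_left_mult [simp]: "im_part (left_mult n) = n"
  by (simp add: left_mult_def im_part_def vec_eq_iff forall_3)

lemma left_mult_add: "left_mult (a + b) = left_mult a + left_mult b"
  by (simp add: left_mult_def vec_eq_iff forall_4)

lemma left_mult_scaleR: "left_mult (r *\<^sub>R a) = r *\<^sub>R left_mult a"
  by (simp add: left_mult_def vec_eq_iff forall_4)

lemma left_mult_minus: "left_mult (- a) = - left_mult a"
  by (simp add: left_mult_def vec_eq_iff forall_4)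

lemma left_mult_diff: "left_mult (a - b) = left_mult a - left_mult b"
  by (simp add: left_mult_def vec_eq_iff forall_4)

lemma bounded_linear_left_mult: "bounded_linear left_mult"
  by (simp add: linear_conv_bounded_linear[symmetric] linear_iff left_mult_add left_mult_scaleR)

lemma bounded_linear_im_part: "bounded_linear im_part"
  by (simp add: linear_conv_bounded_linear[symmetric] linear_iff im_part_def vec_eq_iff forall_3)

lemma left_mult_mult: "left_mult a ** left_mult b = left_mult (cross3 a b) - mat (a \<bullet> b)"
  by (simp add: left_mult_def matrix_matrix_mult_def vec_eq_iff forall_4 sum_4 cross3_def mat_def
      inner_vec_def sum_3 algebra_simps)

lemma mat_mult_left: "mat l ** A = l *\<^sub>R (A :: real^'n^'n)"
  by (simp add: matrix_matrix_mult_def mat_def vec_eq_iff if_distrib if_distribR cong: if_cong)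

lemma mat_mult_right: "A ** mat l = l *\<^sub>R (A :: real^'n^'n)"
  by (simp add: matrix_matrix_mult_def mat_def vec_eq_iff if_distrib if_distribR mult.commute cong: if_cong)

lemma matrix_inv_mat:
  assumes "l \<noteq> (0::real)" shows "matrix_inv (mat l :: real^4^4) = mat (inverse l)"
proof -
  have "mat l ** mat (inverse l) = (mat 1 :: real^4^4)" "mat (inverse l) ** mat l = (mat 1 :: real^4^4)"
    using assms by (simp_all add: mat_mult_left) (simp_all add: mat_def vec_eq_iff)
  then have "matrix_inv (mat l) ** mat l = (mat 1 :: real^4^4)"
    unfolding matrix_inv_def by (metis (mono_tags, lifting) someI_ex)
  then have "l *\<^sub>R matrix_inv (mat l) = (mat 1 :: real^4^4)"
    by (simp add: mat_mult_right)
  then have "matrix_inv (mat l) = inverse l *\<^sub>R (mat 1 :: real^4^4)"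
    using assms by (metis real_vector_eq_affinity scaleR_scaleR left_inverse scaleR_one)
  then show ?thesis
    by (simp add: mat_def vec_eq_iff)
qed

lemma scaleR_matrix_mult_left: "(r *\<^sub>R A) ** B = r *\<^sub>R (A ** (B :: real^'n^'n))"
  by (simp add: matrix_matrix_mult_def vec_eq_iff sum_distrib_left mult.assoc)

lemma scaleR_matrix_mult_right: "A ** (r *\<^sub>R B) = r *\<^sub>R (A ** (B :: real^'n^'n))"
  by (simp add: matrix_matrix_mult_def vec_eq_iff sum_distrib_left mult.left_commute)

lemma raise_conformal:
  fixes g :: metric
  assumes "g x = mat l" "l > 0"
  shows "raise g x \<alpha> = inverse (l\<^sup>2) *\<^sub>R \<alpha>"
  using assms by (simp add: raise_def matrix_inv_mat mat_mult_left mat_mult_right power2_eq_square)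

lemma form_inner_left_mult:
  fixes g :: metric
  assumes "g x = mat l" "l > 0"
  shows "form_inner g x (left_mult a) (left_mult b) = 2 * (a \<bullet> b) / l\<^sup>2"
proof -
  have "form_inner g x \<alpha> \<beta> = inverse (l\<^sup>2) * ((1/2) * (\<Sum>i\<in>UNIV. \<Sum>j\<in>UNIV. \<alpha> $ i $ j * \<beta> $ i $ j))" for \<alpha> \<beta>
    by (simp add: form_inner_def raise_conformal[of g x l, OF assms] sum_distrib_left mult.assoc mult.left_commute)
  moreover have "(1/2) * (\<Sum>i\<in>UNIV. \<Sum>j\<in>UNIV. left_mult a $ i $ j * left_mult b $ i $ j) = 2 * (a \<bullet> b)"
    by (simp add: left_mult_def sum_4 inner_vec_def sum_3)
  ultimately have "form_inner g x (left_mult a) (left_mult b) = inverse (l\<^sup>2) * (2 * (a \<bullet> b))"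
    by (simp only:)
  then show ?thesis by (simp only: divide_inverse mult.commute)
qed

lemma levi_civita_symbol_zero:
  "levi_civita_symbol i i k l = 0" "levi_civita_symbol i j i l = 0" "levi_civita_symbol i j k i = 0"
  "levi_civita_symbol i j j l = 0" "levi_civita_symbol i j k j = 0" "levi_civita_symbol i j k k = 0"
  unfolding levi_civita_symbol_def det_4 by (simp_all add: algebra_simps)

lemma levi_civita_symbol_one:
  "levi_civita_symbol 1 2 3 4 = 1" "levi_civita_symbol 1 2 4 3 = -1" "levi_civita_symbol 1 3 2 4 = -1"
  "levi_civita_symbol 1 3 4 2 = 1" "levi_civita_symbol 1 4 2 3 = 1" "levi_civita_symbol 1 4 3 2 = -1"
  "levi_civita_symbol 2 1 3 4 = -1" "levi_civita_symbol 2 1 4 3 = 1" "levi_civita_symbol 2 3 1 4 = 1"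
  "levi_civita_symbol 2 3 4 1 = -1" "levi_civita_symbol 2 4 1 3 = -1" "levi_civita_symbol 2 4 3 1 = 1"
  "levi_civita_symbol 3 1 2 4 = 1" "levi_civita_symbol 3 1 4 2 = -1" "levi_civita_symbol 3 2 1 4 = -1"
  "levi_civita_symbol 3 2 4 1 = 1" "levi_civita_symbol 3 4 1 2 = 1" "levi_civita_symbol 3 4 2 1 = -1"
  "levi_civita_symbol 4 1 2 3 = -1" "levi_civita_symbol 4 1 3 2 = 1" "levi_civita_symbol 4 2 1 3 = 1"
  "levi_civita_symbol 4 2 3 1 = -1" "levi_civita_symbol 4 3 1 2 = -1" "levi_civita_symbol 4 3 2 1 = 1"
  unfolding levi_civita_symbol_def det_4 by (simp_all add: axis_def)

lemmas levi_civita_symbols = levi_civita_symbol_zero levi_civita_symbol_one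

text \<open>The Hodge star on two-forms is conformally invariant in dimension four, so self-duality can be
  read off from the Levi-Civita symbol alone.\<close>

lemma self_dual_forms_conformal:
  fixes g :: metric
  assumes "g x = mat l" "l > 0"
  shows "self_dual_forms g x = range left_mult"
proof -
  have star: "hodge_star g x \<alpha> = (\<chi> k l. (1/2) * (\<Sum>i\<in>UNIV. \<Sum>j\<in>UNIV. \<alpha> $ i $ j * levi_civita_symbol i j k l))"
    for \<alpha>
  proof -
    have "det (g x) = (l\<^sup>2)\<^sup>2"
      unfolding det_4 assms(1) by (simp add: mat_def power2_eq_square)
    then have "sqrt (det (g x)) = l\<^sup>2"
      using real_sqrt_abs[of "l\<^sup>2"] by (simp only: abs_power2)
    then show ?thesis
      using assms(2)
      by (simp add: hodge_star_def raise_conformal[of g x l, OF assms] sum_distrib_left[symmetric] mult.assoc vec_eq_iff)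
  qed
  show ?thesis
  proof (intro equalityI subsetI)
    fix \<alpha> assume "\<alpha> \<in> self_dual_forms g x"
    then have T: "transpose \<alpha> = - \<alpha>" and H: "hodge_star g x \<alpha> = \<alpha>"
      by (auto simp: self_dual_forms_def)
    have t: "\<alpha> $ i $ j = - \<alpha> $ j $ i" for i j
      using arg_cong[OF T, of "\<lambda>A. A $ j $ i"] by (simp add: transpose_def)
    have h: "\<alpha> $ i $ j = (1/2) * (\<Sum>k\<in>UNIV. \<Sum>l\<in>UNIV. \<alpha> $ k $ l * levi_civita_symbol k l i j)" for i j
      using arg_cong[OF H[symmetric], of "\<lambda>A. A $ i $ j"] unfolding star vec_lambda_beta .
    have dual: "\<alpha> $ 2 $ 1 = \<alpha> $ 4 $ 3" "\<alpha> $ 3 $ 1 = \<alpha> $ 2 $ 4" "\<alpha> $ 4 $ 1 = \<alpha> $ 3 $ 2"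
      using h[of 2 1] h[of 3 1] h[of 4 1] t[of 3 4] t[of 4 2] t[of 2 3]
      by (simp_all add: sum_4 levi_civita_symbols)
    have diag: "\<alpha> $ i $ i = 0" for i
      using t[of i i] by linarith
    have "\<alpha> = left_mult (im_part \<alpha>)"
      unfolding vec_eq_iff forall_4 left_mult_def im_part_def vector_4 vector_3
      using dual diag t[of 1 2] t[of 1 3] t[of 1 4] t[of 2 3] t[of 4 2] t[of 3 4] by metis
    then show "\<alpha> \<in> range left_mult" by blast
  next
    fix \<alpha> assume "\<alpha> \<in> range left_mult"
    then obtain n where "\<alpha> = left_mult n" by blast
    then show "\<alpha> \<in> self_dual_forms g x"
      by (simp add: self_dual_forms_def star levi_civita_symbols left_mult_def vec_eq_iff forall_4 sum_4 transpose_def)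
  qed
qed

section \<open>The Levi-Civita connection of hyperbolic space\<close>

definition conf :: "real^4 \<Rightarrow> real" where
  "conf x = 4 / (1 - (norm x)\<^sup>2)\<^sup>2"

lemma hyp_metric_conf: "hyp_metric x = mat (conf x)"
  by (simp add: hyp_metric_def conf_def)

lemma ball_pos: "x \<in> H4 \<Longrightarrow> 0 < 1 - (norm x)\<^sup>2"
  by (simp add: power_less_one_iff)

lemma conf_pos: "x \<in> H4 \<Longrightarrow> conf x > 0"
  using ball_pos[of x] by (simp add: conf_def)

definition dconf :: "real^4 \<Rightarrow> real^4 \<Rightarrow> real" where
  "dconf x v = 16 * (x \<bullet> v) / (1 - (norm x)\<^sup>2)^3"

lemma conf_has_derivative:
  assumes "x \<in> H4" shows "(conf has_derivative dconf x) (at x)"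
proof -
  have *: "1 - x \<bullet> x > 0" using ball_pos[OF assms] by (simp add: power2_norm_eq_inner)
  have eq: "conf = (\<lambda>x. 4 / (1 - x \<bullet> x)\<^sup>2)"
    by (auto simp: conf_def power2_norm_eq_inner)
  define w where "w = 1 - x \<bullet> x"
  have w: "w > 0" using * by (simp add: w_def)
  have "((\<lambda>x. 4 / (1 - x \<bullet> x)\<^sup>2) has_derivative
      (\<lambda>v. - (4 * (inverse (w\<^sup>2) * (2 * (- (x \<bullet> v + v \<bullet> x)) * w) * inverse (w\<^sup>2))))) (at x)"
    unfolding w_def using * by (auto intro!: derivative_eq_intros simp: divide_inverse)
  also have "(\<lambda>v. - (4 * (inverse (w\<^sup>2) * (2 * (- (x \<bullet> v + v \<bullet> x)) * w) * inverse (w\<^sup>2)))) = dconf x"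
  proof
    fix v
    show "- (4 * (inverse (w\<^sup>2) * (2 * (- (x \<bullet> v + v \<bullet> x)) * w) * inverse (w\<^sup>2))) = dconf x v"
      unfolding dconf_def power2_norm_eq_inner w_def[symmetric] inner_commute[of v]
      using w by (simp add: field_simps power2_eq_square power3_eq_cube)
  qed
  finally show ?thesis unfolding eq .
qed

text \<open>The imaginary part of the quaternion \<open>v x\<^sup>*\<close>.\<close>

definition quat_im :: "real^4 \<Rightarrow> real^4 \<Rightarrow> real^3" where
  "quat_im v x = vector [v$2 * x$1 - v$1 * x$2 + v$4 * x$3 - v$3 * x$4,
     v$3 * x$1 - v$1 * x$3 + v$2 * x$4 - v$4 * x$2,
     v$4 * x$1 - v$1 * x$4 + v$3 * x$2 - v$2 * x$3]"

lemma quat_im_scaleR_right: "quat_im v (c *\<^sub>R x) = c *\<^sub>R quat_im v x"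
  by (simp add: quat_im_def vec_eq_iff forall_3 algebra_simps)

text \<open>The connection form of \<open>\<Lambda>\<^sup>+\<close> in the trivialisation by \<open>left_mult\<close>, as an infinitesimal
  rotation of \<open>\<real>\<^sup>3\<close>.\<close>

definition conn :: "real^4 \<Rightarrow> real^4 \<Rightarrow> real^3" where
  "conn x v = (2 / (1 - (norm x)\<^sup>2)) *\<^sub>R quat_im v x"

text \<open>The general formula for a conformally flat metric \<open>exp (2 h)\<close>, with \<open>\<phi>\<close> the gradient of
  \<open>h = ln (2 / (1 - \<bar>x\<bar>\<^sup>2))\<close>.\<close>

lemma christoffel_hyp:
  assumes "x \<in> H4"
  shows "christoffel hyp_metric x m i j =
    (let \<phi> = (2 / (1 - (norm x)\<^sup>2)) *\<^sub>R x in
     (if j = m then \<phi> $ i else 0) + (if i = m then \<phi> $ j else 0) - (if i = j then \<phi> $ m else 0))"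
proof -
  have dg: "frechet_derivative (\<lambda>y. hyp_metric y $ b $ c) (at x) (axis a 1) =
      (if b = c then dconf x (axis a 1) else 0)" for a b c
  proof (cases "b = c")
    case True
    then have "(\<lambda>y. hyp_metric y $ b $ c) = conf"
      by (simp add: hyp_metric_conf mat_def fun_eq_iff)
    then show ?thesis using True frechet_derivative_at[OF conf_has_derivative[OF assms]] by simp
  next
    case False
    then have "(\<lambda>y. hyp_metric y $ b $ c) = (\<lambda>y. 0)"
      by (simp add: hyp_metric_conf mat_def fun_eq_iff)
    then show ?thesis using False by simp
  qed
  have ratio: "inverse (conf x) * dconf x (axis a 1) = 2 * ((2 / (1 - (norm x)\<^sup>2)) *\<^sub>R x) $ a" for a
  proof -
    define w where "w = 1 - (norm x)\<^sup>2"
    have "w > 0" using ball_pos[OF assms] by (simp add: w_def)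
    then show ?thesis
      unfolding conf_def dconf_def w_def[symmetric]
      by (simp add: inner_axis field_simps power2_eq_square power3_eq_cube)
  qed
  have inv: "matrix_inv (hyp_metric x) $ m $ l = (if l = m then inverse (conf x) else 0)" for l
  proof -
    have "matrix_inv (hyp_metric x) = mat (inverse (conf x))"
      unfolding hyp_metric_conf using conf_pos[OF assms] by (intro matrix_inv_mat) simp
    then show ?thesis by (auto simp: mat_def)
  qed
  have "christoffel hyp_metric x m i j = (1/2) * (inverse (conf x) *
     ((if j = m then dconf x (axis i 1) else 0) + (if i = m then dconf x (axis j 1) else 0)
      - (if i = j then dconf x (axis m 1) else 0)))"
    unfolding christoffel_def Let_def dg inv by (simp add: mult_delta_left)
  also have "\<dots> = (1/2) * ((if j = m then inverse (conf x) * dconf x (axis i 1) else 0)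
     + (if i = m then inverse (conf x) * dconf x (axis j 1) else 0)
     - (if i = j then inverse (conf x) * dconf x (axis m 1) else 0))"
    by (simp add: algebra_simps)
  finally have C: "christoffel hyp_metric x m i j = \<dots>" .
  show ?thesis
    unfolding C ratio Let_def by (cases "j = m"; cases "i = m"; cases "i = j") (simp_all add: algebra_simps)
qed

text \<open>In matrix terms the connection acts on \<open>\<alpha>\<close> as \<open>[v \<phi>\<^sup>T - \<phi> v\<^sup>T, \<alpha>] - 2 (\<phi> \<bullet> v) \<alpha>\<close>. Only the
  self-dual part of the skew matrix fails to commute with left multiplications; it is half the left
  multiplication by \<open>Im (v \<phi>\<^sup>*)\<close>, and a commutator of left multiplications is twice a cross
  product.\<close>

lemma lc_form_hyp_left_mult:
  assumes "x \<in> H4"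
  shows "lc_form hyp_metric x v (left_mult n) =
    left_mult (cross3 (conn x v) n - (4 * (x \<bullet> v) / (1 - (norm x)\<^sup>2)) *\<^sub>R n)"
proof -
  define \<phi> where "\<phi> = (2 / (1 - (norm x)\<^sup>2)) *\<^sub>R x"
  have lc: "lc_form hyp_metric x v \<alpha> = (\<chi> j k. - (\<Sum>i\<in>UNIV. \<Sum>m\<in>UNIV. v $ i *
     (((if j = m then \<phi> $ i else 0) + (if i = m then \<phi> $ j else 0) - (if i = j then \<phi> $ m else 0)) * \<alpha> $ m $ k
    + ((if k = m then \<phi> $ i else 0) + (if i = m then \<phi> $ k else 0) - (if i = k then \<phi> $ m else 0)) * \<alpha> $ j $ m)))"
    for \<alpha>
    by (simp add: lc_form_def christoffel_hyp[OF assms] \<phi>_def[symmetric] Let_def)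
  have "lc_form hyp_metric x v (left_mult n) = left_mult (cross3 (quat_im v \<phi>) n - (2 * (\<phi> \<bullet> v)) *\<^sub>R n)"
    unfolding lc
    by (simp add: vec_eq_iff forall_4 sum_4 left_mult_def cross3_def quat_im_def inner_vec_def algebra_simps)
  moreover have "quat_im v \<phi> = conn x v"
    by (simp add: conn_def \<phi>_def quat_im_scaleR_right)
  moreover have "2 * (\<phi> \<bullet> v) = 4 * (x \<bullet> v) / (1 - (norm x)\<^sup>2)"
    by (simp add: \<phi>_def)
  ultimately show ?thesis by simp
qed

section \<open>Coordinates on the twistor space\<close>

text \<open>The factor by which \<open>left_mult n\<close> has to be scaled to have the length of \<open>n\<close>.\<close>

definition fscale :: "real^4 \<Rightarrow> real" where
  "fscale x = conf x / sqrt 2"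

definition dfscale :: "real^4 \<Rightarrow> real^4 \<Rightarrow> real" where
  "dfscale x v = dconf x v / sqrt 2"

definition tw_param :: "(real^4) \<times> (real^3) \<Rightarrow> (real^4) \<times> (real^4^4)" where
  "tw_param p = (fst p, fscale (fst p) *\<^sub>R left_mult (snd p))"

definition dtw_param :: "(real^4) \<times> (real^3) \<Rightarrow> (real^4) \<times> (real^3) \<Rightarrow> (real^4) \<times> (real^4^4)" where
  "dtw_param p w = (fst w, dfscale (fst p) (fst w) *\<^sub>R left_mult (snd p) + fscale (fst p) *\<^sub>R left_mult (snd w))"

definition tw_dir :: "(real^4) \<times> (real^4^4) \<Rightarrow> real^3" where
  "tw_dir z = inverse (fscale (fst z)) *\<^sub>R im_part (snd z)"

lemma fscale_pos: "x \<in> H4 \<Longrightarrow> fscale x > 0"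
  using conf_pos by (simp add: fscale_def)

lemma tw_dir_scaled [simp]: "x \<in> H4 \<Longrightarrow> tw_dir (x, fscale x *\<^sub>R left_mult m) = m"
  using fscale_pos[of x]
  by (simp add: tw_dir_def left_mult_scaleR[symmetric])

lemma fscale_has_derivative: "x \<in> H4 \<Longrightarrow> (fscale has_derivative dfscale x) (at x)"
  using has_derivative_mult_right[OF conf_has_derivative, of x "inverse (sqrt 2)"]
  by (simp add: fscale_def[abs_def] dfscale_def[abs_def] divide_inverse mult.commute)

lemma smooth_on_conf [smooth_intros]:
  assumes "open S" "smooth_on S f" "f ` S \<subseteq> H4"
  shows "smooth_on S (\<lambda>x. conf (f x))"
proof -
  have "0 < (1 - f x \<bullet> f x)\<^sup>2" if "x \<in> S" for x
    using ball_pos[of "f x"] that assms(3) by (auto simp: power2_norm_eq_inner)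
  then have "smooth_on S (\<lambda>x. 4 / (1 - f x \<bullet> f x)\<^sup>2)"
    by (intro smooth_intros assms)
  then show ?thesis by (simp add: conf_def power2_norm_eq_inner)
qed

lemma smooth_on_fscale [smooth_intros]:
  assumes "open S" "smooth_on S f" "f ` S \<subseteq> H4"
  shows "smooth_on S (\<lambda>x. fscale (f x))"
  unfolding fscale_def by (intro smooth_intros assms) auto

lemmas [smooth_intros] = smooth_on_linear[OF bounded_linear_left_mult] smooth_on_linear[OF bounded_linear_im_part]

lemma bounded_bilinear_cross3: "bounded_bilinear cross3"
  by (simp add: bilinear_conv_bounded_bilinear[symmetric] bilinear_def linear_iff
      cross_add_left cross_add_right cross_mult_left cross_mult_right)

lemma bounded_bilinear_quat_im: "bounded_bilinear quat_im"
  by (simp add: bilinear_conv_bounded_bilinear[symmetric] bilinear_def linear_iff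
      quat_im_def vec_eq_iff forall_3 algebra_simps)

lemmas [smooth_intros] = smooth_on_bilinear[OF bounded_bilinear_cross3] smooth_on_bilinear[OF bounded_bilinear_quat_im]

lemma smooth_on_conn [smooth_intros]:
  assumes "open S" "smooth_on S f" "f ` S \<subseteq> H4" "smooth_on S v"
  shows "smooth_on S (\<lambda>x. conn (f x) (v x))"
proof -
  have "0 < 1 - f x \<bullet> f x" if "x \<in> S" for x
    using ball_pos[of "f x"] that assms(3) by (auto simp: power2_norm_eq_inner)
  then have "smooth_on S (\<lambda>x. (2 / (1 - f x \<bullet> f x)) *\<^sub>R quat_im (v x) (f x))"
    by (intro smooth_intros assms)
  then show ?thesis by (simp add: conn_def power2_norm_eq_inner)
qed

lemma smooth_on_dfscale [smooth_intros]:
  assumes "open S" "smooth_on S f" "f ` S \<subseteq> H4" "smooth_on S v"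
  shows "smooth_on S (\<lambda>x. dfscale (f x) (v x))"
proof -
  have "0 < (1 - f x \<bullet> f x)^3" if "x \<in> S" for x
    using ball_pos[of "f x"] that assms(3) by (auto simp: power2_norm_eq_inner)
  then have "smooth_on S (\<lambda>x. 16 * (f x \<bullet> v x) / (1 - f x \<bullet> f x)^3 / sqrt 2)"
    by (intro smooth_intros assms) auto
  then show ?thesis by (simp add: dfscale_def dconf_def power2_norm_eq_inner)
qed

lemma open_H4_UNIV: "open (H4 \<times> UNIV)"
  by (intro open_Times) auto

lemma smooth_on_tw_param: "smooth_on (H4 \<times> UNIV) tw_param"
  unfolding tw_param_def[abs_def] by (intro smooth_intros open_H4_UNIV) auto

lemma smooth_on_tw_dir: "smooth_on (H4 \<times> UNIV) tw_dir"
  unfolding tw_dir_def[abs_def] by (intro smooth_intros open_H4_UNIV) (auto intro!: fscale_pos)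

lemma tw_param_has_derivative:
  assumes "fst p \<in> H4"
  shows "(tw_param has_derivative dtw_param p) (at p)"
proof -
  have f: "((\<lambda>p. fscale (fst p)) has_derivative (\<lambda>w. dfscale (fst p) (fst w))) (at p)"
    by (rule has_derivative_compose[OF has_derivative_fst[OF has_derivative_ident] fscale_has_derivative[OF assms]])
  have l: "((\<lambda>p. left_mult (snd p)) has_derivative (\<lambda>w. left_mult (snd w))) (at p)"
    by (rule bounded_linear.has_derivative[OF bounded_linear_left_mult has_derivative_snd[OF has_derivative_ident]])
  show ?thesis
    unfolding tw_param_def[abs_def] dtw_param_def[abs_def]
    by (rule has_derivative_eq_rhs[OF has_derivative_Pair[OF has_derivative_fst[OF has_derivative_ident]
            has_derivative_scaleR[OF f l]]]) (simp add: fun_eq_iff add.commute)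
qed

lemma form_inner_scaled:
  assumes "x \<in> H4"
  shows "form_inner hyp_metric x (fscale x *\<^sub>R left_mult a) (fscale x *\<^sub>R left_mult b) = a \<bullet> b"
proof -
  have "conf x \<noteq> 0" using conf_pos[OF assms] by simp
  then show ?thesis
    unfolding left_mult_scaleR[symmetric]
      form_inner_left_mult[of hyp_metric, OF hyp_metric_conf conf_pos[OF assms]]
    by (simp add: fscale_def power2_eq_square)
qed

lemma self_dual_forms_hyp: "x \<in> H4 \<Longrightarrow> self_dual_forms hyp_metric x = range (\<lambda>a. fscale x *\<^sub>R left_mult a)"
proof -
  assume x: "x \<in> H4"
  have "left_mult n = fscale x *\<^sub>R left_mult (inverse (fscale x) *\<^sub>R n)" for n
    using fscale_pos[OF x] by (simp add: left_mult_scaleR)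
  then show ?thesis
    unfolding self_dual_forms_conformal[of hyp_metric, OF hyp_metric_conf conf_pos[OF x]]
    by (metis (no_types, lifting) left_mult_scaleR rangeI image_subsetI subset_antisym)
qed

lemma twistor_space_hyp: "twistor_space H4 hyp_metric = tw_param ` (H4 \<times> sphere 0 1)"
proof -
  have "(x, \<alpha>) \<in> twistor_space H4 hyp_metric \<longleftrightarrow> (x, \<alpha>) \<in> tw_param ` (H4 \<times> sphere 0 1)" for x \<alpha>
  proof (cases "x \<in> H4")
    case True
    then show ?thesis
      by (auto simp: twistor_space_def self_dual_forms_hyp form_inner_scaled tw_param_def norm_eq_1 image_iff)
  next
    case False
    then show ?thesis by (auto simp: twistor_space_def tw_param_def)
  qed
  then show ?thesis by auto
qed

lemma vertical_space_hyp:
  assumes "x \<in> H4"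
  shows "vertical_space hyp_metric (tw_param (x, n)) = {fscale x *\<^sub>R left_mult m |m. n \<bullet> m = 0}"
  using assms by (auto simp: tw_param_def self_dual_forms_hyp form_inner_scaled)

lemma fibre_rotation_hyp:
  assumes "x \<in> H4" "n \<bullet> m = 0"
  shows "fibre_rotation hyp_metric (tw_param (x, n)) (fscale x *\<^sub>R left_mult m) = fscale x *\<^sub>R left_mult (cross3 n m)"
proof -
  have c: "conf x \<noteq> 0" using conf_pos[OF assms(1)] by simp
  have "sqrt 2 * (fscale x * (inverse (conf x) * fscale x)) = fscale x"
    using c by (simp add: fscale_def real_div_sqrt field_simps)
  moreover have "fibre_rotation hyp_metric (tw_param (x, n)) (fscale x *\<^sub>R left_mult m) =
      (sqrt 2 * (fscale x * (inverse (conf x) * fscale x))) *\<^sub>R (left_mult n ** left_mult m)"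
    by (simp add: tw_param_def hyp_metric_conf matrix_inv_mat[OF c] scaleR_matrix_mult_left
        scaleR_matrix_mult_right mat_mult_right)
  ultimately show ?thesis
    using assms(2) by (simp add: left_mult_mult)
qed

text \<open>The second term is minus the derivative of the scaling factor: in the rescaled frame the
  connection is metric, and only the rotation by \<open>conn\<close> remains.\<close>

lemma lc_form_scaled:
  assumes "x \<in> H4"
  shows "lc_form hyp_metric x v (fscale x *\<^sub>R left_mult m) =
    fscale x *\<^sub>R left_mult (cross3 (conn x v) m) - dfscale x v *\<^sub>R left_mult m"
proof -
  define w where "w = 1 - (norm x)\<^sup>2"
  have "w > 0" using ball_pos[OF assms] by (simp add: w_def)
  then have "fscale x * (4 * (x \<bullet> v) / (1 - (norm x)\<^sup>2)) = dfscale x v"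
    unfolding fscale_def dfscale_def conf_def dconf_def w_def[symmetric]
    by (simp add: field_simps power2_eq_square power3_eq_cube)
  then show ?thesis
    unfolding left_mult_scaleR[symmetric] lc_form_hyp_left_mult[OF assms]
    by (simp add: left_mult_scaleR[symmetric] left_mult_diff[symmetric]
        cross_mult_right scaleR_diff_right mult.commute)
qed

lemma horizontal_lift_hyp:
  assumes "x \<in> H4"
  shows "horizontal_lift hyp_metric (tw_param (x, n)) v = dtw_param (x, n) (v, - cross3 (conn x v) n)"
  by (simp add: tw_param_def dtw_param_def lc_form_scaled[OF assms] left_mult_minus)

lemma dtw_param_linear:
  "dtw_param p (v - v') = dtw_param p v - dtw_param p v'"
  by (simp add: dtw_param_def dfscale_def dconf_def left_mult_diff
      inner_diff_right algebra_simps diff_divide_distrib)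

text \<open>The curve is a straight line, with its spherical component normalised.\<close>

lemma tangent_space_product_sphere:
  fixes n :: "'b::euclidean_space" and x :: "'a::euclidean_space"
  assumes "open U" "x \<in> U" "norm n = 1" "n \<bullet> \<nu> = 0"
  shows "(v, \<nu>) \<in> tangent_space (U \<times> sphere 0 1) (x, n)"
proof -
  obtain e where e: "e > 0" "ball x e \<subseteq> U" using assms openE by blast
  define d where "d = e / (norm v + 1)"
  have pos: "norm v + 1 > 0" by (simp add: add_nonneg_pos)
  have d: "d > 0" using e pos by (simp add: d_def)
  have U: "x + t *\<^sub>R v \<in> U" if "t \<in> {-d<..<d}" for t
  proof -
    have "norm (t *\<^sub>R v) \<le> d * norm v"
      using that by (auto intro!: mult_right_mono)
    also have "\<dots> < e"
      using e pos by (simp add: d_def field_simps)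
    finally show ?thesis using e(2) by (auto simp: dist_norm subset_iff)
  qed
  define c where "c t = (x + t *\<^sub>R v, (1 / sqrt (1 + t\<^sup>2 * (\<nu> \<bullet> \<nu>))) *\<^sub>R (n + t *\<^sub>R \<nu>))" for t :: real
  have pos': "1 + t\<^sup>2 * (\<nu> \<bullet> \<nu>) > 0" for t :: real
    by (simp add: add_pos_nonneg)
  have n: "n \<bullet> n = 1" using assms(3) by (simp add: norm_eq_1)
  have sphere: "snd (c t) \<in> sphere 0 1" for t
  proof -
    have "(n + t *\<^sub>R \<nu>) \<bullet> (n + t *\<^sub>R \<nu>) = 1 + t\<^sup>2 * (\<nu> \<bullet> \<nu>)"
      using n assms(4) by (simp add: inner_add_left inner_add_right inner_commute power2_eq_square)
    then have "norm (n + t *\<^sub>R \<nu>) = sqrt (1 + t\<^sup>2 * (\<nu> \<bullet> \<nu>))"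
      by (simp add: norm_eq_sqrt_inner)
    then show ?thesis using pos'[of t] by (simp add: c_def)
  qed
  have "smooth_on {-d<..<d} c"
    unfolding c_def[abs_def] by (intro smooth_intros) (use pos' in auto)
  moreover have "c ` {-d<..<d} \<subseteq> U \<times> sphere 0 1"
  proof (rule image_subsetI)
    fix t assume "t \<in> {-d<..<d}"
    then have "fst (c t) \<in> U" using U by (simp add: c_def)
    with sphere[of t] show "c t \<in> U \<times> sphere 0 1" by (metis mem_Times_iff)
  qed
  moreover have "c 0 = (x, n)" by (simp add: c_def)
  moreover have "(c has_vector_derivative (v, \<nu>)) (at 0)"
    unfolding c_def[abs_def] has_vector_derivative_def
    by (auto intro!: derivative_eq_intros simp: fun_eq_iff)
  ultimately show ?thesis unfolding tangent_space_def using d by blast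
qed

text \<open>A curve in the twistor space is the image of its own coordinate curve, and differentiating
  \<open>\<bar>n\<bar>\<^sup>2 = 1\<close> gives the orthogonality.\<close>

lemma tangent_space_twistor:
  assumes "x \<in> H4" "norm n = 1"
  shows "tangent_space (twistor_space H4 hyp_metric) (tw_param (x, n)) = {dtw_param (x, n) (v, \<nu>) |v \<nu>. n \<bullet> \<nu> = 0}"
proof (intro equalityI subsetI)
  fix u assume u: "u \<in> tangent_space (twistor_space H4 hyp_metric) (tw_param (x, n))"
  let ?Z = "twistor_space H4 hyp_metric" and ?z = "tw_param (x, n)"
  have z: "?z \<in> H4 \<times> UNIV" using assms by (simp add: tw_param_def)
  define T where "T = frechet_derivative tw_dir (at ?z)"
  have T: "(tw_dir has_derivative T) (at ?z)"
    unfolding T_def by (rule smooth_on_has_derivative[OF open_H4_UNIV smooth_on_tw_dir z])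
  have dirz: "tw_dir ?z = n" using assms by (simp add: tw_param_def)
  have "u = dtw_param (x, n) (fst u, T u)"
  proof (rule tangent_derivative_unique[OF u open_UNIV UNIV_I, where F="\<lambda>z. z" and G="\<lambda>z. tw_param (fst z, tw_dir z)"])
    show "z = tw_param (fst z, tw_dir z)" if "z \<in> ?Z \<inter> UNIV" for z
      using that unfolding twistor_space_hyp by (auto simp: tw_param_def)
    show "((\<lambda>z. z) has_derivative (\<lambda>z. z)) (at ?z within ?Z)" by (rule has_derivative_ident)
    have "((\<lambda>z. (fst z, tw_dir z)) has_derivative (\<lambda>u. (fst u, T u))) (at ?z)"
      by (intro has_derivative_Pair has_derivative_fst has_derivative_ident T)
    moreover have "(tw_param has_derivative dtw_param (x, n)) (at (fst ?z, tw_dir ?z))"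
      unfolding dirz using tw_param_has_derivative[of "(x, n)"] assms(1) by (simp add: tw_param_def)
    ultimately have "((\<lambda>z. tw_param (fst z, tw_dir z)) has_derivative (\<lambda>u. dtw_param (x, n) (fst u, T u))) (at ?z)"
      by (rule has_derivative_compose)
    then show "((\<lambda>z. tw_param (fst z, tw_dir z)) has_derivative (\<lambda>u. dtw_param (x, n) (fst u, T u))) (at ?z within ?Z)"
      by (rule has_derivative_at_withinI)
  qed
  moreover have "T u \<bullet> n + n \<bullet> T u = 0"
  proof (rule tangent_derivative_unique[OF u open_UNIV UNIV_I, where F="\<lambda>z. tw_dir z \<bullet> tw_dir z" and G="\<lambda>z. 1" and G'="\<lambda>u. 0"])
    show "tw_dir z \<bullet> tw_dir z = 1" if "z \<in> ?Z \<inter> UNIV" for z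
      using that unfolding twistor_space_hyp by (auto simp: tw_param_def norm_eq_1)
    have "((\<lambda>z. tw_dir z \<bullet> tw_dir z) has_derivative (\<lambda>u. n \<bullet> T u + T u \<bullet> n)) (at ?z)"
      using has_derivative_inner[OF T T] by (simp add: dirz)
    then show "((\<lambda>z. tw_dir z \<bullet> tw_dir z) has_derivative (\<lambda>u. T u \<bullet> n + n \<bullet> T u)) (at ?z within ?Z)"
      by (simp add: add.commute has_derivative_at_withinI)
  qed (rule has_derivative_const)
  ultimately show "u \<in> {dtw_param (x, n) (v, \<nu>) |v \<nu>. n \<bullet> \<nu> = 0}"
    unfolding inner_commute[of _ n] by auto
next
  fix u assume "u \<in> {dtw_param (x, n) (v, \<nu>) |v \<nu>. n \<bullet> \<nu> = 0}"
  then obtain v \<nu> where u: "u = dtw_param (x, n) (v, \<nu>)" "n \<bullet> \<nu> = 0" by blast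
  have "dtw_param (x, n) (v, \<nu>) \<in> tangent_space (twistor_space H4 hyp_metric) (tw_param (x, n))"
    by (rule tangent_space_image[OF tangent_space_product_sphere[OF open_ball assms u(2)] open_H4_UNIV smooth_on_tw_param])
      (use assms in \<open>auto simp: twistor_space_hyp intro!: tw_param_has_derivative\<close>)
  then show "u \<in> tangent_space (twistor_space H4 hyp_metric) (tw_param (x, n))" by (simp add: u(1))
qed

section \<open>The covariant derivative in coordinates\<close>

lemma open_tw_domain:
  assumes "open N" shows "open {p. fst p \<in> H4 \<and> tw_param p \<in> N}"
proof -
  have "continuous_on (H4 \<times> UNIV) tw_param"
    using smooth_on_tw_param Ck_on.simps(1) unfolding smooth_on_def by blast
  then have "open (tw_param -` N \<inter> (H4 \<times> UNIV))"
    using continuous_on_open_vimage[OF open_H4_UNIV, of tw_param] assms by simp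
  moreover have "tw_param -` N \<inter> (H4 \<times> UNIV) = {p. fst p \<in> H4 \<and> tw_param p \<in> N}"
    by auto
  ultimately show ?thesis by simp
qed

text \<open>The covariant derivative of \<open>V\<close> in coordinates. Here \<open>m\<close> is a section of the bundle of planes
  orthogonal to \<open>n\<close> and \<open>dm\<close> its derivative in the direction \<open>w\<close>; the last term is minus the
  component of \<open>dm + A \<times> m\<close> along \<open>n\<close>, written without derivatives of \<open>m\<close> by means of
  \<open>n \<bullet> m = 0\<close>. In this form the next covariant derivative can be computed from it.\<close>

definition covd3 :: "real^4 \<Rightarrow> real^3 \<Rightarrow> real^3 \<Rightarrow> real^3 \<Rightarrow> (real^4) \<times> (real^3) \<Rightarrow> real^3" where
  "covd3 x n m dm w = dm + cross3 (conn x (fst w)) m + ((snd w + cross3 (conn x (fst w)) n) \<bullet> m) *\<^sub>R n"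

text \<open>The coordinate representation \<open>\<sigma>\<close> has to represent \<open>s\<close> only over the twistor space. So the
  lemmas also apply to a section known only by a formula over the twistor space, such as a
  covariant derivative of another section.\<close>

context
  fixes N :: "((real^4) \<times> (real^4^4)) set" and s :: "(real^4) \<times> (real^4^4) \<Rightarrow> real^4^4"
    and \<sigma> :: "(real^4) \<times> (real^3) \<Rightarrow> real^3" and \<sigma>' s' x n
  assumes N: "open N" "tw_param (x, n) \<in> N"
    and x: "x \<in> H4" and n: "norm n = 1"
    and sec: "\<And>y m. y \<in> H4 \<Longrightarrow> norm m = 1 \<Longrightarrow> tw_param (y, m) \<in> N \<Longrightarrow>
      s (tw_param (y, m)) = fscale y *\<^sub>R left_mult (\<sigma> (y, m)) \<and> m \<bullet> \<sigma> (y, m) = 0"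
    and \<sigma>: "(\<sigma> has_derivative \<sigma>') (at (x, n))"
    and s: "(s has_derivative s') (at (tw_param (x, n)))"
begin

lemma section_derivative:
  assumes "n \<bullet> \<nu> = 0"
  shows "s' (dtw_param (x, n) (v, \<nu>)) = dfscale x v *\<^sub>R left_mult (\<sigma> (x, n)) + fscale x *\<^sub>R left_mult (\<sigma>' (v, \<nu>))"
    and "n \<bullet> \<sigma>' (v, \<nu>) = - (\<nu> \<bullet> \<sigma> (x, n))"
proof -
  let ?W = "{p. fst p \<in> H4 \<and> tw_param p \<in> N}" and ?M = "H4 \<times> sphere 0 1"
  have tangent: "(v, \<nu>) \<in> tangent_space ?M (x, n)"
    by (rule tangent_space_product_sphere[OF open_ball x n assms])
  have W: "open ?W" "(x, n) \<in> ?W"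
    using open_tw_domain[OF N(1)] x N(2) by auto
  have "s' (dtw_param (x, n) (v, \<nu>)) =
      dfscale x (fst (v, \<nu>)) *\<^sub>R left_mult (\<sigma> (x, n)) + fscale x *\<^sub>R left_mult (\<sigma>' (v, \<nu>))"
  proof (rule tangent_derivative_unique[OF tangent W, where F="\<lambda>p. s (tw_param p)" and F'="\<lambda>w. s' (dtw_param (x, n) w)"
        and G="\<lambda>p. fscale (fst p) *\<^sub>R left_mult (\<sigma> p)"
        and G'="\<lambda>w. dfscale x (fst w) *\<^sub>R left_mult (\<sigma> (x, n)) + fscale x *\<^sub>R left_mult (\<sigma>' w)"])
    show "s (tw_param p) = fscale (fst p) *\<^sub>R left_mult (\<sigma> p)" if "p \<in> ?M \<inter> ?W" for p
      using that sec[of "fst p" "snd p"] by auto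
    show "((\<lambda>p. s (tw_param p)) has_derivative (\<lambda>w. s' (dtw_param (x, n) w))) (at (x, n) within ?M)"
      by (rule has_derivative_at_withinI[OF has_derivative_compose[OF tw_param_has_derivative s]]) (use x in simp)
    have f: "((\<lambda>p. fscale (fst p)) has_derivative (\<lambda>w. dfscale x (fst w))) (at (x, n))"
      using has_derivative_compose[OF has_derivative_fst[OF has_derivative_ident], of fscale "dfscale x" "(x, n)" UNIV]
        fscale_has_derivative[OF x] by simp
    have "((\<lambda>p. fscale (fst p) *\<^sub>R left_mult (\<sigma> p)) has_derivative
        (\<lambda>w. fscale x *\<^sub>R left_mult (\<sigma>' w) + dfscale x (fst w) *\<^sub>R left_mult (\<sigma> (x, n)))) (at (x, n))"
      using has_derivative_scaleR[OF f bounded_linear.has_derivative[OF bounded_linear_left_mult \<sigma>]] by simp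
    then show "((\<lambda>p. fscale (fst p) *\<^sub>R left_mult (\<sigma> p)) has_derivative
        (\<lambda>w. dfscale x (fst w) *\<^sub>R left_mult (\<sigma> (x, n)) + fscale x *\<^sub>R left_mult (\<sigma>' w))) (at (x, n) within ?M)"
      by (simp add: add.commute has_derivative_at_withinI)
  qed
  then show "s' (dtw_param (x, n) (v, \<nu>)) = dfscale x v *\<^sub>R left_mult (\<sigma> (x, n)) + fscale x *\<^sub>R left_mult (\<sigma>' (v, \<nu>))"
    by simp
  have "n \<bullet> \<sigma>' (v, \<nu>) + snd (v, \<nu>) \<bullet> \<sigma> (x, n) = 0"
  proof (rule tangent_derivative_unique[OF tangent W, where F="\<lambda>p. snd p \<bullet> \<sigma> p" and G="\<lambda>p. 0" and G'="\<lambda>p. 0"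
        and F'="\<lambda>w. n \<bullet> \<sigma>' w + snd w \<bullet> \<sigma> (x, n)"])
    show "snd p \<bullet> \<sigma> p = 0" if "p \<in> ?M \<inter> ?W" for p
      using that sec[of "fst p" "snd p"] by auto
    have "((\<lambda>p. snd p \<bullet> \<sigma> p) has_derivative (\<lambda>w. n \<bullet> \<sigma>' w + snd w \<bullet> \<sigma> (x, n))) (at (x, n))"
      using has_derivative_inner[OF has_derivative_snd[OF has_derivative_ident] \<sigma>] by simp
    then show "((\<lambda>p. snd p \<bullet> \<sigma> p) has_derivative (\<lambda>w. n \<bullet> \<sigma>' w + snd w \<bullet> \<sigma> (x, n))) (at (x, n) within ?M)"
      by (rule has_derivative_at_withinI)
  qed simp_all
  then show "n \<bullet> \<sigma>' (v, \<nu>) = - (\<nu> \<bullet> \<sigma> (x, n))" by simp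
qed

text \<open>The horizontal lift has the coordinates \<open>(v, - A\<^sub>v \<times> n)\<close>, which leaves
  \<open>\<nu> + A\<^sub>v \<times> n\<close> as the vertical part.\<close>

lemma vertical_covd_coords:
  assumes \<nu>: "n \<bullet> \<nu> = 0"
  shows "vertical_covd hyp_metric s (tw_param (x, n)) (dtw_param (x, n) (v, \<nu>)) =
      fscale x *\<^sub>R left_mult (covd3 x n (\<sigma> (x, n)) (\<sigma>' (v, \<nu>)) (v, \<nu>))"
    and "n \<bullet> covd3 x n (\<sigma> (x, n)) (\<sigma>' (v, \<nu>)) (v, \<nu>) = 0"
proof -
  let ?A = "conn x v" and ?z = "tw_param (x, n)" and ?m = "\<sigma> (x, n)"
  let ?\<beta> = "\<nu> + cross3 ?A n"
  have nA: "n \<bullet> (- cross3 ?A n) = 0" "n \<bullet> ?\<beta> = 0"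
    using \<nu> by (simp_all add: dot_cross_self inner_add_right)
  have nm: "n \<bullet> ?m = 0" using sec[OF x n N(2)] by simp
  have nn: "n \<bullet> n = 1" using n by (simp add: norm_eq_1)
  have z: "?z = (x, fscale x *\<^sub>R left_mult n)" by (simp add: tw_param_def)
  have h: "horizontal_lift hyp_metric ?z v = dtw_param (x, n) (v, - cross3 ?A n)"
    by (rule horizontal_lift_hyp[OF x])
  have vert: "dtw_param (x, n) (v, \<nu>) - dtw_param (x, n) (v, - cross3 ?A n) = dtw_param (x, n) (0, ?\<beta>)"
    by (simp add: dtw_param_linear[symmetric])
  have dv: "s' (dtw_param (x, n) (0, ?\<beta>)) = fscale x *\<^sub>R left_mult (\<sigma>' (0, ?\<beta>))"
    by (simp add: section_derivative(1)[OF nA(2)] dfscale_def dconf_def)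
  have dh: "s' (dtw_param (x, n) (v, - cross3 ?A n)) =
      dfscale x v *\<^sub>R left_mult ?m + fscale x *\<^sub>R left_mult (\<sigma>' (v, - cross3 ?A n))"
    by (rule section_derivative(1)[OF nA(1)])
  have "linear \<sigma>'" using \<sigma> has_derivative_linear by blast
  from linear_add[OF this, of "(0, ?\<beta>)" "(v, - cross3 ?A n)"]
  have split: "\<sigma>' (v, \<nu>) = \<sigma>' (0, ?\<beta>) + \<sigma>' (v, - cross3 ?A n)" by simp
  have sz: "s ?z = fscale x *\<^sub>R left_mult ?m" using sec[OF x n N(2)] by simp
  have fst: "fst (dtw_param (x, n) (v, \<nu>)) = v" by (simp add: dtw_param_def)
  have "vertical_covd hyp_metric s ?z (dtw_param (x, n) (v, \<nu>)) =
      (let ds = s'; h = dtw_param (x, n) (v, - cross3 ?A n); d\<^sub>v = ds (dtw_param (x, n) (v, \<nu>) - h)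
       in (d\<^sub>v - form_inner hyp_metric x (fscale x *\<^sub>R left_mult n) d\<^sub>v *\<^sub>R (fscale x *\<^sub>R left_mult n))
        + (ds h + lc_form hyp_metric x v (s ?z)))"
    unfolding z vertical_covd.simps fst frechet_derivative_at[OF s, symmetric, unfolded z] h[unfolded z] ..
  also have "\<dots> = (fscale x *\<^sub>R left_mult (\<sigma>' (0, ?\<beta>))
      - (n \<bullet> \<sigma>' (0, ?\<beta>)) *\<^sub>R (fscale x *\<^sub>R left_mult n))
      + (dfscale x v *\<^sub>R left_mult ?m + fscale x *\<^sub>R left_mult (\<sigma>' (v, - cross3 ?A n))
         + (fscale x *\<^sub>R left_mult (cross3 ?A ?m) - dfscale x v *\<^sub>R left_mult ?m))"
    unfolding Let_def vert dv dh sz lc_form_scaled[OF x] form_inner_scaled[OF x] ..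
  also have "\<dots> = fscale x *\<^sub>R left_mult (covd3 x n ?m (\<sigma>' (v, \<nu>)) (v, \<nu>))"
    unfolding covd3_def split section_derivative(2)[OF nA(2)]
    by (simp add: left_mult_add left_mult_scaleR scaleR_add_right)
  finally show "vertical_covd hyp_metric s ?z (dtw_param (x, n) (v, \<nu>)) =
      fscale x *\<^sub>R left_mult (covd3 x n ?m (\<sigma>' (v, \<nu>)) (v, \<nu>))" .
  have "cross3 ?A n \<bullet> ?m = - (n \<bullet> cross3 ?A ?m)"
    by (simp add: cross3_def inner_vec_def sum_3 algebra_simps)
  then show "n \<bullet> covd3 x n ?m (\<sigma>' (v, \<nu>)) (v, \<nu>) = 0"
    unfolding covd3_def by (simp add: inner_add_right inner_add_left section_derivative(2)[OF \<nu>] nn)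
qed

end

lemma smooth_on_if [smooth_intros]:
  "(c \<Longrightarrow> smooth_on S f) \<Longrightarrow> (\<not> c \<Longrightarrow> smooth_on S g) \<Longrightarrow> smooth_on S (\<lambda>x. if c then f x else g x)"
  by (cases c) simp_all

lemma smooth_on_lc_form [smooth_intros]:
  assumes S: "open S" "smooth_on S x" "x ` S \<subseteq> H4" "smooth_on S v" "smooth_on S \<alpha>"
  shows "smooth_on S (\<lambda>z. lc_form hyp_metric (x z) (v z) (\<alpha> z))"
proof (rule smooth_on_cong[OF S(1)])
  let ?\<phi> = "\<lambda>z. (2 / (1 - x z \<bullet> x z)) *\<^sub>R x z"
  let ?\<Gamma> = "\<lambda>z m i j. (if j = m then ?\<phi> z $ i else 0) + (if i = m then ?\<phi> z $ j else 0) - (if i = j then ?\<phi> z $ m else 0)"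
  have "0 < 1 - x z \<bullet> x z" if "z \<in> S" for z
    using ball_pos[of "x z"] that assms(3) by (auto simp: power2_norm_eq_inner)
  then show "smooth_on S (\<lambda>z. (\<chi> j k. - (\<Sum>i\<in>UNIV. \<Sum>m\<in>UNIV.
     v z $ i * (?\<Gamma> z m i j * \<alpha> z $ m $ k + ?\<Gamma> z m i k * \<alpha> z $ j $ m))) :: real^4^4)"
    by (intro smooth_intros S)
  show "(\<chi> j k. - (\<Sum>i\<in>UNIV. \<Sum>m\<in>UNIV.
     v z $ i * (?\<Gamma> z m i j * \<alpha> z $ m $ k + ?\<Gamma> z m i k * \<alpha> z $ j $ m))) = lc_form hyp_metric (x z) (v z) (\<alpha> z)"
    if "z \<in> S" for z
  proof -
    have "x z \<in> H4" using that assms(3) by blast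
    then show ?thesis
      unfolding lc_form_def by (simp only: christoffel_hyp Let_def power2_norm_eq_inner)
  qed
qed

lemma smooth_on_form_inner [smooth_intros]:
  assumes S: "open S" "smooth_on S x" "x ` S \<subseteq> H4" "smooth_on S \<alpha>" "smooth_on S \<beta>"
  shows "smooth_on S (\<lambda>z. form_inner hyp_metric (x z) (\<alpha> z) (\<beta> z))"
proof (rule smooth_on_cong[OF S(1)])
  show "smooth_on S (\<lambda>z. (1/2) * (\<Sum>i\<in>UNIV. \<Sum>j\<in>UNIV. (inverse ((conf (x z))\<^sup>2) *\<^sub>R \<alpha> z) $ i $ j * \<beta> z $ i $ j))"
    by (intro smooth_intros S) (use conf_pos S(3) in \<open>force simp: image_subset_iff\<close>)
  show "(1/2) * (\<Sum>i\<in>UNIV. \<Sum>j\<in>UNIV. (inverse ((conf (x z))\<^sup>2) *\<^sub>R \<alpha> z) $ i $ j * \<beta> z $ i $ j)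
      = form_inner hyp_metric (x z) (\<alpha> z) (\<beta> z)" if "z \<in> S" for z
  proof -
    have "x z \<in> H4" using that assms(3) by blast
    from raise_conformal[of hyp_metric, OF hyp_metric_conf conf_pos[OF this]]
    show ?thesis by (simp only: form_inner_def)
  qed
qed

text \<open>A second covariant derivative is only meaningful if the first one is differentiable on the
  ambient space, off the twistor space too.\<close>

lemma smooth_on_vertical_covd:
  assumes N: "open N" "N \<subseteq> H4 \<times> UNIV" and s: "smooth_on N s" and Y: "smooth_on N Y"
  shows "smooth_on N (\<lambda>z. vertical_covd hyp_metric s z (Y z))"
proof -
  have eq: "vertical_covd hyp_metric s z w =
     (let ds = frechet_derivative s (at z);
          h = (fst w, - lc_form hyp_metric (fst z) (fst w) (snd z));
          d\<^sub>v = ds (w - h)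
      in (d\<^sub>v - form_inner hyp_metric (fst z) (snd z) d\<^sub>v *\<^sub>R snd z) + (ds h + lc_form hyp_metric (fst z) (fst w) (s z)))"
    for z w
    by (cases z) simp
  have fst: "fst ` N \<subseteq> H4" using N(2) by auto
  show ?thesis
    unfolding eq Let_def by (intro smooth_intros smooth_on_frechet_derivative N(1) s Y fst)
qed

section \<open>The curvature of the vertical tangent bundle\<close>

text \<open>The product rule for \<open>D\<^sub>Y \<sigma>\<close>: the first term is the second derivative of \<open>\<sigma>\<close>, whose symmetry
  removes it from the curvature, and the second one is removed by the Lie bracket.\<close>

lemma derivative_along_field:
  fixes \<sigma> :: "'a::euclidean_space \<Rightarrow> 'b::euclidean_space"
  assumes W: "open W" "p \<in> W" and \<sigma>: "smooth_on W \<sigma>" and Y: "(Y has_derivative Y') (at p)"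
  shows "((\<lambda>q. frechet_derivative \<sigma> (at q) (Y q)) has_derivative
    (\<lambda>u. frechet_derivative (\<lambda>q. frechet_derivative \<sigma> (at q) (Y p)) (at p) u + frechet_derivative \<sigma> (at p) (Y' u))) (at p)"
proof -
  let ?D = "\<lambda>b q. frechet_derivative \<sigma> (at q) b"
  have lin: "linear (\<lambda>b. ?D b q)" if "q \<in> W" for q
    using smooth_on_has_derivative[OF W(1) \<sigma> that] has_derivative_linear by blast
  have DD: "(?D b has_derivative frechet_derivative (?D b) (at p)) (at p)" for b
    by (intro smooth_on_has_derivative[OF W(1) _ W(2)] smooth_on_frechet_derivative W(1) \<sigma> smooth_intros)
  have field: "((\<lambda>q. ?D (Y q) q) has_derivative
      (\<lambda>u. \<Sum>b\<in>Basis. (Y p \<bullet> b) *\<^sub>R frechet_derivative (?D b) (at p) u + (Y' u \<bullet> b) *\<^sub>R ?D b p)) (at p)"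
    if Y: "(Y has_derivative Y') (at p)" for Y Y'
  proof (rule has_derivative_transform_within_open[OF _ W])
    show "((\<lambda>q. \<Sum>b\<in>Basis. (Y q \<bullet> b) *\<^sub>R ?D b q) has_derivative
      (\<lambda>u. \<Sum>b\<in>Basis. (Y p \<bullet> b) *\<^sub>R frechet_derivative (?D b) (at p) u + (Y' u \<bullet> b) *\<^sub>R ?D b p)) (at p)"
      by (intro has_derivative_sum has_derivative_scaleR has_derivative_inner_left Y DD)
    show "(\<Sum>b\<in>Basis. (Y q \<bullet> b) *\<^sub>R ?D b q) = ?D (Y q) q" if "q \<in> W" for q
      by (rule linear_sum_Basis[OF lin[OF that]])
  qed
  have const: "frechet_derivative (?D (Y p)) (at p) u = (\<Sum>b\<in>Basis. (Y p \<bullet> b) *\<^sub>R frechet_derivative (?D b) (at p) u)" for u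
    using frechet_derivative_at[OF field[OF has_derivative_const[of "Y p"]]] by (simp add: fun_eq_iff)
  show ?thesis
    using field[OF Y] unfolding sum.distrib const[symmetric] linear_sum_Basis[OF lin[OF W(2)]] .
qed

text \<open>The derivative of \<open>conn x v\<close> with respect to \<open>x\<close> in the direction \<open>u\<close>.\<close>

definition dconn :: "real^4 \<Rightarrow> real^4 \<Rightarrow> real^4 \<Rightarrow> real^3" where
  "dconn x u v = (4 * (x \<bullet> u) / (1 - (norm x)\<^sup>2)\<^sup>2) *\<^sub>R quat_im v x + (2 / (1 - (norm x)\<^sup>2)) *\<^sub>R quat_im v u"

text \<open>The second derivative of \<open>fscale\<close>.\<close>

definition ddfscale :: "real^4 \<Rightarrow> real^4 \<Rightarrow> real^4 \<Rightarrow> real" where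
  "ddfscale x u v = (16 * (u \<bullet> v) / (1 - (norm x)\<^sup>2)^3 + 96 * (x \<bullet> u) * (x \<bullet> v) / (1 - (norm x)\<^sup>2)^4) / sqrt 2"

lemma conn_has_derivative:
  assumes x: "y p \<in> H4" and y: "(y has_derivative y') (at p)" and V: "(V has_derivative V') (at p)"
  shows "((\<lambda>q. conn (y q) (V q)) has_derivative (\<lambda>u. dconn (y p) (y' u) (V p) + conn (y p) (V' u))) (at p)"
proof -
  define w where "w = 1 - y p \<bullet> y p"
  have w: "w > 0" using ball_pos[OF x] by (simp add: w_def power2_norm_eq_inner)
  have k: "((\<lambda>q. 2 / (1 - y q \<bullet> y q)) has_derivative (\<lambda>u. 4 * (y p \<bullet> y' u) / w\<^sup>2)) (at p)"
  proof (rule has_derivative_eq_rhs)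
    show "((\<lambda>q. 2 / (1 - y q \<bullet> y q)) has_derivative
      (\<lambda>u. - (2 * (inverse w * (- (y p \<bullet> y' u + y' u \<bullet> y p)) * inverse w)))) (at p)"
      unfolding w_def using w unfolding w_def by (auto intro!: derivative_eq_intros y simp: divide_inverse)
    show "(\<lambda>u. - (2 * (inverse w * (- (y p \<bullet> y' u + y' u \<bullet> y p)) * inverse w))) = (\<lambda>u. 4 * (y p \<bullet> y' u) / w\<^sup>2)"
      using w by (auto simp: fun_eq_iff inner_commute[of "y' _"] field_simps power2_eq_square)
  qed
  have "((\<lambda>q. (2 / (1 - y q \<bullet> y q)) *\<^sub>R quat_im (V q) (y q)) has_derivative
     (\<lambda>u. (2 / w) *\<^sub>R (quat_im (V p) (y' u) + quat_im (V' u) (y p)) + (4 * (y p \<bullet> y' u) / w\<^sup>2) *\<^sub>R quat_im (V p) (y p))) (at p)"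
    using has_derivative_scaleR[OF k bounded_bilinear.FDERIV[OF bounded_bilinear_quat_im V y]] by (simp add: w_def)
  then show ?thesis
    unfolding conn_def[abs_def] dconn_def power2_norm_eq_inner w_def[symmetric]
    by (rule has_derivative_eq_rhs) (simp add: fun_eq_iff algebra_simps)
qed

lemma dfscale_has_derivative:
  assumes x: "y p \<in> H4" and y: "(y has_derivative y') (at p)" and V: "(V has_derivative V') (at p)"
  shows "((\<lambda>q. dfscale (y q) (V q)) has_derivative (\<lambda>u. ddfscale (y p) (y' u) (V p) + dfscale (y p) (V' u))) (at p)"
proof -
  define w where "w = 1 - y p \<bullet> y p"
  have w: "w > 0" using ball_pos[OF x] by (simp add: w_def power2_norm_eq_inner)
  have k: "((\<lambda>q. 16 / (1 - y q \<bullet> y q)^3) has_derivative (\<lambda>u. 96 * (y p \<bullet> y' u) / w^4)) (at p)"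
  proof (rule has_derivative_eq_rhs)
    show "((\<lambda>q. 16 / (1 - y q \<bullet> y q)^3) has_derivative
      (\<lambda>u. - (16 * (inverse (w^3) * (3 * (- (y p \<bullet> y' u + y' u \<bullet> y p)) * w\<^sup>2) * inverse (w^3))))) (at p)"
      unfolding w_def using w unfolding w_def by (auto intro!: derivative_eq_intros y simp: divide_inverse)
    show "(\<lambda>u. - (16 * (inverse (w^3) * (3 * (- (y p \<bullet> y' u + y' u \<bullet> y p)) * w\<^sup>2) * inverse (w^3)))) =
      (\<lambda>u. 96 * (y p \<bullet> y' u) / w^4)"
      using w by (auto simp: fun_eq_iff inner_commute[of "y' _"] field_simps eval_nat_numeral)
  qed
  have eq: "dfscale x v = (16 / (1 - x \<bullet> x)^3) * (x \<bullet> v) / sqrt 2" for x v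
    by (simp add: dfscale_def dconf_def power2_norm_eq_inner)
  have "((\<lambda>q. (16 / (1 - y q \<bullet> y q)^3) * (y q \<bullet> V q)) has_derivative
     (\<lambda>u. (16 / w^3) * (y p \<bullet> V' u + y' u \<bullet> V p) + (96 * (y p \<bullet> y' u) / w^4) * (y p \<bullet> V p))) (at p)"
    using has_derivative_mult[OF k has_derivative_inner[OF y V]] by (simp add: w_def)
  from has_derivative_mult_left[OF this, of "inverse (sqrt 2)"] show ?thesis
    unfolding eq[abs_def] ddfscale_def power2_norm_eq_inner w_def[symmetric] divide_inverse[of _ "sqrt 2"]
    by (rule has_derivative_eq_rhs) (simp add: fun_eq_iff algebra_simps add_divide_distrib)
qed

lemma ddfscale_commute: "ddfscale x u v = ddfscale x v u"
  by (simp add: ddfscale_def inner_commute mult.commute mult.left_commute)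

text \<open>The inverse of \<open>dtw_param p\<close>, extended to all ambient vectors so that it is defined off the
  twistor space and smooth.\<close>

definition tw_coord :: "(real^4) \<times> (real^3) \<Rightarrow> (real^4) \<times> (real^4^4) \<Rightarrow> (real^4) \<times> (real^3)" where
  "tw_coord p w = (fst w, inverse (fscale (fst p)) *\<^sub>R (im_part (snd w) - dfscale (fst p) (fst w) *\<^sub>R snd p))"

lemma tw_coord_dtw_param [simp]: "fst p \<in> H4 \<Longrightarrow> tw_coord p (dtw_param p w) = w"
  using fscale_pos[of "fst p"]
  by (cases w) (simp add: tw_coord_def dtw_param_def left_mult_scaleR[symmetric] left_mult_add[symmetric])

lemma smooth_on_tw_coord:
  assumes "open W" "\<And>p. p \<in> W \<Longrightarrow> fst p \<in> H4" "smooth_on W X"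
  shows "smooth_on W (\<lambda>p. tw_coord p (X p))"
  unfolding tw_coord_def by (intro smooth_intros assms) (use assms(2) fscale_pos in auto)

text \<open>The first summand of \<open>X'\<close> is the second derivative of \<open>tw_param\<close>. It is symmetric in the two
  vectors and so drops out of the Lie bracket.\<close>

lemma field_derivative:
  assumes N: "open N" "tw_param (x, n) \<in> N"
    and x: "x \<in> H4" and n: "norm n = 1" and \<nu>: "n \<bullet> \<nu> = 0"
    and field: "\<And>p. fst p \<in> H4 \<Longrightarrow> norm (snd p) = 1 \<Longrightarrow> tw_param p \<in> N \<Longrightarrow>
      X (tw_param p) = dtw_param p (C p) \<and> snd p \<bullet> snd (C p) = 0"
    and C: "(C has_derivative C') (at (x, n))"
    and X: "(X has_derivative X') (at (tw_param (x, n)))"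
  shows "X' (dtw_param (x, n) (v, \<nu>)) = (0, (ddfscale x v (fst (C (x, n)))) *\<^sub>R left_mult n
      + dfscale x (fst (C (x, n))) *\<^sub>R left_mult \<nu> + dfscale x v *\<^sub>R left_mult (snd (C (x, n)))) + dtw_param (x, n) (C' (v, \<nu>))"
      (is "_ = ?B (v, \<nu>)")
    and "n \<bullet> snd (C' (v, \<nu>)) = - (\<nu> \<bullet> snd (C (x, n)))"
proof -
  let ?W = "{p. fst p \<in> H4 \<and> tw_param p \<in> N}" and ?M = "H4 \<times> sphere 0 1"
  have tangent: "(v, \<nu>) \<in> tangent_space ?M (x, n)"
    by (rule tangent_space_product_sphere[OF open_ball x n \<nu>])
  have W: "open ?W" "(x, n) \<in> ?W"
    using open_tw_domain[OF N(1)] x N(2) by auto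
  let ?G' = "\<lambda>w. (0, (ddfscale x (fst w) (fst (C (x, n)))) *\<^sub>R left_mult n
      + dfscale x (fst (C (x, n))) *\<^sub>R left_mult (snd w) + dfscale x (fst w) *\<^sub>R left_mult (snd (C (x, n)))) + dtw_param (x, n) (C' w)"
  have "X' (dtw_param (x, n) (v, \<nu>)) = ?G' (v, \<nu>)"
  proof (rule tangent_derivative_unique[OF tangent W, where F="\<lambda>p. X (tw_param p)" and F'="\<lambda>w. X' (dtw_param (x, n) w)"
        and G="\<lambda>p. dtw_param p (C p)" and G'="?G'"])
    show "X (tw_param p) = dtw_param p (C p)" if "p \<in> ?M \<inter> ?W" for p
      using that field[of p] by auto
    show "((\<lambda>p. X (tw_param p)) has_derivative (\<lambda>w. X' (dtw_param (x, n) w))) (at (x, n) within ?M)"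
      by (rule has_derivative_at_withinI[OF has_derivative_compose[OF tw_param_has_derivative X]]) (use x in simp)
    have f: "((\<lambda>p. fscale (fst p)) has_derivative (\<lambda>w. dfscale x (fst w))) (at (x, n))"
      using has_derivative_compose[OF has_derivative_fst[OF has_derivative_ident], of fscale "dfscale x" "(x, n)" UNIV]
        fscale_has_derivative[OF x] by simp
    have df: "((\<lambda>p. dfscale (fst p) (fst (C p))) has_derivative
        (\<lambda>w. ddfscale x (fst w) (fst (C (x, n))) + dfscale x (fst (C' w)))) (at (x, n))"
      using dfscale_has_derivative[OF _ has_derivative_fst[OF has_derivative_ident] has_derivative_fst[OF C]] x by simp
    have l: "((\<lambda>p. left_mult (snd p)) has_derivative (\<lambda>w. left_mult (snd w))) (at (x, n))"
      by (rule bounded_linear.has_derivative[OF bounded_linear_left_mult has_derivative_snd[OF has_derivative_ident]])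
    have "((\<lambda>p. dtw_param p (C p)) has_derivative ?G') (at (x, n))"
      unfolding dtw_param_def
      by (rule has_derivative_eq_rhs[OF has_derivative_Pair[OF has_derivative_fst[OF C] has_derivative_add[OF
              has_derivative_scaleR[OF df l] has_derivative_scaleR[OF f
              bounded_linear.has_derivative[OF bounded_linear_left_mult has_derivative_snd[OF C]]]]]])
        (simp add: fun_eq_iff algebra_simps)
    then show "((\<lambda>p. dtw_param p (C p)) has_derivative ?G') (at (x, n) within ?M)"
      by (rule has_derivative_at_withinI)
  qed
  then show "X' (dtw_param (x, n) (v, \<nu>)) = ?B (v, \<nu>)" by simp
  have "n \<bullet> snd (C' (v, \<nu>)) + snd (v, \<nu>) \<bullet> snd (C (x, n)) = 0"
  proof (rule tangent_derivative_unique[OF tangent W, where F="\<lambda>p. snd p \<bullet> snd (C p)" and G="\<lambda>p. 0" and G'="\<lambda>p. 0"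
        and F'="\<lambda>w. n \<bullet> snd (C' w) + snd w \<bullet> snd (C (x, n))"])
    show "snd p \<bullet> snd (C p) = 0" if "p \<in> ?M \<inter> ?W" for p
      using that field[of p] by auto
    have "((\<lambda>p. snd p \<bullet> snd (C p)) has_derivative (\<lambda>w. n \<bullet> snd (C' w) + snd w \<bullet> snd (C (x, n)))) (at (x, n))"
      using has_derivative_inner[OF has_derivative_snd[OF has_derivative_ident] has_derivative_snd[OF C]] by simp
    then show "((\<lambda>p. snd p \<bullet> snd (C p)) has_derivative (\<lambda>w. n \<bullet> snd (C' w) + snd w \<bullet> snd (C (x, n)))) (at (x, n) within ?M)"
      by (rule has_derivative_at_withinI)
  qed simp_all
  then show "n \<bullet> snd (C' (v, \<nu>)) = - (\<nu> \<bullet> snd (C (x, n)))" by simp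
qed

text \<open>By the Jacobi and Lagrange identities \<open>T\<close> agrees up to multiples of \<open>n\<close> with
  \<open>(dA + A\<^sub>1 \<times> A\<^sub>2 - B\<^sub>1 \<times> B\<^sub>2) \<times> m\<close>. The part of this orthogonal to \<open>n\<close> is the rotation of
  \<open>m\<close> by the component of the first factor along \<open>n\<close>. Since \<open>T\<close> is orthogonal to \<open>n\<close>, the
  coefficient \<open>\<kappa>\<close> need not be known.\<close>

lemma curvature_algebra:
  fixes n m A\<^sub>1 A\<^sub>2 B\<^sub>1 B\<^sub>2 dA T :: "real^3"
  assumes n: "n \<bullet> n = 1" and m: "n \<bullet> m = 0" and T: "n \<bullet> T = 0"
    and T_eq: "T = cross3 dA m + (cross3 A\<^sub>1 (cross3 A\<^sub>2 m) - cross3 A\<^sub>2 (cross3 A\<^sub>1 m))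
      + ((B\<^sub>2 \<bullet> m) *\<^sub>R B\<^sub>1 - (B\<^sub>1 \<bullet> m) *\<^sub>R B\<^sub>2) + \<kappa> *\<^sub>R n"
  shows "T = (n \<bullet> cross3 B\<^sub>1 B\<^sub>2 - n \<bullet> (dA + cross3 A\<^sub>1 A\<^sub>2)) *\<^sub>R (- cross3 n m)"
proof -
  define G where "G = dA + cross3 A\<^sub>1 A\<^sub>2 - cross3 B\<^sub>1 B\<^sub>2"
  have TG: "T = cross3 G m + \<kappa> *\<^sub>R n"
    unfolding T_eq G_def by (simp add: vec_eq_iff forall_3 cross3_def inner_vec_def sum_3 algebra_simps)
  have "\<kappa> = - (n \<bullet> cross3 G m)"
    using T n unfolding TG by (simp add: inner_add_right)
  then have "T = - cross3 n (cross3 n (cross3 G m))"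
    unfolding TG using n Lagrange[of n n "cross3 G m"] by simp
  also have "cross3 n (cross3 G m) = - (n \<bullet> G) *\<^sub>R m"
    unfolding Lagrange using m by simp
  finally show ?thesis
    by (simp add: G_def cross_mult_right inner_diff_right inner_add_right)
qed

text \<open>The form \<open>\<sigma> - d\<langle>n, A\<rangle>\<close> on \<open>H4 \<times> S\<^sup>2\<close>, where \<open>\<sigma>\<close> is the area form of the sphere.\<close>

definition twistor_density :: "real^4 \<Rightarrow> real^3 \<Rightarrow> (real^4) \<times> (real^3) \<Rightarrow> (real^4) \<times> (real^3) \<Rightarrow> real" where
  "twistor_density x n u w = n \<bullet> cross3 (snd u) (snd w) - snd u \<bullet> conn x (fst w) + snd w \<bullet> conn x (fst u)
     - n \<bullet> (dconn x (fst u) (fst w) - dconn x (fst w) (fst u))"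

text \<open>The area of the vertical parts minus the component of the curvature of \<open>A\<close> along \<open>n\<close>: the terms
  quadratic in \<open>A\<close> cancel, and what remains is \<open>\<sigma> - d\<langle>n, A\<rangle>\<close>.\<close>

lemma twistor_density_eq:
  fixes n \<nu>\<^sub>1 \<nu>\<^sub>2 :: "real^3"
  assumes n: "n \<bullet> n = 1" and \<nu>: "n \<bullet> \<nu>\<^sub>1 = 0" "n \<bullet> \<nu>\<^sub>2 = 0"
  shows "n \<bullet> cross3 (\<nu>\<^sub>1 + cross3 (conn x v\<^sub>1) n) (\<nu>\<^sub>2 + cross3 (conn x v\<^sub>2) n)
      - n \<bullet> ((dconn x v\<^sub>1 v\<^sub>2 - dconn x v\<^sub>2 v\<^sub>1) + cross3 (conn x v\<^sub>1) (conn x v\<^sub>2))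
    = twistor_density x n (v\<^sub>1, \<nu>\<^sub>1) (v\<^sub>2, \<nu>\<^sub>2)"
proof -
  have perp: "n \<bullet> cross3 a (cross3 b n) = - (a \<bullet> b)" if "n \<bullet> a = 0" for a b
    unfolding Lagrange using n that by (simp add: inner_diff_right inner_commute)
  have perp': "n \<bullet> cross3 (cross3 b n) a = a \<bullet> b" if "n \<bullet> a = 0" for a b
    using perp[OF that, of b] cross_skew[of a "cross3 b n"] by simp
  have both: "n \<bullet> cross3 (cross3 a n) (cross3 b n) = n \<bullet> cross3 a b" for a b
  proof -
    have "n \<bullet> cross3 (cross3 a n) (cross3 b n) = - (cross3 a n \<bullet> b)"
      by (rule perp) (simp add: dot_cross_self)
    also have "\<dots> = n \<bullet> cross3 a b"
      by (simp add: cross3_def inner_vec_def sum_3 algebra_simps)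
    finally show ?thesis .
  qed
  show ?thesis
    unfolding twistor_density_def
    by (simp add: cross_add_left cross_add_right inner_add_right inner_diff_right perp[OF \<nu>(1)] perp'[OF \<nu>(2)] both)
qed

text \<open>The derivative is explicit only modulo \<open>n\<close>, which is all that \<open>curvature_algebra\<close> asks for.\<close>

lemma second_covd:
  assumes W: "open W" "(x, n) \<in> W" and x: "x \<in> H4" and \<sigma>: "smooth_on W \<sigma>"
    and C: "(C has_derivative C') (at (x, n))"
  obtains \<tau>' \<kappa> where
    "((\<lambda>p. covd3 (fst p) (snd p) (\<sigma> p) (frechet_derivative \<sigma> (at p) (C p)) (C p)) has_derivative \<tau>') (at (x, n))"
    "\<And>w. \<tau>' w = frechet_derivative (\<lambda>q. frechet_derivative \<sigma> (at q) (C (x, n))) (at (x, n)) w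
       + frechet_derivative \<sigma> (at (x, n)) (C' w)
       + (cross3 (conn x (fst (C (x, n)))) (frechet_derivative \<sigma> (at (x, n)) w)
         + cross3 (dconn x (fst w) (fst (C (x, n))) + conn x (fst (C' w))) (\<sigma> (x, n)))
       + (((snd (C (x, n)) + cross3 (conn x (fst (C (x, n)))) n) \<bullet> \<sigma> (x, n)) *\<^sub>R snd w + \<kappa> w *\<^sub>R n)"
proof -
  let ?p = "(x, n)" and ?D = "\<lambda>p. frechet_derivative \<sigma> (at p)"
  note id = has_derivative_ident[of "at ?p"]
  have D: "((\<lambda>p. ?D p (C p)) has_derivative
      (\<lambda>w. frechet_derivative (\<lambda>q. ?D q (C ?p)) (at ?p) w + ?D ?p (C' w))) (at ?p)"
    by (rule derivative_along_field[OF W \<sigma> C])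
  have A: "((\<lambda>p. conn (fst p) (fst (C p))) has_derivative
      (\<lambda>w. dconn x (fst w) (fst (C ?p)) + conn x (fst (C' w)))) (at ?p)"
    using conn_has_derivative[OF _ has_derivative_fst[OF id] has_derivative_fst[OF C]] x by simp
  note \<sigma>' = smooth_on_has_derivative[OF W(1) \<sigma> W(2)]
  note cross = bounded_bilinear.FDERIV[OF bounded_bilinear_cross3]
  note k = has_derivative_inner[OF has_derivative_add[OF has_derivative_snd[OF C] cross[OF A has_derivative_snd[OF id]]] \<sigma>']
  note * = has_derivative_add[OF has_derivative_add[OF D cross[OF A \<sigma>']] has_derivative_scaleR[OF k has_derivative_snd[OF id]]]
  show thesis
    by (rule that[OF *[folded covd3_def], where \<kappa>="\<lambda>w. (snd (C (x, n)) + cross3 (conn x (fst (C (x, n)))) n) \<bullet>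
        frechet_derivative \<sigma> (at (x, n)) w + (snd (C' w) + (cross3 (conn x (fst (C (x, n)))) (snd w) +
          cross3 (dconn x (fst w) (fst (C (x, n))) + conn x (fst (C' w))) n)) \<bullet> \<sigma> (x, n)"]) simp
qed

text \<open>Modulo \<open>n\<close> the three terms of the curvature are known explicitly; the second derivatives of the
  section and the derivatives of the fields cancel, and the rest has the form required by
  \<open>curvature_algebra\<close>.\<close>

lemma vertical_curvature_hyp:
  fixes X Y :: "(real^4) \<times> (real^4^4) \<Rightarrow> (real^4) \<times> (real^4^4)"
  assumes x: "x \<in> H4" and n: "norm n = 1" and N: "open N" "tw_param (x, n) \<in> N" "N \<subseteq> H4 \<times> UNIV"
    and smooth: "smooth_on N X" "smooth_on N Y" "smooth_on N s"
    and tangent: "\<And>z. z \<in> N \<inter> twistor_space H4 hyp_metric \<Longrightarrow>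
      X z \<in> tangent_space (twistor_space H4 hyp_metric) z \<and>
      Y z \<in> tangent_space (twistor_space H4 hyp_metric) z \<and> s z \<in> vertical_space hyp_metric z"
    and u: "X (tw_param (x, n)) = dtw_param (x, n) u\<^sub>1" "Y (tw_param (x, n)) = dtw_param (x, n) u\<^sub>2"
      "n \<bullet> snd u\<^sub>1 = 0" "n \<bullet> snd u\<^sub>2 = 0"
  shows "vertical_curvature hyp_metric X Y s (tw_param (x, n)) =
    twistor_density x n u\<^sub>1 u\<^sub>2 *\<^sub>R (- fibre_rotation hyp_metric (tw_param (x, n)) (s (tw_param (x, n))))"
proof -
  let ?z = "tw_param (x, n)" and ?p = "(x, n)"
  define W where "W = {p. fst p \<in> H4 \<and> tw_param p \<in> N}"
  have W: "open W" "?p \<in> W"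
    using open_tw_domain[OF N(1)] x N(2) by (auto simp: W_def)
  have W': "fst p \<in> H4" "tw_param p \<in> N" if "p \<in> W" for p
    using that by (auto simp: W_def)
  have param: "smooth_on W tw_param"
    by (rule smooth_on_subset[OF open_H4_UNIV _ smooth_on_tw_param]) (auto simp: W_def)
  have comp: "smooth_on W (\<lambda>p. F (tw_param p))" if "smooth_on N F" for F :: "_ \<Rightarrow> 'c::euclidean_space"
    by (rule smooth_on_compose[OF W(1) N(1) _ param that]) (auto simp: W_def)
  define \<sigma> where "\<sigma> p = inverse (fscale (fst p)) *\<^sub>R im_part (s (tw_param p))" for p
  define CX where "CX p = tw_coord p (X (tw_param p))" for p
  define CY where "CY p = tw_coord p (Y (tw_param p))" for p
  have \<sigma>: "smooth_on W \<sigma>"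
    unfolding \<sigma>_def[abs_def] by (intro smooth_intros W(1) comp smooth) (use W' fscale_pos in auto)
  have C: "smooth_on W CX" "smooth_on W CY"
    unfolding CX_def[abs_def] CY_def[abs_def] by (intro smooth_on_tw_coord W(1) W'(1) comp smooth; assumption)+
  have on_Z: "tw_param p \<in> N \<inter> twistor_space H4 hyp_metric" if "p \<in> W" "norm (snd p) = 1" for p
    using that unfolding W_def twistor_space_hyp by (cases p) auto
  have sec: "s (tw_param p) = fscale (fst p) *\<^sub>R left_mult (\<sigma> p) \<and> snd p \<bullet> \<sigma> p = 0"
    if p: "p \<in> W" "norm (snd p) = 1" for p
  proof -
    have "s (tw_param p) \<in> vertical_space hyp_metric (tw_param (fst p, snd p))"
      using tangent[OF on_Z[OF p]] by simp
    then obtain m where m: "s (tw_param p) = fscale (fst p) *\<^sub>R left_mult m" "snd p \<bullet> m = 0"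
      unfolding vertical_space_hyp[OF W'(1)[OF p(1)]] by blast
    then have "\<sigma> p = m"
      using fscale_pos[OF W'(1)[OF p(1)]] by (simp add: \<sigma>_def left_mult_scaleR[symmetric])
    with m show ?thesis by simp
  qed
  have field: "F (tw_param p) = dtw_param p (tw_coord p (F (tw_param p))) \<and> snd p \<bullet> snd (tw_coord p (F (tw_param p))) = 0"
    if F: "F (tw_param p) \<in> tangent_space (twistor_space H4 hyp_metric) (tw_param p)" and p: "p \<in> W" "norm (snd p) = 1"
    for F p
  proof -
    have "F (tw_param p) \<in> tangent_space (twistor_space H4 hyp_metric) (tw_param (fst p, snd p))"
      using F by simp
    then obtain v \<nu> where "F (tw_param p) = dtw_param p (v, \<nu>)" "snd p \<bullet> \<nu> = 0"
      unfolding tangent_space_twistor[OF W'(1)[OF p(1)] p(2)] by auto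
    then show ?thesis using W'(1)[OF p(1)] by simp
  qed
  have fX: "X (tw_param p) = dtw_param p (CX p) \<and> snd p \<bullet> snd (CX p) = 0"
    and fY: "Y (tw_param p) = dtw_param p (CY p) \<and> snd p \<bullet> snd (CY p) = 0"
    if "p \<in> W" "norm (snd p) = 1" for p
    using tangent[OF on_Z[OF that]] field[OF _ that] by (simp_all add: CX_def CY_def)
  have Cp: "CX ?p = u\<^sub>1" "CY ?p = u\<^sub>2"
    using u x by (simp_all add: CX_def CY_def)
  define S where "S = \<sigma> ?p"
  define D where "D = frechet_derivative \<sigma> (at ?p)"
  have D: "(\<sigma> has_derivative D) (at ?p)"
    unfolding D_def by (rule smooth_on_has_derivative[OF W(1) \<sigma> W(2)])
  have D_lin: "linear D" using D has_derivative_linear by blast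
  define X' where "X' = frechet_derivative CX (at ?p)"
  define Y' where "Y' = frechet_derivative CY (at ?p)"
  have X': "(CX has_derivative X') (at ?p)" and Y': "(CY has_derivative Y') (at ?p)"
    unfolding X'_def Y'_def by (intro smooth_on_has_derivative[OF W(1) _ W(2)] C)+
  \<comment> \<open>A covariant derivative is again a section of \<open>V\<close>, so \<open>vertical_covd_coords\<close> applies twice.\<close>
  have first: "vertical_covd hyp_metric s (tw_param p) (F (tw_param p)) = fscale (fst p) *\<^sub>R left_mult
        (covd3 (fst p) (snd p) (\<sigma> p) (frechet_derivative \<sigma> (at p) (CF p)) (CF p)) \<and>
      snd p \<bullet> covd3 (fst p) (snd p) (\<sigma> p) (frechet_derivative \<sigma> (at p) (CF p)) (CF p) = 0"
    if p: "p \<in> W" "norm (snd p) = 1" and F: "F (tw_param p) = dtw_param p (CF p) \<and> snd p \<bullet> snd (CF p) = 0"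
    for p F CF
  proof -
    have N': "tw_param (fst p, snd p) \<in> N" using W'(2)[OF p(1)] by simp
    have sec': "s (tw_param (y, m)) = fscale y *\<^sub>R left_mult (\<sigma> (y, m)) \<and> m \<bullet> \<sigma> (y, m) = 0"
      if "y \<in> H4" "norm m = 1" "tw_param (y, m) \<in> N" for y m
      using sec[of "(y, m)"] that by (simp add: W_def)
    have d1: "(\<sigma> has_derivative frechet_derivative \<sigma> (at p)) (at (fst p, snd p))"
      using smooth_on_has_derivative[OF W(1) \<sigma> p(1)] by simp
    note d2 = smooth_on_has_derivative[OF N(1) smooth(3) N']
    show ?thesis
      using vertical_covd_coords[OF N(1) N' W'(1)[OF p(1)] p(2) sec' d1 d2, of "snd (CF p)" "fst (CF p)"] F by simp
  qed
  have second: "\<exists>T \<kappa>. vertical_covd hyp_metric (\<lambda>z'. vertical_covd hyp_metric s z' (F z')) ?z (dtw_param ?p w) = fscale x *\<^sub>R left_mult T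
      \<and> n \<bullet> T = 0 \<and> T = frechet_derivative (\<lambda>q. frechet_derivative \<sigma> (at q) (CF ?p)) (at ?p) w + D (CF' w)
       + (cross3 (conn x (fst (CF ?p))) (D w) + cross3 (dconn x (fst w) (fst (CF ?p)) + conn x (fst (CF' w))) S)
       + ((snd (CF ?p) + cross3 (conn x (fst (CF ?p))) n) \<bullet> S) *\<^sub>R snd w
       + cross3 (conn x (fst w)) (D (CF ?p) + cross3 (conn x (fst (CF ?p))) S
           + ((snd (CF ?p) + cross3 (conn x (fst (CF ?p))) n) \<bullet> S) *\<^sub>R n) + \<kappa> *\<^sub>R n"
    if F: "smooth_on N F" and CF: "(CF has_derivative CF') (at ?p)"
      and fF: "\<And>p. p \<in> W \<Longrightarrow> norm (snd p) = 1 \<Longrightarrow> F (tw_param p) = dtw_param p (CF p) \<and> snd p \<bullet> snd (CF p) = 0"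
      and w: "n \<bullet> snd w = 0"
    for F CF CF' w
  proof -
    let ?t = "\<lambda>z'. vertical_covd hyp_metric s z' (F z')"
    define \<tau> where "\<tau> p = covd3 (fst p) (snd p) (\<sigma> p) (frechet_derivative \<sigma> (at p) (CF p)) (CF p)" for p
    have sec': "?t (tw_param (y, m)) = fscale y *\<^sub>R left_mult (\<tau> (y, m)) \<and> m \<bullet> \<tau> (y, m) = 0"
      if "y \<in> H4" "norm m = 1" "tw_param (y, m) \<in> N" for y m
      using first[of "(y, m)" F CF] fF[of "(y, m)"] that by (simp add: W_def \<tau>_def)
    obtain \<tau>' \<kappa> where \<tau>: "(\<tau> has_derivative \<tau>') (at ?p)" and \<tau>'_eq:
      "\<And>w. \<tau>' w = frechet_derivative (\<lambda>q. frechet_derivative \<sigma> (at q) (CF ?p)) (at ?p) w + D (CF' w)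
       + (cross3 (conn x (fst (CF ?p))) (D w) + cross3 (dconn x (fst w) (fst (CF ?p)) + conn x (fst (CF' w))) S)
       + (((snd (CF ?p) + cross3 (conn x (fst (CF ?p))) n) \<bullet> S) *\<^sub>R snd w + \<kappa> w *\<^sub>R n)"
      using second_covd[OF W x \<sigma> CF] unfolding \<tau>_def[abs_def, symmetric] D_def[symmetric] S_def[symmetric] by blast
    note d2 = smooth_on_has_derivative[OF N(1) smooth_on_vertical_covd[OF N(1,3) smooth(3) F] N(2)]
    have covd: "vertical_covd hyp_metric ?t ?z (dtw_param ?p w) = fscale x *\<^sub>R left_mult (covd3 x n (\<tau> ?p) (\<tau>' w) w)"
      "n \<bullet> covd3 x n (\<tau> ?p) (\<tau>' w) w = 0"
      by (rule vertical_covd_coords[OF N(1,2) x n sec' \<tau> d2, of "snd w" "fst w", unfolded prod.collapse];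
          (assumption | rule w))+
    have "covd3 x n (\<tau> ?p) (\<tau>' w) w = \<tau>' w + cross3 (conn x (fst w)) (D (CF ?p) + cross3 (conn x (fst (CF ?p))) S
           + ((snd (CF ?p) + cross3 (conn x (fst (CF ?p))) n) \<bullet> S) *\<^sub>R n)
         + ((snd w + cross3 (conn x (fst w)) n) \<bullet> \<tau> ?p) *\<^sub>R n"
      by (simp add: covd3_def \<tau>_def S_def D_def)
    with covd show ?thesis
      unfolding \<tau>'_eq
      by (intro exI[of _ "covd3 x n (\<tau> ?p) (\<tau>' w) w"] exI[of _ "\<kappa> w + (snd w + cross3 (conn x (fst w)) n) \<bullet> \<tau> ?p"])
        (simp add: \<tau>'_eq scaleR_add_left algebra_simps)
  qed
  obtain T\<^sub>1 \<kappa>\<^sub>1 where T\<^sub>1: "vertical_covd hyp_metric (\<lambda>z'. vertical_covd hyp_metric s z' (Y z')) ?z (X ?z) = fscale x *\<^sub>R left_mult T\<^sub>1"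
      "n \<bullet> T\<^sub>1 = 0"
    and T\<^sub>1_eq: "T\<^sub>1 = frechet_derivative (\<lambda>q. frechet_derivative \<sigma> (at q) u\<^sub>2) (at ?p) u\<^sub>1 + D (Y' u\<^sub>1)
       + (cross3 (conn x (fst u\<^sub>2)) (D u\<^sub>1) + cross3 (dconn x (fst u\<^sub>1) (fst u\<^sub>2) + conn x (fst (Y' u\<^sub>1))) S)
       + ((snd u\<^sub>2 + cross3 (conn x (fst u\<^sub>2)) n) \<bullet> S) *\<^sub>R snd u\<^sub>1
       + cross3 (conn x (fst u\<^sub>1)) (D u\<^sub>2 + cross3 (conn x (fst u\<^sub>2)) S
           + ((snd u\<^sub>2 + cross3 (conn x (fst u\<^sub>2)) n) \<bullet> S) *\<^sub>R n) + \<kappa>\<^sub>1 *\<^sub>R n"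
    using second[OF smooth(2) Y' fY u(3)] unfolding Cp u(1)[symmetric] by blast
  obtain T\<^sub>2 \<kappa>\<^sub>2 where T\<^sub>2: "vertical_covd hyp_metric (\<lambda>z'. vertical_covd hyp_metric s z' (X z')) ?z (Y ?z) = fscale x *\<^sub>R left_mult T\<^sub>2"
      "n \<bullet> T\<^sub>2 = 0"
    and T\<^sub>2_eq: "T\<^sub>2 = frechet_derivative (\<lambda>q. frechet_derivative \<sigma> (at q) u\<^sub>1) (at ?p) u\<^sub>2 + D (X' u\<^sub>2)
       + (cross3 (conn x (fst u\<^sub>1)) (D u\<^sub>2) + cross3 (dconn x (fst u\<^sub>2) (fst u\<^sub>1) + conn x (fst (X' u\<^sub>2))) S)
       + ((snd u\<^sub>1 + cross3 (conn x (fst u\<^sub>1)) n) \<bullet> S) *\<^sub>R snd u\<^sub>2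
       + cross3 (conn x (fst u\<^sub>2)) (D u\<^sub>1 + cross3 (conn x (fst u\<^sub>1)) S
           + ((snd u\<^sub>1 + cross3 (conn x (fst u\<^sub>1)) n) \<bullet> S) *\<^sub>R n) + \<kappa>\<^sub>2 *\<^sub>R n"
    using second[OF smooth(1) X' fX u(4)] unfolding Cp u(2)[symmetric] by blast
  define b where "b = Y' u\<^sub>1 - X' u\<^sub>2"
  note dX = smooth_on_has_derivative[OF N(1) smooth(1) N(2)] and dY = smooth_on_has_derivative[OF N(1) smooth(2) N(2)]
  have fX': "X (tw_param p) = dtw_param p (CX p) \<and> snd p \<bullet> snd (CX p) = 0"
    and fY': "Y (tw_param p) = dtw_param p (CY p) \<and> snd p \<bullet> snd (CY p) = 0"
    if "fst p \<in> H4" "norm (snd p) = 1" "tw_param p \<in> N" for p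
    using fX[of p] fY[of p] that by (simp_all add: W_def)
  have b: "lie_bracket X Y ?z = dtw_param ?p b" "n \<bullet> snd b = 0"
  proof -
    have fdY: "frechet_derivative Y (at ?z) (dtw_param ?p u\<^sub>1) = (0, ddfscale x (fst u\<^sub>1) (fst u\<^sub>2) *\<^sub>R left_mult n
        + dfscale x (fst u\<^sub>2) *\<^sub>R left_mult (snd u\<^sub>1) + dfscale x (fst u\<^sub>1) *\<^sub>R left_mult (snd u\<^sub>2)) + dtw_param ?p (Y' u\<^sub>1)"
      "n \<bullet> snd (Y' u\<^sub>1) = - (snd u\<^sub>1 \<bullet> snd u\<^sub>2)"
      by (rule field_derivative[where X=Y and C=CY and \<nu>="snd u\<^sub>1" and v="fst u\<^sub>1", OF N(1,2) x n u(3) fY' Y' dY,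
            unfolded prod.collapse Cp]; assumption)+
    have fdX: "frechet_derivative X (at ?z) (dtw_param ?p u\<^sub>2) = (0, ddfscale x (fst u\<^sub>2) (fst u\<^sub>1) *\<^sub>R left_mult n
        + dfscale x (fst u\<^sub>1) *\<^sub>R left_mult (snd u\<^sub>2) + dfscale x (fst u\<^sub>2) *\<^sub>R left_mult (snd u\<^sub>1)) + dtw_param ?p (X' u\<^sub>2)"
      "n \<bullet> snd (X' u\<^sub>2) = - (snd u\<^sub>2 \<bullet> snd u\<^sub>1)"
      by (rule field_derivative[where X=X and C=CX and \<nu>="snd u\<^sub>2" and v="fst u\<^sub>2", OF N(1,2) x n u(4) fX' X' dX,
            unfolded prod.collapse Cp]; assumption)+
    show "lie_bracket X Y ?z = dtw_param ?p b"
      unfolding lie_bracket_def u(1,2) fdY(1) fdX(1) b_def dtw_param_linear ddfscale_commute[of x "fst u\<^sub>1"] by (simp add: zero_prod_def)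
    show "n \<bullet> snd b = 0"
      unfolding b_def using fdY(2) fdX(2) by (simp add: inner_diff_right inner_commute)
  qed
  define T\<^sub>3 where "T\<^sub>3 = covd3 x n S (D b) b"
  have sec': "s (tw_param (y, m)) = fscale y *\<^sub>R left_mult (\<sigma> (y, m)) \<and> m \<bullet> \<sigma> (y, m) = 0"
    if "y \<in> H4" "norm m = 1" "tw_param (y, m) \<in> N" for y m
    using sec[of "(y, m)"] that by (simp add: W_def)
  note ds = smooth_on_has_derivative[OF N(1) smooth(3) N(2)]
  have T\<^sub>3: "vertical_covd hyp_metric s ?z (lie_bracket X Y ?z) = fscale x *\<^sub>R left_mult T\<^sub>3" "n \<bullet> T\<^sub>3 = 0"
    unfolding T\<^sub>3_def S_def b(1)
    by (rule vertical_covd_coords[OF N(1,2) x n sec' D ds, of "snd b" "fst b", unfolded prod.collapse];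
        (assumption | rule b))+
  have curv: "vertical_curvature hyp_metric X Y s ?z = fscale x *\<^sub>R left_mult (T\<^sub>1 - T\<^sub>2 - T\<^sub>3)"
    unfolding vertical_curvature_def T\<^sub>1(1) T\<^sub>2(1) T\<^sub>3(1) by (simp add: left_mult_diff scaleR_diff_right)
  have nn: "n \<bullet> n = 1" using n by (simp add: norm_eq_1)
  have S: "n \<bullet> S = 0" using sec[OF W(2)] n by (simp add: S_def)
  have sz: "s ?z = fscale x *\<^sub>R left_mult S" using sec[OF W(2)] n by (simp add: S_def)
  have sym: "frechet_derivative (\<lambda>q. frechet_derivative \<sigma> (at q) u\<^sub>2) (at ?p) u\<^sub>1
      = frechet_derivative (\<lambda>q. frechet_derivative \<sigma> (at q) u\<^sub>1) (at ?p) u\<^sub>2"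
    by (rule second_derivative_symmetric[OF W(1) \<sigma> W(2)])
  have conn_diff: "conn x (v - w) = conn x v - conn x w" for v w
    by (simp add: conn_def bounded_bilinear.diff_left[OF bounded_bilinear_quat_im] scaleR_diff_right)
  have "T\<^sub>1 - T\<^sub>2 - T\<^sub>3 = (n \<bullet> cross3 (snd u\<^sub>1 + cross3 (conn x (fst u\<^sub>1)) n) (snd u\<^sub>2 + cross3 (conn x (fst u\<^sub>2)) n)
      - n \<bullet> ((dconn x (fst u\<^sub>1) (fst u\<^sub>2) - dconn x (fst u\<^sub>2) (fst u\<^sub>1)) + cross3 (conn x (fst u\<^sub>1)) (conn x (fst u\<^sub>2)))) *\<^sub>R (- cross3 n S)"
  proof (rule curvature_algebra[OF nn S])
    show "n \<bullet> (T\<^sub>1 - T\<^sub>2 - T\<^sub>3) = 0" using T\<^sub>1(2) T\<^sub>2(2) T\<^sub>3(2) by (simp add: inner_diff_right)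
    show "T\<^sub>1 - T\<^sub>2 - T\<^sub>3 = cross3 (dconn x (fst u\<^sub>1) (fst u\<^sub>2) - dconn x (fst u\<^sub>2) (fst u\<^sub>1)) S
       + (cross3 (conn x (fst u\<^sub>1)) (cross3 (conn x (fst u\<^sub>2)) S) - cross3 (conn x (fst u\<^sub>2)) (cross3 (conn x (fst u\<^sub>1)) S))
       + (((snd u\<^sub>2 + cross3 (conn x (fst u\<^sub>2)) n) \<bullet> S) *\<^sub>R (snd u\<^sub>1 + cross3 (conn x (fst u\<^sub>1)) n)
          - ((snd u\<^sub>1 + cross3 (conn x (fst u\<^sub>1)) n) \<bullet> S) *\<^sub>R (snd u\<^sub>2 + cross3 (conn x (fst u\<^sub>2)) n))
       + (\<kappa>\<^sub>1 - \<kappa>\<^sub>2 - (snd b + cross3 (conn x (fst b)) n) \<bullet> S) *\<^sub>R n"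
      unfolding T\<^sub>1_eq T\<^sub>2_eq T\<^sub>3_def covd3_def sym
      by (simp add: b_def linear_diff[OF D_lin] conn_diff cross_add_left cross_add_right cross_mult_right
          Cross3.left_diff_distrib scaleR_diff_left scaleR_add_right)
  qed
  then have "T\<^sub>1 - T\<^sub>2 - T\<^sub>3 = twistor_density x n u\<^sub>1 u\<^sub>2 *\<^sub>R (- cross3 n S)"
    unfolding twistor_density_eq[OF nn u(3,4)] prod.collapse .
  then show ?thesis
    unfolding curv sz fibre_rotation_hyp[OF x S] by (simp add: left_mult_scaleR left_mult_minus)
qed

lemma smooth_on_dtw_param:
  assumes "open S" "smooth_on S p" "\<And>z. z \<in> S \<Longrightarrow> fst (p z) \<in> H4" "smooth_on S w"
  shows "smooth_on S (\<lambda>z. dtw_param (p z) (w z))"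
  unfolding dtw_param_def by (intro smooth_intros assms) (use assms(3) in auto)

text \<open>The curvature identity determines the value of the form because \<open>u\<^sub>1\<close> and \<open>u\<^sub>2\<close> extend to fields
  and some section does not vanish at the point. Both are obtained by projecting constant
  coordinate vectors orthogonally to \<open>n\<close>.\<close>

lemma twistor_form_hyp:
  assumes x: "x \<in> H4" and n: "norm n = 1" and u: "n \<bullet> snd u\<^sub>1 = 0" "n \<bullet> snd u\<^sub>2 = 0"
  shows "twistor_form H4 hyp_metric (tw_param (x, n)) (dtw_param (x, n) u\<^sub>1) (dtw_param (x, n) u\<^sub>2) =
    twistor_density x n u\<^sub>1 u\<^sub>2 / (2 * pi)"
proof -
  let ?Z = "twistor_space H4 hyp_metric" and ?z = "tw_param (x, n)"
  have z: "?z \<in> H4 \<times> UNIV" using x by (simp add: tw_param_def)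
  have dirz: "tw_dir ?z = n" using x by (simp add: tw_param_def)
  define F where "F w z = dtw_param (fst z, tw_dir z) (fst w, snd w - (tw_dir z \<bullet> snd w) *\<^sub>R tw_dir z)" for w z
  obtain m where m: "m \<noteq> 0" "n \<bullet> m = 0"
    using orthogonal_to_vector_exists[of n] by (auto simp: orthogonal_def)
  define s where "s z = fscale (fst z) *\<^sub>R left_mult (m - (tw_dir z \<bullet> m) *\<^sub>R tw_dir z)" for z
  have F: "smooth_on (H4 \<times> UNIV) (F w)" for w
    unfolding F_def[abs_def] by (intro smooth_on_dtw_param smooth_intros open_H4_UNIV smooth_on_tw_dir) auto
  have s: "smooth_on (H4 \<times> UNIV) s"
    unfolding s_def[abs_def] by (intro smooth_intros open_H4_UNIV smooth_on_tw_dir) auto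
  have Fz: "F w ?z = dtw_param (x, n) w" if "n \<bullet> snd w = 0" for w
    using that by (simp add: F_def dirz) (simp add: tw_param_def)
  have sz: "s ?z = fscale x *\<^sub>R left_mult m"
    using m(2) by (simp add: s_def dirz) (simp add: tw_param_def)
  have on_Z: "F w z \<in> tangent_space ?Z z \<and> s z \<in> vertical_space hyp_metric z" if zZ: "z \<in> ?Z" for w z
  proof -
    obtain y k where z: "z = tw_param (y, k)" "y \<in> H4" "norm k = 1"
      using zZ unfolding twistor_space_hyp by auto
    have k: "tw_dir z = k" "fst z = y" using z by (simp_all add: tw_param_def)
    have perp: "k \<bullet> (a - (k \<bullet> a) *\<^sub>R k) = 0" for a
      using z(3) by (simp add: inner_diff_right norm_eq_1)
    show ?thesis
      unfolding F_def s_def k unfolding z(1) tangent_space_twistor[OF z(2,3)] vertical_space_hyp[OF z(2)]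
      using perp by blast
  qed
  have "fibre_rotation hyp_metric ?z (s ?z) \<noteq> 0"
  proof
    assume "fibre_rotation hyp_metric ?z (s ?z) = 0"
    then have "left_mult (cross3 n m) = 0"
      using fscale_pos[OF x] unfolding sz fibre_rotation_hyp[OF x m(2)] by simp
    then have "cross3 n m = 0"
      using im_part_left_mult[of "cross3 n m"] by (simp add: im_part_def vec_eq_iff forall_3)
    then show False
      using Lagrange[of n n m] m n by (simp add: norm_eq_1)
  qed
  moreover have curv: "vertical_curvature hyp_metric X Y s ?z = twistor_density x n u\<^sub>1 u\<^sub>2 *\<^sub>R (- fibre_rotation hyp_metric ?z (s ?z))"
    if "open N \<and> ?z \<in> N \<and> N \<subseteq> H4 \<times> UNIV \<and> smooth_on N X \<and> smooth_on N Y \<and> smooth_on N s \<and>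
     (\<forall>z' \<in> N \<inter> ?Z. X z' \<in> tangent_space ?Z z' \<and> Y z' \<in> tangent_space ?Z z' \<and> s z' \<in> vertical_space hyp_metric z') \<and>
     X ?z = dtw_param (x, n) u\<^sub>1 \<and> Y ?z = dtw_param (x, n) u\<^sub>2" for N X Y s
    by (rule vertical_curvature_hyp[OF x n, of N]) (use that u in auto)
  ultimately show ?thesis
    unfolding twistor_form_def
  proof (intro the_equality allI impI)
    fix c
    assume nz: "fibre_rotation hyp_metric ?z (s ?z) \<noteq> 0"
    assume c: "\<forall>N X Y s. open N \<and> ?z \<in> N \<and> N \<subseteq> H4 \<times> UNIV \<and> smooth_on N X \<and> smooth_on N Y \<and> smooth_on N s \<and>
       (\<forall>z' \<in> N \<inter> ?Z. X z' \<in> tangent_space ?Z z' \<and> Y z' \<in> tangent_space ?Z z' \<and> s z' \<in> vertical_space hyp_metric z') \<and>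
       X ?z = dtw_param (x, n) u\<^sub>1 \<and> Y ?z = dtw_param (x, n) u\<^sub>2 \<longrightarrow>
       vertical_curvature hyp_metric X Y s ?z = (2 * pi * c) *\<^sub>R (- fibre_rotation hyp_metric ?z (s ?z))"
    have local: "open (H4 \<times> (UNIV :: (real^4^4) set)) \<and> ?z \<in> H4 \<times> UNIV \<and> H4 \<times> UNIV \<subseteq> H4 \<times> (UNIV :: (real^4^4) set)
       \<and> smooth_on (H4 \<times> UNIV) (F u\<^sub>1) \<and> smooth_on (H4 \<times> UNIV) (F u\<^sub>2) \<and> smooth_on (H4 \<times> UNIV) s \<and>
       (\<forall>z' \<in> H4 \<times> UNIV \<inter> ?Z. F u\<^sub>1 z' \<in> tangent_space ?Z z' \<and> F u\<^sub>2 z' \<in> tangent_space ?Z z' \<and> s z' \<in> vertical_space hyp_metric z') \<and>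
       F u\<^sub>1 ?z = dtw_param (x, n) u\<^sub>1 \<and> F u\<^sub>2 ?z = dtw_param (x, n) u\<^sub>2"
      using open_H4_UNIV z F s on_Z Fz u by blast
    have "(2 * pi * c) *\<^sub>R (- fibre_rotation hyp_metric ?z (s ?z)) =
        twistor_density x n u\<^sub>1 u\<^sub>2 *\<^sub>R (- fibre_rotation hyp_metric ?z (s ?z))"
      using curv[OF local] c[rule_format, OF local] by simp
    then have "2 * pi * c = twistor_density x n u\<^sub>1 u\<^sub>2"
      using nz by simp
    then show "c = twistor_density x n u\<^sub>1 u\<^sub>2 / (2 * pi)"
      by (simp add: field_simps)
  qed simp
qed

section \<open>The resolution in coordinates\<close>

text \<open>The Bloch sphere: \<open>(1 + n \<cdot> s) / 2\<close> for the Pauli matrices \<open>s\<close>.\<close>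

definition proj :: "real^3 \<Rightarrow> complex^2^2" where
  "proj n = vector [vector [Complex ((1 + n$3) / 2) 0, Complex (n$1 / 2) (- n$2 / 2)],
     vector [Complex (n$1 / 2) (n$2 / 2), Complex ((1 - n$3) / 2) 0]]"

definition dproj :: "real^3 \<Rightarrow> complex^2^2" where
  "dproj n = vector [vector [Complex (n$3 / 2) 0, Complex (n$1 / 2) (- n$2 / 2)],
     vector [Complex (n$1 / 2) (n$2 / 2), Complex (- n$3 / 2) 0]]"

text \<open>The columns of the matrix \<open>X\<close> of the quaternion \<open>x\<close>, with \<open>i, j, k\<close> represented by
  \<open>- \<i>\<close> times the Pauli matrices.\<close>

definition col1 :: "real^4 \<Rightarrow> complex^2" where
  "col1 x = vector [Complex (x$1) (- x$4), Complex (x$3) (- x$2)]"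

definition col2 :: "real^4 \<Rightarrow> complex^2" where
  "col2 x = vector [Complex (- x$3) (- x$2), Complex (x$1) (x$4)]"

definition bloch :: "complex^2^2 \<Rightarrow> real^3" where
  "bloch P = vector [2 * Re (P$2$1), 2 * Im (P$2$1), Re (P$1$1) - Re (P$2$2)]"

text \<open>The quaternion with the matrix \<open>M + J M\<close>, where \<open>m\<close> consists of the columns of \<open>M\<close> and \<open>J\<close>
  is the real structure on two-by-two matrices that fixes the quaternions.\<close>

definition quat_of :: "(complex^2) \<times> (complex^2) \<Rightarrow> real^4" where
  "quat_of m = vector [Re (fst m $ 1) + Re (snd m $ 2), - Im (fst m $ 2) - Im (snd m $ 1),
     Re (fst m $ 2) - Re (snd m $ 1), - Im (fst m $ 1) + Im (snd m $ 2)]"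

lemma proj_dproj: "proj n = proj 0 + dproj n"
  by (simp add: proj_def dproj_def vec_eq_iff forall_2 complex_eq_iff add_divide_distrib diff_divide_distrib)

lemma bounded_linear_dproj: "bounded_linear dproj"
  by (simp add: linear_conv_bounded_linear[symmetric] linear_iff dproj_def vec_eq_iff forall_2 complex_eq_iff
      add_divide_distrib)

lemma bounded_linear_col1: "bounded_linear col1"
  by (simp add: linear_conv_bounded_linear[symmetric] linear_iff col1_def vec_eq_iff forall_2 complex_eq_iff)

lemma bounded_linear_col2: "bounded_linear col2"
  by (simp add: linear_conv_bounded_linear[symmetric] linear_iff col2_def vec_eq_iff forall_2 complex_eq_iff)

lemma bounded_linear_quat_of: "bounded_linear quat_of"
  by (simp add: linear_conv_bounded_linear[symmetric] linear_iff quat_of_def vec_eq_iff forall_4 algebra_simps)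

lemma bounded_linear_bloch: "bounded_linear bloch"
  by (simp add: linear_conv_bounded_linear[symmetric] linear_iff bloch_def vec_eq_iff forall_3 algebra_simps)

lemma bounded_bilinear_mult_vec: "bounded_bilinear ((*v) :: complex^2^2 \<Rightarrow> complex^2 \<Rightarrow> complex^2)"
  by (simp add: bilinear_conv_bounded_bilinear[symmetric] bilinear_def linear_iff matrix_vector_mult_def
      vec_eq_iff forall_2 sum_2 algebra_simps)

lemma bloch_proj [simp]: "bloch (proj n) = n"
  by (simp add: bloch_def proj_def vec_eq_iff forall_3 diff_divide_distrib[symmetric])

lemma unit_sphere_3:
  fixes n :: "real^3" assumes "norm n = 1"
  shows "n$3 * n$3 = 1 - n$1 * n$1 - n$2 * n$2"
  using assms by (simp add: norm_eq_1 inner_vec_def sum_3)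

lemma proj_idem:
  assumes "norm n = 1" shows "proj n ** proj n = proj n"
  using unit_sphere_3[OF assms]
  by (simp add: proj_def matrix_matrix_mult_def vec_eq_iff forall_2 sum_2 complex_eq_iff field_simps)

lemma CP1_eq: "CP1 = proj ` sphere 0 1"
proof (intro equalityI subsetI)
  fix P assume "P \<in> CP1"
  then have h: "map_matrix cnj (transpose P) = P" and i: "P ** P = P" and t: "trace P = 1"
    by (auto simp: CP1_def)
  have im: "Im (P$1$1) = 0" "Im (P$2$2) = 0" "P$1$2 = cnj (P$2$1)"
    using arg_cong[OF h, of "\<lambda>A. A$1$1"] arg_cong[OF h, of "\<lambda>A. A$2$2"] arg_cong[OF h, of "\<lambda>A. A$1$2"]
    by (simp_all add: map_matrix_def transpose_def complex_eq_iff)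
  have tr: "Re (P$1$1) + Re (P$2$2) = 1"
    using arg_cong[OF t, of Re] by (simp add: trace_def sum_2)
  have "Re (P$1$1) * Re (P$1$1) + Re (P$2$1) * Re (P$2$1) + Im (P$2$1) * Im (P$2$1) = Re (P$1$1)"
    using arg_cong[OF i, of "\<lambda>A. Re (A$1$1)"] im by (simp add: matrix_matrix_mult_def sum_2)
  moreover have tr': "Re (P$2$2) = 1 - Re (P$1$1)" using tr by simp
  ultimately have "bloch P \<bullet> bloch P = 1"
    unfolding bloch_def inner_vec_def sum_3 tr' by (simp add: algebra_simps)
  moreover have "proj (bloch P) = P"
    using im tr by (simp add: proj_def bloch_def vec_eq_iff forall_2 complex_eq_iff field_simps)
  ultimately show "P \<in> proj ` sphere 0 1"
    by (metis image_eqI mem_sphere_0 norm_eq_1)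
next
  fix P assume "P \<in> proj ` sphere 0 1"
  then obtain n where n: "P = proj n" "norm n = 1" by auto
  have "map_matrix cnj (transpose P) = P" "trace P = 1"
    by (simp_all add: n(1) proj_def map_matrix_def transpose_def vec_eq_iff forall_2 complex_eq_iff trace_def sum_2
        add_divide_distrib[symmetric])
  then show "P \<in> CP1" using proj_idem[OF n(2)] by (simp add: CP1_def n(1))
qed

lemma range_proj:
  assumes "norm n = 1" shows "a \<in> range ((*v) (proj n)) \<longleftrightarrow> proj n *v a = a"
proof
  assume "a \<in> range ((*v) (proj n))"
  then obtain b where "a = proj n *v b" by blast
  then show "proj n *v a = a" by (simp add: matrix_vector_mul_assoc proj_idem[OF assms])
qed (metis rangeI)

lemma resolution_eq: "resolution = {(proj n, (a, b)) |n a b. norm n = 1 \<and> proj n *v a = a \<and> proj n *v b = b}"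
proof -
  have "P \<in> proj ` sphere 0 1 \<and> a \<in> range ((*v) P) \<and> b \<in> range ((*v) P) \<longleftrightarrow>
      (\<exists>n. norm n = 1 \<and> P = proj n \<and> proj n *v a = a \<and> proj n *v b = b)" for P a b
    unfolding image_iff[where f=proj] Bex_def mem_sphere_0 using range_proj by metis
  then show ?thesis unfolding resolution_def CP1_eq by auto
qed

text \<open>The matrix \<open>P(n) X\<close>, given by its columns. It contains half of the information in the complex
  matrix \<open>X\<close>, but determines the quaternion.\<close>

definition half :: "real^3 \<Rightarrow> real^4 \<Rightarrow> (complex^2) \<times> (complex^2)" where
  "half n x = (proj n *v col1 x, proj n *v col2 x)"

definition dhalf :: "real^3 \<Rightarrow> real^4 \<Rightarrow> (complex^2) \<times> (complex^2)" where
  "dhalf n x = (dproj n *v col1 x, dproj n *v col2 x)"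

lemmas half_simps = half_def dhalf_def proj_def dproj_def col1_def col2_def quat_of_def matrix_vector_mult_def
  vec_eq_iff forall_2 forall_4 sum_2 complex_eq_iff

text \<open>The real structure exchanges \<open>P(n) X\<close> with \<open>(1 - P(n)) X\<close>, and the two add up to \<open>X\<close>.\<close>

lemma quat_of_half: "quat_of (half n x) = x"
  by (simp add: half_simps field_simps)

lemma proj_inner:
  assumes "norm n = 1"
  shows "(\<Sum>k\<in>UNIV. cnj ((proj n *v a) $ k) * (proj n *v b) $ k) = (\<Sum>k\<in>UNIV. cnj (a $ k) * (proj n *v b) $ k)"
proof -
  have "(\<Sum>k\<in>UNIV. cnj ((proj n *v a) $ k) * c $ k) = (\<Sum>k\<in>UNIV. cnj (a $ k) * (proj n *v c) $ k)" for c
    by (simp add: proj_def matrix_vector_mult_def sum_2 complex_eq_iff algebra_simps)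
  then show ?thesis
    by (simp add: matrix_vector_mul_assoc proj_idem[OF assms])
qed

lemma norm_half:
  assumes "norm n = 1" shows "(norm (half n x))\<^sup>2 = (norm x)\<^sup>2"
proof -
  have sq: "(norm a)\<^sup>2 = Re (\<Sum>k\<in>UNIV. cnj (a $ k) * a $ k)" for a :: "complex^2"
    by (simp add: power2_norm_eq_inner inner_vec_def sum_2 inner_complex_def)
  have "(norm (half n x))\<^sup>2 = (norm (proj n *v col1 x))\<^sup>2 + (norm (proj n *v col2 x))\<^sup>2"
    by (simp add: half_def norm_prod_def)
  also have "\<dots> = (norm x)\<^sup>2"
    unfolding sq proj_inner[OF assms]
    by (simp add: power2_norm_eq_inner inner_vec_def sum_2 sum_4 half_simps field_simps)
  finally show ?thesis .
qed

text \<open>The vector \<open>(cnj b\<^sub>2, - cnj b\<^sub>1)\<close> is orthogonal to \<open>b\<close>, and so to the line.\<close>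

lemma proj_conjugate:
  assumes "proj n *v b = b"
  shows "proj n *v vector [cnj (b$2), - cnj (b$1)] = 0"
proof -
  have e: "Re ((proj n *v b) $ i) = Re (b $ i)" "Im ((proj n *v b) $ i) = Im (b $ i)" for i
    using assms by simp_all
  note e1 = e[of 1, unfolded proj_def matrix_vector_mult_def, simplified sum_2, simplified]
  note e2 = e[of 2, unfolded proj_def matrix_vector_mult_def, simplified sum_2, simplified]
  show ?thesis
    using e1 e2 by (simp add: proj_def matrix_vector_mult_def vec_eq_iff forall_2 sum_2 complex_eq_iff field_simps)
qed

lemma half_quat_of:
  assumes "proj n *v a = a" "proj n *v b = b"
  shows "half n (quat_of (a, b)) = (a, b)"
proof -
  have "col1 (quat_of (a, b)) = a + vector [cnj (b$2), - cnj (b$1)]"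
    "col2 (quat_of (a, b)) = b - vector [cnj (a$2), - cnj (a$1)]"
    by (simp_all add: col1_def col2_def quat_of_def vec_eq_iff forall_2 complex_eq_iff)
  then show ?thesis
    by (simp add: half_def assms matrix_vector_right_distrib matrix_vector_mult_diff_distrib proj_conjugate)
qed

text \<open>The left hand side is \<open>Im (tr (P Y X\<^sup>*))\<close> for the matrices \<open>X, Y\<close> of the quaternions. The real
  part of \<open>y x\<^sup>*\<close> does not contribute, and \<open>P\<close> picks out the component of the imaginary part
  along \<open>n\<close>. The next three lemmas are of the same kind.\<close>

lemma omega_half_half:
  assumes "norm n = 1"
  shows "omega_C4 r (half n x) (half n y) = n \<bullet> quat_im x y"
  unfolding omega_C4_def half_def fst_conv snd_conv Im_sum[symmetric] proj_inner[OF assms]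
  by (simp add: proj_def col1_def col2_def matrix_vector_mult_def sum_2 quat_im_def inner_vec_def sum_3 field_simps)

lemma omega_dhalf_half: "omega_C4 r (dhalf \<nu> x) (half n y) = (\<nu> \<bullet> quat_im x y) / 2"
  by (simp add: omega_C4_def half_def dhalf_def proj_def dproj_def col1_def col2_def matrix_vector_mult_def sum_2
      quat_im_def inner_vec_def sum_3 field_simps)

lemma omega_dhalf_dhalf: "omega_C4 r (dhalf \<nu> x) (dhalf \<mu> x) = 0"
  by (simp add: omega_C4_def half_def dhalf_def proj_def dproj_def col1_def col2_def matrix_vector_mult_def sum_2
      quat_im_def inner_vec_def sum_3 field_simps)

lemma omega_FS_proj: "omega_FS (proj n) (dproj \<nu>) (dproj \<mu>) = (n \<bullet> cross3 \<nu> \<mu>) / (2 * pi)"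
proof -
  have "Im (trace (proj n ** dproj \<nu> ** dproj \<mu>)) = (n \<bullet> cross3 \<nu> \<mu>) / 4"
    by (simp add: trace_def matrix_matrix_mult_def proj_def dproj_def sum_2 cross3_def inner_vec_def sum_3 field_simps)
  then show ?thesis by (simp add: omega_FS_def field_simps)
qed

section \<open>The symplectomorphism\<close>

text \<open>Its square is \<open>1 / \<pi>\<close> times the factor \<open>2 / (1 - \<bar>x\<bar>\<^sup>2)\<close> in \<open>conn\<close>, as the comparison of
  the primitives requires.\<close>

definition rscale :: "real^4 \<Rightarrow> real" where
  "rscale x = sqrt (2 / (pi * (1 - (norm x)\<^sup>2)))"

definition res_param :: "(real^4) \<times> (real^3) \<Rightarrow> (complex^2^2) \<times> (complex^2) \<times> (complex^2)" where
  "res_param p = (proj (snd p), rscale (fst p) *\<^sub>R half (snd p) (fst p))"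

definition dres_param :: "(real^4) \<times> (real^3) \<Rightarrow> (real^4) \<times> (real^3) \<Rightarrow> (complex^2^2) \<times> (complex^2) \<times> (complex^2)" where
  "dres_param p w = (dproj (snd w), (rscale (fst p) * (fst p \<bullet> fst w) / (1 - (norm (fst p))\<^sup>2)) *\<^sub>R half (snd p) (fst p)
     + rscale (fst p) *\<^sub>R (dhalf (snd w) (fst p) + half (snd p) (fst w)))"

definition to_resolution :: "(real^4) \<times> (real^4^4) \<Rightarrow> (complex^2^2) \<times> (complex^2) \<times> (complex^2)" where
  "to_resolution z = res_param (fst z, tw_dir z)"

text \<open>With \<open>k = 2/\<pi> + \<bar>m\<bar>\<^sup>2\<close> for the pair \<open>m\<close> of vectors one has \<open>k = 2 / (\<pi> (1 - \<bar>x\<bar>\<^sup>2))\<close> on the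
  resolution. Hence \<open>\<surd>k = rscale x\<close> and \<open>conf x = (\<pi> k)\<^sup>2\<close>, and written in terms of \<open>k\<close> the
  formula is smooth on the whole ambient space.\<close>

definition of_resolution :: "(complex^2^2) \<times> (complex^2) \<times> (complex^2) \<Rightarrow> (real^4) \<times> (real^4^4)" where
  "of_resolution r = ((1 / sqrt (2 / pi + snd r \<bullet> snd r)) *\<^sub>R quat_of (snd r),
     ((pi * (2 / pi + snd r \<bullet> snd r))\<^sup>2 / sqrt 2) *\<^sub>R left_mult (bloch (fst r)))"

lemma to_resolution_tw_param [simp]: "x \<in> H4 \<Longrightarrow> to_resolution (tw_param (x, n)) = res_param (x, n)"
  by (simp add: to_resolution_def) (simp add: tw_param_def)

lemma half_scaleR: "half n (c *\<^sub>R x) = c *\<^sub>R half n x"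
  by (simp add: half_def linear_scale[OF bounded_linear.linear[OF bounded_linear_col1]] linear_scale[OF bounded_linear.linear[OF bounded_linear_col2]]
      bounded_bilinear.scaleR_right[OF bounded_bilinear_mult_vec])

lemma rscale_pos: "x \<in> H4 \<Longrightarrow> rscale x > 0"
  using ball_pos[of x] by (simp add: rscale_def)

lemma of_resolution_res_param:
  assumes x: "x \<in> H4" and n: "norm n = 1"
  shows "of_resolution (res_param (x, n)) = tw_param (x, n)"
proof -
  define w where "w = 1 - (norm x)\<^sup>2"
  have w: "w > 0" using ball_pos[OF x] by (simp add: w_def)
  have "snd (res_param (x, n)) \<bullet> snd (res_param (x, n)) = (rscale x)\<^sup>2 * (norm (half n x))\<^sup>2"
    unfolding power2_norm_eq_inner[symmetric] by (simp add: res_param_def power_mult_distrib)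
  also have "\<dots> = 2 / (pi * w) * (1 - w)"
    using w by (simp add: norm_half[OF n] rscale_def w_def[symmetric]) (simp add: w_def)
  finally have k: "2 / pi + snd (res_param (x, n)) \<bullet> snd (res_param (x, n)) = 2 / (pi * w)"
    using w by (simp add: field_simps)
  have "sqrt (2 / (pi * w)) = rscale x" by (simp add: rscale_def w_def)
  moreover have "(pi * (2 / (pi * w)))\<^sup>2 / sqrt 2 = fscale x"
    unfolding fscale_def conf_def w_def[symmetric] by (simp add: power_divide)
  ultimately show ?thesis
    unfolding of_resolution_def k tw_param_def using rscale_pos[OF x]
    by (simp add: res_param_def linear_scale[OF bounded_linear.linear[OF bounded_linear_quat_of]] quat_of_half)
qed

lemma resolution_param: "resolution = res_param ` (H4 \<times> sphere 0 1)"
proof (intro equalityI subsetI)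
  fix r assume "r \<in> resolution"
  then obtain n a b where r: "r = (proj n, (a, b))" and n: "norm n = 1" and ab: "proj n *v a = a" "proj n *v b = b"
    unfolding resolution_eq by blast
  define q where "q = quat_of (a, b)"
  define k where "k = 2 / pi + (norm q)\<^sup>2"
  have k: "k > 0" by (simp add: k_def add_pos_nonneg)
  define x where "x = (1 / sqrt k) *\<^sub>R q"
  have nx: "(norm x)\<^sup>2 = (norm q)\<^sup>2 / k"
    using k by (simp add: x_def power_mult_distrib power_divide)
  have w: "1 - (norm x)\<^sup>2 = 2 / pi / k"
    unfolding nx using k by (simp add: k_def field_simps)
  then have "(norm x)\<^sup>2 < 1" using k by (smt (verit) divide_pos_pos pi_gt_zero)
  then have x: "x \<in> H4" by (simp add: power_less_one_iff)
  have "rscale x = sqrt k" unfolding rscale_def w using k by simp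
  then have "res_param (x, n) = r"
    using k by (simp add: res_param_def x_def half_scaleR q_def half_quat_of[OF ab] r)
  with x n show "r \<in> res_param ` (H4 \<times> sphere 0 1)" by force
next
  fix r assume "r \<in> res_param ` (H4 \<times> sphere 0 1)"
  then obtain x n where r: "r = res_param (x, n)" "norm n = 1" by auto
  have "proj n *v (rscale x *\<^sub>R (proj n *v c)) = rscale x *\<^sub>R (proj n *v c)" for c
    by (simp add: bounded_bilinear.scaleR_right[OF bounded_bilinear_mult_vec] matrix_vector_mul_assoc proj_idem[OF r(2)])
  then show "r \<in> resolution"
    unfolding resolution_eq r(1) res_param_def half_def using r(2) by auto
qed

lemmas [smooth_intros] =
  smooth_on_linear[OF bounded_linear_dproj]
  smooth_on_linear[OF bounded_linear_col1]
  smooth_on_linear[OF bounded_linear_col2]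
  smooth_on_linear[OF bounded_linear_quat_of]
  smooth_on_linear[OF bounded_linear_bloch]
  smooth_on_bilinear[OF bounded_bilinear_mult_vec]

lemma smooth_on_to_resolution: "smooth_on (H4 \<times> UNIV) to_resolution"
proof -
  have "0 < pi * (1 - fst z \<bullet> fst z)" if "z \<in> H4 \<times> UNIV" for z :: "(real^4) \<times> (real^4^4)"
    using ball_pos[of "fst z"] that by (auto simp: power2_norm_eq_inner)
  then show ?thesis
    unfolding to_resolution_def[abs_def] res_param_def half_def rscale_def proj_dproj[of "tw_dir _"]
      fst_conv snd_conv power2_norm_eq_inner
    by (intro smooth_intros open_H4_UNIV smooth_on_tw_dir divide_pos_pos) auto
qed

lemma smooth_on_of_resolution: "smooth_on UNIV of_resolution"
proof -
  have "0 < 2 / pi + m \<bullet> m" for m :: "(complex^2) \<times> (complex^2)"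
    by (simp add: add_pos_nonneg)
  then show ?thesis
    unfolding of_resolution_def[abs_def] by (intro smooth_intros open_UNIV real_sqrt_gt_zero) auto
qed

lemma res_param_has_derivative:
  assumes "x \<in> H4"
  shows "(res_param has_derivative dres_param (x, n)) (at (x, n))"
proof -
  let ?p = "(x, n)"
  note id = has_derivative_ident[of "at ?p"]
  define w where "w = 1 - x \<bullet> x"
  have w: "w > 0" using ball_pos[OF assms] by (simp add: w_def power2_norm_eq_inner)
  have inner: "((\<lambda>p. 2 / (pi * (1 - fst p \<bullet> fst p))) has_derivative
      (\<lambda>u. - (2 * (inverse (pi * w) * (pi * - (x \<bullet> fst u + fst u \<bullet> x)) * inverse (pi * w))))) (at ?p)"
    using w unfolding w_def by (auto intro!: derivative_eq_intros simp: divide_inverse)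
  have "((\<lambda>p. rscale (fst p)) has_derivative (\<lambda>u. rscale x * (x \<bullet> fst u) / w)) (at ?p)"
  proof (rule has_derivative_eq_rhs)
    show "((\<lambda>p. rscale (fst p)) has_derivative
        (\<lambda>u. - (2 * (inverse (pi * w) * (pi * - (x \<bullet> fst u + fst u \<bullet> x)) * inverse (pi * w))) * (inverse (rscale x) / 2))) (at ?p)"
      unfolding rscale_def power2_norm_eq_inner w_def[symmetric]
      using has_derivative_real_sqrt[OF _ inner] w by (simp add: w_def)
    have "inverse (rscale x) = rscale x * (pi * w) / 2"
    proof -
      have "rscale x * rscale x = 2 / (pi * w)"
        using w by (simp add: rscale_def power2_norm_eq_inner w_def[symmetric])
      then show ?thesis using w rscale_pos[OF assms] by (simp add: field_simps)
    qed
    then show "(\<lambda>u. - (2 * (inverse (pi * w) * (pi * - (x \<bullet> fst u + fst u \<bullet> x)) * inverse (pi * w))) * (inverse (rscale x) / 2)) =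
        (\<lambda>u. rscale x * (x \<bullet> fst u) / w)"
      using w by (auto simp: fun_eq_iff inner_commute[of _ x] field_simps)
  qed
  then have r: "((\<lambda>p. rscale (fst p)) has_derivative (\<lambda>u. rscale x * (x \<bullet> fst u) / (1 - (norm x)\<^sup>2))) (at ?p)"
    by (simp add: w_def power2_norm_eq_inner)
  have pr: "((\<lambda>p. proj (snd p)) has_derivative (\<lambda>u. dproj (snd u))) (at ?p)"
    unfolding proj_dproj[of "snd _"]
    using has_derivative_add[OF has_derivative_const bounded_linear.has_derivative[OF bounded_linear_dproj has_derivative_snd[OF id]]]
    by simp
  note c1 = bounded_linear.has_derivative[OF bounded_linear_col1 has_derivative_fst[OF id]]
  note c2 = bounded_linear.has_derivative[OF bounded_linear_col2 has_derivative_fst[OF id]]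
  note mult = bounded_bilinear.FDERIV[OF bounded_bilinear_mult_vec pr]
  have h: "((\<lambda>p. half (snd p) (fst p)) has_derivative (\<lambda>u. dhalf (snd u) x + half n (fst u))) (at ?p)"
    unfolding half_def dhalf_def
    by (rule has_derivative_eq_rhs[OF has_derivative_Pair[OF mult[OF c1] mult[OF c2]]]) (simp add: fun_eq_iff add.commute)
  show ?thesis
    unfolding res_param_def[abs_def] dres_param_def[abs_def]
    by (rule has_derivative_eq_rhs[OF has_derivative_Pair[OF pr has_derivative_scaleR[OF r h]]])
      (simp add: fun_eq_iff add.commute)
qed

lemma omega_C4_add:
  "omega_C4 r (u + u') v = omega_C4 r u v + omega_C4 r u' v"
  "omega_C4 r v (u + u') = omega_C4 r v u + omega_C4 r v u'"
  by (simp_all add: omega_C4_def sum_2 algebra_simps)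

lemma omega_C4_scaleR:
  "omega_C4 r (c *\<^sub>R u) v = c * omega_C4 r u v"
  "omega_C4 r v (c *\<^sub>R u) = c * omega_C4 r v u"
  by (simp_all add: omega_C4_def sum_2 algebra_simps)

lemma omega_C4_skew: "omega_C4 r u v = - omega_C4 r v u"
  by (simp add: omega_C4_def sum_2 algebra_simps)

lemma quat_im_skew: "quat_im x y = - quat_im y x"
  by (simp add: quat_im_def vec_eq_iff forall_3)

lemma quat_im_self: "quat_im x x = 0"
  by (simp add: quat_im_def vec_eq_iff forall_3)

text \<open>The terms of \<open>omega_C4\<close> are those of \<open>- d\<langle>n, A\<rangle> / (2\<pi>)\<close>: the radial derivative of the factor
  corresponds to that of \<open>1 / (1 - \<bar>x\<bar>\<^sup>2)\<close> in \<open>A\<close>, the mixed terms are those with a derivative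
  of \<open>n\<close>, and the term in \<open>v\<^sub>1, v\<^sub>2\<close> comes from \<open>d (Im (dx x\<^sup>*))\<close>. The Fubini-Study form gives the area of the sphere.\<close>

lemma resolution_form_density:
  assumes x: "x \<in> H4" and n: "norm n = 1"
  shows "omega_C4 r (snd (dres_param (x, n) u\<^sub>1)) (snd (dres_param (x, n) u\<^sub>2))
      + omega_FS (proj n) (fst (dres_param (x, n) u\<^sub>1)) (fst (dres_param (x, n) u\<^sub>2))
    = twistor_density x n u\<^sub>1 u\<^sub>2 / (2 * pi)"
proof -
  define w where "w = 1 - (norm x)\<^sup>2"
  have w: "w > 0" using ball_pos[OF x] by (simp add: w_def)
  obtain v\<^sub>1 \<nu>\<^sub>1 v\<^sub>2 \<nu>\<^sub>2 where u: "u\<^sub>1 = (v\<^sub>1, \<nu>\<^sub>1)" "u\<^sub>2 = (v\<^sub>2, \<nu>\<^sub>2)" by (cases u\<^sub>1; cases u\<^sub>2) auto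
  have half_dhalf: "omega_C4 r (half n y) (dhalf \<nu> x) = - ((\<nu> \<bullet> quat_im x y) / 2)" for y \<nu>
    using omega_C4_skew[of r "half n y"] omega_dhalf_half by simp
  have f: "rscale x * rscale x = 2 / (pi * w)"
    using w by (simp add: rscale_def w_def[symmetric])
  let ?q = quat_im
  have base: "omega_C4 r (snd (dres_param (x, n) u\<^sub>1)) (snd (dres_param (x, n) u\<^sub>2)) =
      (rscale x * rscale x) * ((x \<bullet> v\<^sub>1) / w * (n \<bullet> ?q x v\<^sub>2) - (x \<bullet> v\<^sub>2) / w * (n \<bullet> ?q x v\<^sub>1)
        + (\<nu>\<^sub>1 \<bullet> ?q x v\<^sub>2) / 2 - (\<nu>\<^sub>2 \<bullet> ?q x v\<^sub>1) / 2 + n \<bullet> ?q v\<^sub>1 v\<^sub>2)"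
    unfolding dres_param_def u snd_conv fst_conv w_def[symmetric]
    by (simp add: omega_C4_add omega_C4_scaleR omega_half_half[OF n] half_dhalf omega_dhalf_half omega_dhalf_dhalf
        quat_im_self quat_im_skew[of v\<^sub>1 x] algebra_simps)
  have fibre: "omega_FS (proj n) (fst (dres_param (x, n) u\<^sub>1)) (fst (dres_param (x, n) u\<^sub>2)) = (n \<bullet> cross3 \<nu>\<^sub>1 \<nu>\<^sub>2) / (2 * pi)"
    by (simp add: dres_param_def u omega_FS_proj)
  have twistor: "twistor_density x n u\<^sub>1 u\<^sub>2 = n \<bullet> cross3 \<nu>\<^sub>1 \<nu>\<^sub>2 + 2 / w * (\<nu>\<^sub>1 \<bullet> ?q x v\<^sub>2) - 2 / w * (\<nu>\<^sub>2 \<bullet> ?q x v\<^sub>1)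
      + 4 * (x \<bullet> v\<^sub>1) / w\<^sup>2 * (n \<bullet> ?q x v\<^sub>2) - 4 * (x \<bullet> v\<^sub>2) / w\<^sup>2 * (n \<bullet> ?q x v\<^sub>1) + 4 / w * (n \<bullet> ?q v\<^sub>1 v\<^sub>2)"
    unfolding twistor_density_def u fst_conv snd_conv conn_def dconn_def w_def[symmetric]
      quat_im_skew[of v\<^sub>1 x] quat_im_skew[of v\<^sub>2 x] quat_im_skew[of v\<^sub>2 v\<^sub>1]
      inner_diff_right inner_add_right inner_scaleR_right inner_minus_right
    by simp
  show ?thesis
    unfolding base fibre twistor f using w by (simp add: field_simps power2_eq_square)
qed

text \<open>The derivative within \<open>M\<close> is an arbitrary choice off the tangent space, but on it every choice
  gives the ambient derivative.\<close>

lemma frechet_derivative_within_tangent: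
  assumes u: "u \<in> tangent_space M z" and f: "(f has_derivative f') (at z)"
  shows "frechet_derivative f (at z within M) u = f' u"
proof (rule tangent_derivative_unique[OF u open_UNIV UNIV_I])
  show "(f has_derivative f') (at z within M)" by (rule has_derivative_at_withinI[OF f])
  then show "(f has_derivative frechet_derivative f (at z within M)) (at z within M)"
    using frechet_derivative_works differentiable_def by blast
qed simp

lemma bij_betw_to_resolution: "bij_betw to_resolution (twistor_space H4 hyp_metric) resolution"
  and inv_to_resolution: "r \<in> resolution \<Longrightarrow> inv_into (twistor_space H4 hyp_metric) to_resolution r = of_resolution r"
proof -
  have left_inv: "of_resolution (to_resolution z) = z" if "z \<in> twistor_space H4 hyp_metric" for z
    using that unfolding twistor_space_hyp by (auto simp: of_resolution_res_param)
  then have inj: "inj_on to_resolution (twistor_space H4 hyp_metric)"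
    by (rule inj_on_inverseI)
  have im: "to_resolution ` twistor_space H4 hyp_metric = resolution"
    unfolding twistor_space_hyp resolution_param image_image
    by (rule image_cong) auto
  show "bij_betw to_resolution (twistor_space H4 hyp_metric) resolution"
    using inj im by (simp add: bij_betw_def)
  show "inv_into (twistor_space H4 hyp_metric) to_resolution r = of_resolution r" if "r \<in> resolution"
    using that im left_inv inj by (metis (no_types, lifting) imageE inv_into_f_f)
qed

lemma twistor_space_subset: "twistor_space H4 hyp_metric \<subseteq> H4 \<times> UNIV"
  by (auto simp: twistor_space_def)

lemma diffeomorphism_to_resolution: "diffeomorphism (twistor_space H4 hyp_metric) resolution to_resolution"
  unfolding diffeomorphism_def
proof (intro conjI)
  let ?Z = "twistor_space H4 hyp_metric"
  show bij: "bij_betw to_resolution ?Z resolution" by (rule bij_betw_to_resolution)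
  show "smooth_map ?Z resolution to_resolution"
    unfolding smooth_map_def
    using bij_betw_imp_surj_on[OF bij] twistor_space_subset open_H4_UNIV smooth_on_to_resolution by blast
  show "smooth_map resolution ?Z (inv_into ?Z to_resolution)"
    unfolding smooth_map_def
  proof (intro conjI ballI)
    show "inv_into ?Z to_resolution ` resolution \<subseteq> ?Z"
      using bij_betw_imp_surj_on[OF bij_betw_inv_into[OF bij]] by simp
    show "\<exists>O' F. open O' \<and> r \<in> O' \<and> smooth_on O' F \<and> (\<forall>x\<in>resolution \<inter> O'. F x = inv_into ?Z to_resolution x)" for r
      by (intro exI[of _ UNIV] exI[of _ of_resolution]) (simp add: smooth_on_of_resolution inv_to_resolution)
  qed
qed

theorem mainTheorem10:
  shows "symplectomorphic (twistor_space H4 hyp_metric) (twistor_form H4 hyp_metric)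
           resolution resolution_form"
  unfolding symplectomorphic_def
proof (intro exI conjI ballI)
  let ?Z = "twistor_space H4 hyp_metric"
  show "diffeomorphism ?Z resolution to_resolution" by (rule diffeomorphism_to_resolution)
  fix z u v assume z: "z \<in> ?Z" and u: "u \<in> tangent_space ?Z z" and v: "v \<in> tangent_space ?Z z"
  from z obtain x n where zxn: "z = tw_param (x, n)" and x: "x \<in> H4" and n: "norm n = 1"
    unfolding twistor_space_hyp by auto
  obtain w\<^sub>1 w\<^sub>2 where w: "u = dtw_param (x, n) w\<^sub>1" "v = dtw_param (x, n) w\<^sub>2" "n \<bullet> snd w\<^sub>1 = 0" "n \<bullet> snd w\<^sub>2 = 0"
    using u v unfolding zxn tangent_space_twistor[OF x n] by auto
  define T where "T = frechet_derivative to_resolution (at z)"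
  have T: "(to_resolution has_derivative T) (at z)"
    unfolding T_def using z twistor_space_subset
    by (intro smooth_on_has_derivative[OF open_H4_UNIV smooth_on_to_resolution]) blast
  \<comment> \<open>In coordinates the map is \<open>res_param\<close>, so the chain rule identifies its derivative.\<close>
  have Tw: "T (dtw_param (x, n) w) = dres_param (x, n) w" for w
  proof -
    have "((\<lambda>p. to_resolution (tw_param p)) has_derivative (\<lambda>w. T (dtw_param (x, n) w))) (at (x, n))"
      by (rule has_derivative_compose[OF tw_param_has_derivative]) (use x T in \<open>simp_all add: zxn\<close>)
    moreover have "((\<lambda>p. to_resolution (tw_param p)) has_derivative dres_param (x, n)) (at (x, n))"
      by (rule has_derivative_transform_within_open[OF res_param_has_derivative[OF x] open_H4_UNIV]) (use x in auto)
    ultimately show ?thesis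
      using has_derivative_unique by metis
  qed
  have image: "T t \<in> tangent_space resolution (to_resolution z)" if "t \<in> tangent_space ?Z z" for t
    by (rule tangent_space_image[OF that open_H4_UNIV smooth_on_to_resolution twistor_space_subset _ T])
      (use bij_betw_imp_surj_on[OF bij_betw_to_resolution] in blast)
  have deriv: "frechet_derivative to_resolution (at z within ?Z) t = T t" if "t \<in> tangent_space ?Z z" for t
    by (rule frechet_derivative_within_tangent[OF that T])
  have p: "frechet_derivative res_p (at (to_resolution z) within resolution) (T t) = snd (T t)"
    and q: "frechet_derivative res_q (at (to_resolution z) within resolution) (T t) = fst (T t)"
    if "t \<in> tangent_space ?Z z" for t
    unfolding res_p_def res_q_def
    by (rule frechet_derivative_within_tangent[OF image[OF that]];
        intro has_derivative_fst has_derivative_snd has_derivative_ident)+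
  have "res_q (to_resolution z) = proj n"
    using x by (simp add: zxn res_q_def res_param_def)
  then have "pullback ?Z to_resolution resolution_form z u v = twistor_density x n w\<^sub>1 w\<^sub>2 / (2 * pi)"
    unfolding pullback_def resolution_form_def deriv[OF u] deriv[OF v] p[OF u] p[OF v] q[OF u] q[OF v]
    by (simp add: w(1,2) Tw resolution_form_density[OF x n])
  also have "\<dots> = twistor_form H4 hyp_metric z u v"
    unfolding zxn w(1,2) by (rule twistor_form_hyp[OF x n w(3,4), symmetric])
  finally show "pullback ?Z to_resolution resolution_form z u v = twistor_form H4 hyp_metric z u v" .
qed

end
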